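(* For every integer $v$ with $v \equiv 2, 4 \pmod 6$ and $v > 4$, there exists a Steiner quadruple system of order $v$ that admits a $1$-ocycle.
   Context: A Steiner quadruple system of order $v$, or SQS($v$), is a pair $(X, \mathcal{B})$ where $X$ is a set with $|X| = v$ and $\mathcal{B}$ is a collection of $4$-element subsets of $X$ (called quadruples or blocks) such that every three distinct points of $X$ are contained in a unique quadruple of $\mathcal{B}$. A $1$-overlap cycle (or $1$-ocycle) for $(X,\mathcal{B})$ is a cyclic ordering $B_1, B_2, \ldots, B_m$ of all the blocks in $\mathcal{B}$ (each block listed exactly once, $m = |\mathcal{B}| \geq 1$), together with a way of writing each block $B_i$ as a string of length $4$ listing its four points in some order, such that for every $i$ (indices taken modulo $m$) the last letter of the string for $B_i$ equals the first letter of the string for $B_{i+1}$. The system admits a $1$-ocycle if such an ordering exists. *)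

theory Defs
  imports "HOL-Number_Theory.Cong"
begin

definition steiner_quadruple_system :: "nat \<Rightarrow> 'a set \<Rightarrow> 'a set set \<Rightarrow> bool" where
  "steiner_quadruple_system v X \<B> \<longleftrightarrow>
     finite X \<and> card X = v \<and>
     (\<forall>b\<in>\<B>. b \<subseteq> X \<and> card b = 4) \<and>
     (\<forall>x\<in>X. \<forall>y\<in>X. \<forall>z\<in>X. x \<noteq> y \<and> x \<noteq> z \<and> y \<noteq> z \<longrightarrow>
        (\<exists>!b. b \<in> \<B> \<and> {x, y, z} \<subseteq> b))"

definition string_of_block :: "'a set \<Rightarrow> 'a list \<Rightarrow> bool" where
  "string_of_block b s \<longleftrightarrow> length s = 4 \<and> distinct s \<and> set s = b"

(* Bs is the cyclic ordering of the blocks; ws ! i is the string chosen for Bs ! i.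
   Indices start at 0 and wrap around modulo the number of blocks. *)
definition one_ocycle :: "'a set set \<Rightarrow> 'a set list \<Rightarrow> 'a list list \<Rightarrow> bool" where
  "one_ocycle \<B> Bs ws \<longleftrightarrow>
     Bs \<noteq> [] \<and> distinct Bs \<and> set Bs = \<B> \<and>
     length ws = length Bs \<and>
     (\<forall>i<length Bs. string_of_block (Bs ! i) (ws ! i)) \<and>
     (\<forall>i<length Bs. last (ws ! i) = hd (ws ! (Suc i mod length Bs)))"

definition admits_one_ocycle :: "'a set set \<Rightarrow> bool" where
  "admits_one_ocycle \<B> \<longleftrightarrow> (\<exists>Bs ws. one_ocycle \<B> Bs ws)"

end

theory Submission
  imports Defs
begin

text \<open>Hanani's theorem provides a Steiner quadruple system of every order congruent to 2 or 4 modulo 6. It is proved by recursion: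
  the points are arranged in \<open>n\<close> groups of size \<open>g\<close> together with a stem of \<open>s\<close> points, the triples not inside
  a group plus the stem are covered by explicit blocks (a candelabra system), and each group plus the stem
  is filled with a smaller system. As the number of blocks is prescribed, it suffices that every triple is covered
  and that there are not too many blocks. The orders \<open>2u\<close>, \<open>3u - 2\<close>, \<open>3u - 4\<close>, \<open>3u - 8\<close>, \<open>4u - 6\<close> and
  \<open>12u - 10\<close> obtained in this way, together with the order 14, exhaust the admissible residue classes modulo 72.

  Every Steiner quadruple system of order \<open>v \<ge> 8\<close> then admits a 1-ocycle. Such a cycle is an Euler circuit of the
  multigraph given by the first and last letters of the strings, so it suffices to choose in each block a pair of points
  such that all degrees are even and the edges are connected. By Hall's theorem, blocks through a fixed point \<open>p\<close> can be
  spent to connect everything, and the blocks avoiding \<open>p\<close> leave enough freedom to correct the parities.\<close>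

section \<open>Counting blocks\<close>

text \<open>With the points of three groups read modulo \<open>g\<close>, every transversal triple
  has a sum. A block with a pair of difference \<open>d\<close> in one group and a point in each of
  the other two covers transversal triples of two sums that differ by \<open>d\<close>. So the pairs
  inside the groups compete with the stem for the \<open>g\<close> sums: each stem point takes one
  sum, the others are grouped in twos and settle some differences, and the remaining differences are
  left to one-factors. The choice of sums and differences is dictated by the count: in every
  construction the bound obtained for the number of blocks equals the prescribed number, so there is
  no slack.

  The order 14 has to be given outright. No admissible \<open>u\<close> yields it as 2u, 3u - 2, 3u
  - 4, 3u - 8 or 4u - 6, and as 12u - 10 it needs u = 2, where the system of order 14 is itself the
  ingredient that fills the groups.

  For order 4 there is no 1-ocycle, since the only string would have to end with its first letter.
  The next admissible order is 8.\<close>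

definition sqs_exists :: "nat \<Rightarrow> bool" where
  "sqs_exists v \<longleftrightarrow> (\<exists>(X :: nat set) \<B>. steiner_quadruple_system v X \<B>)"

lemma finite_blocks:
  assumes "steiner_quadruple_system v X \<B>"
  shows "finite \<B>"
  using assms unfolding steiner_quadruple_system_def
  by (meson PowI finite_Pow_iff rev_finite_subset subsetI)

lemma two_choose_two: "2 * (n choose 2) = n * (n - 1)"
  by (induction n) (auto simp: numeral_2_eq_2 algebra_simps)

lemma six_choose_three: "6 * (n choose 3) = n * (n - 1) * (n - 2)"
proof (induction n)
  case (Suc n)
  have "2 * (n choose 2) = n * (n - 1)"
    by (rule two_choose_two)
  then have "6 * (Suc n choose 3) = 3 * (n * (n - 1)) + n * (n - 1) * (n - 2)"
    using Suc by (simp add: numeral_3_eq_3 numeral_2_eq_2)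
  also have "\<dots> = Suc n * (Suc n - 1) * (Suc n - 2)"
  proof (cases n)
    case (Suc k)
    then show ?thesis by (cases k) (auto simp: algebra_simps)
  qed simp
  finally show ?case .
qed simp

text \<open>A block contains four triples, so the bound says that the blocks contain at most
  \<open>v choose 3\<close> triples in total, counted with multiplicity. Each triple occurs at least
  once, hence exactly once. This spares every later construction the proof of uniqueness.\<close>

lemma steiner_quadruple_system_by_counting:
  assumes fin: "finite X" and card: "card X = v"
    and blocks: "\<And>b. b \<in> \<B> \<Longrightarrow> b \<subseteq> X \<and> card b = 4"
    and cover: "\<And>x y z. \<lbrakk>x \<in> X; y \<in> X; z \<in> X; x \<noteq> y; x \<noteq> z; y \<noteq> z\<rbrakk> \<Longrightarrow> \<exists>b\<in>\<B>. {x, y, z} \<subseteq> b"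
    and count: "24 * card \<B> \<le> v * (v - 1) * (v - 2)"
  shows "steiner_quadruple_system v X \<B>"
proof -
  define T where "T = {t. t \<subseteq> X \<and> card t = 3}"
  define d where "d t = card {b \<in> \<B>. t \<subseteq> b}" for t
  have finB: "finite \<B>"
    using blocks fin by (meson PowI finite_Pow_iff rev_finite_subset subsetI)
  have finT: "finite T" using fin by (simp add: T_def)
  have cT: "card T = v choose 3" unfolding T_def using n_subsets[OF fin] card by simp
  have four: "card {t \<in> T. t \<subseteq> b} = 4" if "b \<in> \<B>" for b
  proof -
    have "{t \<in> T. t \<subseteq> b} = {t. t \<subseteq> b \<and> card t = 3}" using blocks[OF that] by (auto simp: T_def)
    moreover have "finite b" using blocks[OF that] by (metis card.infinite zero_neq_numeral)
    ultimately show ?thesis using n_subsets[of b 3] blocks[OF that]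
      by (simp add: numeral_3_eq_3 numeral_eq_Suc)
  qed
  have total: "(\<Sum>t\<in>T. d t) = 4 * card \<B>"
    unfolding d_def using sum_multicount_gen[OF finT finB, of "\<lambda>t b. t \<subseteq> b" "\<lambda>_. 4"] four by simp
  have ge1: "1 \<le> d t" if tT: "t \<in> T" for t
  proof -
    obtain x y z where t: "t = {x, y, z}" "x \<noteq> y" "x \<noteq> z" "y \<noteq> z"
      using tT unfolding T_def card_3_iff by auto
    then obtain b where "b \<in> \<B>" "t \<subseteq> b" using cover[of x y z] tT by (auto simp: T_def)
    then have "{b \<in> \<B>. t \<subseteq> b} \<noteq> {}" by blast
    then show ?thesis unfolding d_def using finB by (simp add: Suc_le_eq card_gt_0_iff)
  qed
  have "6 * (\<Sum>t\<in>T. d t) \<le> 6 * card T"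
    using count total cT six_choose_three[of v] by simp
  then have le: "(\<Sum>t\<in>T. d t) \<le> (\<Sum>t\<in>T. 1)" by simp
  have d1: "d t = 1" if "t \<in> T" for t
  proof (rule ccontr)
    assume "d t \<noteq> 1"
    then have "1 < d t" using ge1[OF that] by simp
    then have "(\<Sum>t\<in>T. 1) < (\<Sum>t\<in>T. d t)"
      using sum_strict_mono_ex1[OF finT, of "\<lambda>_. 1" d] ge1 that by blast
    then show False using le by simp
  qed
  show ?thesis
    unfolding steiner_quadruple_system_def
  proof (intro conjI ballI impI)
    fix x y z assume xyz: "x \<in> X" "y \<in> X" "z \<in> X" "x \<noteq> y \<and> x \<noteq> z \<and> y \<noteq> z"
    then have "{x, y, z} \<in> T" by (simp add: T_def)
    then have "card {b \<in> \<B>. {x, y, z} \<subseteq> b} = 1" using d1 unfolding d_def by blast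
    then obtain b where b: "{b \<in> \<B>. {x, y, z} \<subseteq> b} = {b}" by (rule card_1_singletonE)
    have "c \<in> \<B> \<and> {x, y, z} \<subseteq> c \<longleftrightarrow> c = b" for c
      using b by (metis (no_types, lifting) mem_Collect_eq singleton_iff)
    then show "\<exists>!b. b \<in> \<B> \<and> {x, y, z} \<subseteq> b" by (simp only: ex1_eq)
  qed (use fin card blocks in auto)
qed

lemma sqs_blockE:
  assumes "steiner_quadruple_system v X \<B>"
    and "x \<in> X" "y \<in> X" "z \<in> X" "x \<noteq> y" "x \<noteq> z" "y \<noteq> z"
  obtains b where "b \<in> \<B>" "x \<in> b" "y \<in> b" "z \<in> b"
proof -
  have "\<exists>!b. b \<in> \<B> \<and> {x, y, z} \<subseteq> b"
    using assms unfolding steiner_quadruple_system_def by simp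
  then show thesis using that by (auto dest: ex1_implies_ex)
qed

lemma sqs_block_unique:
  assumes "steiner_quadruple_system v X \<B>"
    and "x \<noteq> y" "x \<noteq> z" "y \<noteq> z" and b: "b \<in> \<B>" "{x, y, z} \<subseteq> b" and c: "c \<in> \<B>" "{x, y, z} \<subseteq> c"
  shows "b = c"
proof -
  have "b \<subseteq> X" using assms by (simp add: steiner_quadruple_system_def)
  then have "x \<in> X" "y \<in> X" "z \<in> X" using b by auto
  then have "\<exists>!b. b \<in> \<B> \<and> {x, y, z} \<subseteq> b"
    using assms(1-4) unfolding steiner_quadruple_system_def by simp
  then show ?thesis using b c by (elim ex1E) metis
qed

text \<open>Double counting of the sets \<open>t\<close> that complete \<open>Q\<close> to a triple:
  each lies with \<open>Q\<close> in one block, and each block through \<open>Q\<close> contains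
  \<open>4 - card Q\<close> of them. The cases of zero, one and two points are used.\<close>

lemma card_blocks_containing:
  assumes sqs: "steiner_quadruple_system v X \<B>" and Q: "Q \<subseteq> X" and q: "card Q \<le> 3"
  shows "card {b \<in> \<B>. Q \<subseteq> b} * (4 - card Q) = (v - card Q) choose (3 - card Q)"
proof -
  define T where "T = {t. t \<subseteq> X - Q \<and> card t = 3 - card Q}"
  define B where "B = {b \<in> \<B>. Q \<subseteq> b}"
  have fin: "finite X" and cX: "card X = v" and blocks: "\<And>b. b \<in> \<B> \<Longrightarrow> b \<subseteq> X \<and> card b = 4"
    using sqs by (auto simp: steiner_quadruple_system_def)
  have finQ: "finite Q" using Q fin by (rule finite_subset)
  have finB: "finite B" using finite_blocks[OF sqs] by (simp add: B_def)
  have finT: "finite T" using fin by (simp add: T_def)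
  have cT: "card T = (v - card Q) choose (3 - card Q)"
    unfolding T_def using n_subsets[of "X - Q"] fin cX Q finQ by (simp add: card_Diff_subset)
  have one: "card {b \<in> B. t \<subseteq> b} = 1" if "t \<in> T" for t
  proof -
    have "finite t" "Q \<inter> t = {}" using that fin finite_subset unfolding T_def by auto
    then have "card (Q \<union> t) = 3"
      using card_Un_disjoint[of Q t] finQ that q by (auto simp: T_def)
    moreover have "Q \<union> t \<subseteq> X" using that Q by (auto simp: T_def)
    moreover obtain x y z where xyz: "Q \<union> t = {x, y, z}" "x \<noteq> y" "x \<noteq> z" "y \<noteq> z"
      using calculation(1) unfolding card_3_iff by auto
    ultimately obtain b where b: "b \<in> \<B>" "Q \<union> t \<subseteq> b"
      using sqs_blockE[OF sqs, of x y z] by (metis insert_subset empty_subsetI)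
    have "b' = b" if "b' \<in> B" "t \<subseteq> b'" for b'
      using sqs_block_unique[OF sqs xyz(2-4), of b' b] b that by (simp add: B_def flip: xyz(1))
    moreover have "b \<in> B" "t \<subseteq> b" using b(1,2) by (auto simp: B_def)
    ultimately have "{b \<in> B. t \<subseteq> b} = {b}" by blast
    then show ?thesis by simp
  qed
  have many: "card {t \<in> T. t \<subseteq> b} = 4 - card Q" if "b \<in> B" for b
  proof -
    have b: "b \<subseteq> X" "card b = 4" "Q \<subseteq> b" using that blocks by (auto simp: B_def)
    have finb: "finite b" using b(1) fin by (rule finite_subset)
    have "{t \<in> T. t \<subseteq> b} = {t. t \<subseteq> b - Q \<and> card t = 3 - card Q}" using b by (auto simp: T_def)
    moreover have "card (b - Q) = 4 - card Q" using b finQ by (simp add: card_Diff_subset)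
    ultimately have "card {t \<in> T. t \<subseteq> b} = (4 - card Q) choose (3 - card Q)"
      using n_subsets[of "b - Q" "3 - card Q"] finb by simp
    also have "\<dots> = 4 - card Q"
    proof -
      have "4 - card Q = Suc (3 - card Q)" using q by simp
      then show ?thesis by (metis binomial_Suc_n)
    qed
    finally show ?thesis .
  qed
  have "(\<Sum>t\<in>T. card {b \<in> B. t \<subseteq> b}) = (\<Sum>b\<in>B. 4 - card Q)"
    by (rule sum_multicount_gen[OF finT finB]) (use many in auto)
  then show ?thesis using one cT by (simp add: B_def)
qed

lemma card_blocks:
  assumes "steiner_quadruple_system v X \<B>"
  shows "24 * card \<B> = v * (v - 1) * (v - 2)"
  using card_blocks_containing[OF assms, of "{}"] six_choose_three[of v] by simp

lemma card_blocks_point: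
  assumes "steiner_quadruple_system v X \<B>" "p \<in> X"
  shows "6 * card {b \<in> \<B>. p \<in> b} = (v - 1) * (v - 2)"
proof -
  have "card {b \<in> \<B>. p \<in> b} * 3 = (v - 1) choose 2"
    using card_blocks_containing[OF assms(1), of "{p}"] assms(2) by simp
  moreover have "2 * ((v - 1) choose 2) = (v - 1) * (v - 2)"
    using two_choose_two[of "v - 1"] by (simp add: numeral_2_eq_2)
  ultimately show ?thesis by linarith
qed

lemma card_blocks_pair:
  assumes "steiner_quadruple_system v X \<B>" "p \<in> X" "a \<in> X" "p \<noteq> a"
  shows "2 * card {b \<in> \<B>. p \<in> b \<and> a \<in> b} = v - 2"
  using card_blocks_containing[OF assms(1), of "{p, a}"] assms(2-) by (simp add: numeral_2_eq_2)

section \<open>Transport of systems along bijections\<close>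

lemma sqs_image:
  assumes sqs: "steiner_quadruple_system v X \<B>" and bij: "bij_betw f X Y"
  shows "steiner_quadruple_system v Y ((`) f ` \<B>)"
proof (rule steiner_quadruple_system_by_counting)
  have X: "finite X" "card X = v" and blocks: "\<And>b. b \<in> \<B> \<Longrightarrow> b \<subseteq> X \<and> card b = 4"
    using sqs by (auto simp: steiner_quadruple_system_def)
  have inj: "inj_on f X" and img: "f ` X = Y" using bij by (auto simp: bij_betw_def)
  show "finite Y" "card Y = v"
    using X bij_betw_finite[OF bij] bij_betw_same_card[OF bij] by auto
  show "c \<subseteq> Y \<and> card c = 4" if c: "c \<in> (`) f ` \<B>" for c
  proof -
    obtain b where b: "b \<in> \<B>" "c = f ` b" using c by auto
    then have "inj_on f b" using blocks[of b] inj inj_on_subset by blast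
    then have "card c = card b" using b card_image by blast
    then show ?thesis using b blocks[of b] img by auto
  qed
  show "\<exists>c\<in>(`) f ` \<B>. {x, y, z} \<subseteq> c"
    if xyz: "x \<in> Y" "y \<in> Y" "z \<in> Y" "x \<noteq> y" "x \<noteq> z" "y \<noteq> z" for x y z
  proof -
    obtain x' y' z' where "x' \<in> X" "y' \<in> X" "z' \<in> X" and f: "x = f x'" "y = f y'" "z = f z'"
      using xyz(1-3) img by blast
    moreover from f have "x' \<noteq> y'" "x' \<noteq> z'" "y' \<noteq> z'" using xyz(4-6) by auto
    ultimately obtain b where "b \<in> \<B>" "x' \<in> b" "y' \<in> b" "z' \<in> b"
      using sqs_blockE[OF sqs] by blast
    then show ?thesis using f by auto
  qed
  have "card ((`) f ` \<B>) \<le> card \<B>" by (rule card_image_le[OF finite_blocks[OF sqs]])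
  then show "24 * card ((`) f ` \<B>) \<le> v * (v - 1) * (v - 2)"
    unfolding card_blocks[OF sqs, symmetric] by simp
qed

lemma sqs_exists_onE:
  assumes "sqs_exists u" "finite Y" "card Y = u"
  obtains \<B> where "steiner_quadruple_system u Y \<B>"
proof -
  obtain X :: "nat set" and \<B> where X: "steiner_quadruple_system u X \<B>"
    using assms(1) by (auto simp: sqs_exists_def)
  then obtain f where "bij_betw f X Y"
    using finite_same_card_bij[of X Y] assms by (auto simp: steiner_quadruple_system_def)
  then show thesis using sqs_image[OF X] that by blast
qed

lemma sqs_existsI:
  assumes "steiner_quadruple_system v X \<B>"
  shows "sqs_exists v"
proof -
  have "finite X" "card X = v" using assms by (auto simp: steiner_quadruple_system_def)
  then obtain f where "bij_betw f X {..<v}"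
    using finite_same_card_bij[of X "{..<v}"] by auto
  then show ?thesis using sqs_image[OF assms] by (auto simp: sqs_exists_def)
qed

text \<open>Some block is moved onto \<open>Z\<close> by a permutation of \<open>Y\<close>. A stem
  of four points needs this: it must be a common block of all the systems filled in, because its
  triples may be covered only once.\<close>

lemma sqs_exists_on_blockE:
  assumes "sqs_exists u" "finite Y" "card Y = u" and Z: "Z \<subseteq> Y" "card Z = 4"
  obtains \<B> where "steiner_quadruple_system u Y \<B>" "Z \<in> \<B>"
proof -
  obtain \<B> where sqs: "steiner_quadruple_system u Y \<B>" using sqs_exists_onE assms by metis
  have finZ: "finite Z" using Z assms(2) finite_subset by blast
  obtain t where t: "t \<subseteq> Z" "card t = 3" using obtain_subset_with_card_n[of 3 Z] Z(2) by auto
  then obtain x y z where "{x, y, z} \<subseteq> Z" "x \<noteq> y" "x \<noteq> z" "y \<noteq> z"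
    unfolding card_3_iff by blast
  then obtain b where b: "b \<in> \<B>" using sqs_blockE[OF sqs, of x y z] Z by blast
  then have bY: "b \<subseteq> Y" "card b = 4" using sqs by (auto simp: steiner_quadruple_system_def)
  have finb: "finite b" using bY assms(2) finite_subset by blast
  obtain f where f: "bij_betw f b Z" using finite_same_card_bij[OF finb finZ] bY Z by auto
  have "card (Y - b) = card (Y - Z)" using bY Z finb finZ by (simp add: card_Diff_subset)
  then obtain g where g: "bij_betw g (Y - b) (Y - Z)"
    using finite_same_card_bij[of "Y - b" "Y - Z"] assms(2) by auto
  define h where "h x = (if x \<in> b then f x else g x)" for x
  have hf: "bij_betw h b Z" using f by (rule bij_betw_cong[THEN iffD1, rotated]) (simp add: h_def)
  moreover have "bij_betw h (Y - b) (Y - Z)"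
    using g by (rule bij_betw_cong[THEN iffD1, rotated]) (simp add: h_def)
  ultimately have "bij_betw h (b \<union> (Y - b)) (Z \<union> (Y - Z))"
    by (rule bij_betw_combine) blast
  moreover have "b \<union> (Y - b) = Y" "Z \<union> (Y - Z) = Y" using bY Z by auto
  ultimately have "bij_betw h Y Y" by simp
  then have "steiner_quadruple_system u Y ((`) h ` \<B>)" using sqs_image[OF sqs] by blast
  moreover have "Z \<in> (`) h ` \<B>" using b hf by (auto simp: bij_betw_def)
  ultimately show thesis using that by blast
qed

section \<open>Candelabra systems\<close>

datatype pt = Stem nat | Pt nat nat

definition pts :: "nat \<Rightarrow> nat \<Rightarrow> nat \<Rightarrow> pt set" where
  "pts n g s = Stem ` {..<s} \<union> (\<lambda>(i, a). Pt i a) ` ({..<n} \<times> {..<g})"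

definition covered :: "'a set set \<Rightarrow> 'a set \<Rightarrow> bool" where
  "covered C t \<longleftrightarrow> (\<exists>b\<in>C. t \<subseteq> b)"

text \<open>The bound is six times the number of triples to be covered, with four triples to a
  block. There are \<open>s * g * g\<close> triples for each pair of groups with a stem point,
  \<open>g * g * (g - 1)\<close> for each pair of groups without one, and \<open>g * g * g\<close>
  for each three groups. Integers avoid truncated subtraction in \<open>n - 2\<close> and in
  \<open>3 * s + 3 * g - 3\<close>.\<close>

definition candelabra :: "nat \<Rightarrow> nat \<Rightarrow> nat \<Rightarrow> pt set set \<Rightarrow> bool" where
  "candelabra n g s C \<longleftrightarrow>
     (\<forall>b\<in>C. b \<subseteq> pts n g s \<and> card b = 4) \<and>
     (\<forall>x<s. \<forall>i<n. \<forall>j<n. \<forall>a<g. \<forall>b<g. i \<noteq> j \<longrightarrow> covered C {Stem x, Pt i a, Pt j b}) \<and>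
     (\<forall>i<n. \<forall>j<n. \<forall>a<g. \<forall>a'<g. \<forall>b<g. i \<noteq> j \<longrightarrow> a \<noteq> a' \<longrightarrow> covered C {Pt i a, Pt i a', Pt j b}) \<and>
     (\<forall>i<n. \<forall>j<n. \<forall>k<n. \<forall>a<g. \<forall>b<g. \<forall>c<g. i \<noteq> j \<longrightarrow> i \<noteq> k \<longrightarrow> j \<noteq> k \<longrightarrow>
        covered C {Pt i a, Pt j b, Pt k c}) \<and>
     24 * int (card C) \<le> int n * (int n - 1) * int g * int g * (3 * int s + 3 * int g - 3 + (int n - 2) * int g)"

lemma mem_pts [simp]: "Stem x \<in> pts n g s \<longleftrightarrow> x < s" "Pt i a \<in> pts n g s \<longleftrightarrow> i < n \<and> a < g"
  by (auto simp: pts_def)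

lemma finite_pts [simp]: "finite (pts n g s)"
  by (simp add: pts_def)

lemma card_pts: "card (pts n g s) = n * g + s"
proof -
  have "card (Stem ` {..<s}) = s" by (simp add: card_image inj_on_def)
  moreover have "card ((\<lambda>(i, a). Pt i a) ` ({..<n} \<times> {..<g})) = n * g"
    by (subst card_image) (auto simp: inj_on_def)
  moreover have "Stem ` {..<s} \<inter> (\<lambda>(i, a). Pt i a) ` ({..<n} \<times> {..<g}) = {}" by auto
  ultimately show ?thesis unfolding pts_def by (subst card_Un_disjoint) auto
qed

lemma coveredI: "b \<in> C \<Longrightarrow> t \<subseteq> b \<Longrightarrow> covered C t"
  by (auto simp: covered_def)

lemma covered_Un: "covered (C \<union> D) t \<longleftrightarrow> covered C t \<or> covered D t"
  by (auto simp: covered_def)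

lemma pts_cases:
  assumes "x \<in> pts n g s"
  obtains k where "x = Stem k" "k < s" | i a where "x = Pt i a" "i < n" "a < g"
  using assms by (cases x) auto

lemma candelabraD:
  assumes "candelabra n g s C"
  shows "b \<in> C \<Longrightarrow> b \<subseteq> pts n g s" "b \<in> C \<Longrightarrow> card b = 4"
    and "\<lbrakk>x < s; i < n; j < n; a < g; b1 < g; i \<noteq> j\<rbrakk> \<Longrightarrow> covered C {Stem x, Pt i a, Pt j b1}"
    and "\<lbrakk>i < n; j < n; a < g; a' < g; b1 < g; i \<noteq> j; a \<noteq> a'\<rbrakk> \<Longrightarrow> covered C {Pt i a, Pt i a', Pt j b1}"
    and "\<lbrakk>i < n; j < n; k < n; a < g; b1 < g; c < g; i \<noteq> j; i \<noteq> k; j \<noteq> k\<rbrakk> \<Longrightarrow> covered C {Pt i a, Pt j b1, Pt k c}"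
    and "24 * int (card C) \<le> int n * (int n - 1) * int g * int g * (3 * int s + 3 * int g - 3 + (int n - 2) * int g)"
  using assms unfolding candelabra_def by simp_all

lemma candelabra_finite: "candelabra n g s C \<Longrightarrow> finite C"
  by (meson PowI candelabraD(1) finite_Pow_iff finite_pts rev_finite_subset subsetI)

lemma int_falling: "int (v * (v - 1) * (v - 2)) = int v * (int v - 1) * (int v - 2)"
proof -
  consider "v = 0" | "v = 1" | k where "v = Suc (Suc k)" by (metis One_nat_def not0_implies_Suc)
  then show ?thesis by cases (auto simp: algebra_simps)
qed

text \<open>The systems placed on the groups overlap only in the stem. A stem of at most two points
  contains no triple, and a stem of four points is made a block of each of them, so that in both
  cases no triple is paid for twice.\<close>

theorem candelabra_fill:
  assumes C: "candelabra n g s C" and sub: "sqs_exists (g + s)" and s: "s \<le> 2 \<or> s = 4" and n: "n > 0"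
  shows "sqs_exists (n * g + s)"
proof -
  define S where "S = Stem ` {..<s}"
  define Y where "Y i = S \<union> Pt i ` {..<g}" for i
  define E where "E = (if s = 4 then {S} else {})"
  have finY: "finite (Y i)" for i by (simp add: Y_def S_def)
  have cS: "card S = s" by (simp add: S_def card_image inj_on_def)
  have cY: "card (Y i) = g + s" for i
  proof -
    have "card (Pt i ` {..<g}) = g" by (simp add: card_image inj_on_def)
    moreover have "S \<inter> Pt i ` {..<g} = {}" by (auto simp: S_def)
    ultimately show ?thesis unfolding Y_def using cS by (subst card_Un_disjoint) (auto simp: S_def)
  qed
  have "\<exists>\<B>. steiner_quadruple_system (g + s) (Y i) \<B> \<and> E \<subseteq> \<B>" for i
  proof (cases "s = 4")
    case True
    then obtain \<B> where "steiner_quadruple_system (g + s) (Y i) \<B>" "S \<in> \<B>"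
      using sqs_exists_on_blockE[OF sub finY cY, of S] cS by (auto simp: Y_def)
    then show ?thesis by (auto simp: E_def)
  next
    case False
    then show ?thesis using sqs_exists_onE[OF sub finY cY] by (metis E_def empty_subsetI)
  qed
  then obtain F where F: "\<And>i. steiner_quadruple_system (g + s) (Y i) (F i)" and EF: "\<And>i. E \<subseteq> F i"
    by metis
  \<comment> \<open>The shared block is split off from each filling, so that summing over the groups
    counts it once and not \<open>n\<close> times.\<close>
  define D where "D = C \<union> E \<union> (\<Union>i<n. F i - E)"
  have inD: "F i \<subseteq> D" if "i < n" for i using that by (auto simp: D_def)
  have covY: "covered D {x, y, z}"
    if i: "i < n" and xyz: "x \<in> Y i" "y \<in> Y i" "z \<in> Y i" "x \<noteq> y" "x \<noteq> z" "y \<noteq> z" for i x y z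
  proof -
    obtain b where "b \<in> F i" "x \<in> b" "y \<in> b" "z \<in> b" using sqs_blockE[OF F xyz] by metis
    then show ?thesis using inD[OF i] by (auto simp: covered_def)
  qed
  have covC: "covered D t" if "covered C t" for t using that by (auto simp: covered_def D_def)
  have c1: "covered D {Stem x, Pt i a, Pt j b}" if "x < s" "i < n" "j < n" "a < g" "b < g" "i \<noteq> j" for x i j a b
    using covC[OF candelabraD(3)[OF C]] that by blast
  have c2: "covered D {Pt i a, Pt i a', Pt j b}"
    if "i < n" "j < n" "a < g" "a' < g" "b < g" "i \<noteq> j" "a \<noteq> a'" for i j a a' b
    using covC[OF candelabraD(4)[OF C]] that by blast
  have c3: "covered D {Pt i a, Pt j b, Pt k c}"
    if "i < n" "j < n" "k < n" "a < g" "b < g" "c < g" "i \<noteq> j" "i \<noteq> k" "j \<noteq> k" for i j k a b c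
    using covC[OF candelabraD(5)[OF C]] that by blast
  have perm: "covered D {x, y, z} \<Longrightarrow> covered D {y, x, z}" "covered D {x, y, z} \<Longrightarrow> covered D {y, z, x}"
    "covered D {x, y, z} \<Longrightarrow> covered D {z, x, y}" "covered D {x, y, z} \<Longrightarrow> covered D {x, z, y}"
    "covered D {x, y, z} \<Longrightarrow> covered D {z, y, x}" for x y z
    by (simp_all add: insert_commute)
  have Y1: "Stem k \<in> Y i \<longleftrightarrow> k < s" "Pt j a \<in> Y i \<longleftrightarrow> j = i \<and> a < g" for i j k a
    by (auto simp: Y_def S_def)
  have two: "covered D {Stem k, Pt i a, Pt j b}"
    if "k < s" "i < n" "a < g" "j < n" "b < g" "Pt i a \<noteq> Pt j b" for k i j a b
  proof (cases "i = j")
    case True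
    then show ?thesis using covY[of i "Stem k" "Pt i a" "Pt j b"] that by (auto simp: Y1)
  qed (use c1 that in auto)
  have three: "covered D {Pt i a, Pt j b, Pt k c}"
    if "i < n" "a < g" "j < n" "b < g" "k < n" "c < g" "Pt i a \<noteq> Pt j b" "Pt i a \<noteq> Pt k c" "Pt j b \<noteq> Pt k c"
    for i j k a b c
  proof -
    consider "i = j" "j = k" | "i = j" "j \<noteq> k" | "i = k" "i \<noteq> j" | "j = k" "i \<noteq> j" | "i \<noteq> j" "i \<noteq> k" "j \<noteq> k"
      by blast
    then show ?thesis
    proof cases
      case 1
      then show ?thesis using covY[of i "Pt i a" "Pt j b" "Pt k c"] that by (auto simp: Y1)
    next
      case 2
      then show ?thesis using c2[of i k a b c] that by auto
    next
      case 3
      then show ?thesis using c2[of i j a c b] that by (auto intro: perm)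
    next
      case 4
      then show ?thesis using c2[of j i b c a] that by (auto intro: perm)
    qed (use c3 that in auto)
  qed
  have cover: "covered D {x, y, z}"
    if xyz: "x \<in> pts n g s" "y \<in> pts n g s" "z \<in> pts n g s" "x \<noteq> y" "x \<noteq> z" "y \<noteq> z" for x y z
    using xyz(1)
  proof (cases rule: pts_cases)
    case x: (1 k)
    show ?thesis using xyz(2)
    proof (cases rule: pts_cases)
      case y: (1 l)
      show ?thesis using xyz(3)
      proof (cases rule: pts_cases)
        case (1 m)
        then show ?thesis using x y xyz n covY[of 0 x y z] by (auto simp: Y1)
      next
        case (2 i a)
        then show ?thesis using x y xyz covY[of i x y z] by (auto simp: Y1)
      qed
    next
      case y: (2 i a)
      show ?thesis using xyz(3)
      proof (cases rule: pts_cases)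
        case (1 m)
        then show ?thesis using x y xyz covY[of i x y z] by (auto simp: Y1)
      next
        case (2 j b)
        then show ?thesis using x y xyz two by auto
      qed
    qed
  next
    case x: (2 i a)
    show ?thesis using xyz(2)
    proof (cases rule: pts_cases)
      case y: (1 l)
      show ?thesis using xyz(3)
      proof (cases rule: pts_cases)
        case (1 m)
        then show ?thesis using x y xyz covY[of i x y z] by (auto simp: Y1)
      next
        case (2 j b)
        then have "covered D {y, x, z}" using x y xyz two by auto
        then show ?thesis by (rule perm)
      qed
    next
      case y: (2 j b)
      show ?thesis using xyz(3)
      proof (cases rule: pts_cases)
        case (1 m)
        then have "covered D {z, x, y}" using x y xyz two by auto
        then show ?thesis by (rule perm)
      next
        case (2 k c)
        then show ?thesis using x y xyz three by auto
      qed
    qed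
  qed
  define v where "v = n * g + s"
  have "steiner_quadruple_system v (pts n g s) D"
  proof (rule steiner_quadruple_system_by_counting)
    show "finite (pts n g s)" "card (pts n g s) = v" by (simp_all add: card_pts v_def)
    have Ysub: "Y i \<subseteq> pts n g s" if "i < n" for i using that by (auto simp: Y_def S_def)
    show "b \<subseteq> pts n g s \<and> card b = 4" if "b \<in> D" for b
      using that unfolding D_def
    proof (elim UnE UN_E)
      assume "b \<in> C" then show ?thesis using candelabraD(1,2)[OF C] by blast
    next
      assume "b \<in> E" then show ?thesis using cS by (auto simp: E_def S_def split: if_splits)
    next
      fix i assume i: "i \<in> {..<n}" "b \<in> F i - E"
      then have "b \<subseteq> Y i" "card b = 4" using F[of i] by (auto simp: steiner_quadruple_system_def)
      then show ?thesis using Ysub[of i] i by auto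
    qed
    show "\<exists>b\<in>D. {x, y, z} \<subseteq> b"
      if "x \<in> pts n g s" "y \<in> pts n g s" "z \<in> pts n g s" "x \<noteq> y" "x \<noteq> z" "y \<noteq> z" for x y z
      using cover[OF that] by (simp add: covered_def)
    define e where "e = card E"
    have finF: "finite (F i)" for i using finite_blocks[OF F] .
    have finE: "finite E" by (simp add: E_def)
    have cF: "24 * int (card (F i - E)) = int (g + s) * (int (g + s) - 1) * (int (g + s) - 2) - 24 * int e" for i
    proof -
      have "card (F i - E) = card (F i) - card E" using EF finE by (simp add: card_Diff_subset)
      moreover have "card E \<le> card (F i)" using EF finF by (simp add: card_mono)
      ultimately have "int (card (F i - E)) = int (card (F i)) - int e" by (simp add: e_def of_nat_diff)
      moreover have "24 * int (card (F i)) = int (g + s) * (int (g + s) - 1) * (int (g + s) - 2)"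
        using card_blocks[OF F[of i]] int_falling[of "g + s"] by linarith
      ultimately show ?thesis by simp
    qed
    \<comment> \<open>This equation restricts the stem: \<open>E\<close> must have as many blocks as
      a quadruple system on the stem would, which is none for 0, 1, 2 points and one for 4
      points.\<close>
    have e: "24 * int e = int s * (int s - 1) * (int s - 2)"
    proof -
      have "s = 0 \<or> s = 1 \<or> s = 2 \<or> s = 4" using s by auto
      then show ?thesis by (auto simp: e_def E_def)
    qed
    have "card (\<Union>i<n. F i - E) \<le> (\<Sum>i<n. card (F i - E))" by (rule card_UN_le) simp
    then have "24 * int (card (\<Union>i<n. F i - E)) \<le> (\<Sum>i<n. 24 * int (card (F i - E)))"
      by (simp flip: sum_distrib_left of_nat_sum)
    also have "\<dots> = int n * (int (g + s) * (int (g + s) - 1) * (int (g + s) - 2) - 24 * int e)"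
      by (simp only: cF) simp
    finally have "24 * int (card (\<Union>i<n. F i - E)) \<le> \<dots>" .
    moreover have "card D \<le> card C + card E + card (\<Union>i<n. F i - E)"
      unfolding D_def by (meson add_le_mono card_Un_le le_trans order_refl)
    moreover have "24 * int (card C) \<le> int n * (int n - 1) * int g * int g * (3 * int s + 3 * int g - 3 + (int n - 2) * int g)"
      by (rule candelabraD(6)[OF C])
    ultimately have "24 * int (card D) \<le>
        int n * (int n - 1) * int g * int g * (3 * int s + 3 * int g - 3 + (int n - 2) * int g) + 24 * int e
        + int n * (int (g + s) * (int (g + s) - 1) * (int (g + s) - 2) - 24 * int e)"
      by (simp add: e_def)
    \<comment> \<open>The identity states that the triples of all points split into those of the
      candelabra, those inside the stem, and those inside a group plus the stem but not inside the
      stem.\<close>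
    also have "\<dots> = int v * (int v - 1) * (int v - 2)"
      unfolding e v_def by (simp add: algebra_simps)
    also have "\<dots> = int (v * (v - 1) * (v - 2))" by (rule int_falling[symmetric])
    finally show "24 * card D \<le> v * (v - 1) * (v - 2)" by linarith
  qed
  then show ?thesis unfolding v_def by (rule sqs_existsI)
qed

section \<open>One-factors and doubling\<close>

text \<open>A one-factor of the complete graph on \<open>A\<close>, encoded as the map that
  exchanges the two ends of each edge.\<close>

definition involution_on :: "'a set \<Rightarrow> ('a \<Rightarrow> 'a) \<Rightarrow> bool" where
  "involution_on A f \<longleftrightarrow> (\<forall>a\<in>A. f a \<in> A \<and> f a \<noteq> a \<and> f (f a) = a)"

definition pairs :: "'a set \<Rightarrow> ('a \<Rightarrow> 'a) \<Rightarrow> 'a set set" where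
  "pairs A f = (\<lambda>a. {a, f a}) ` A"

lemma card_pairs:
  assumes "finite A" "involution_on A f"
  shows "2 * card (pairs A f) = card A"
proof -
  have "card (\<Union>(pairs A f)) = sum card (pairs A f)"
  proof (rule card_Union_disjoint)
    show "pairwise disjnt (pairs A f)"
    proof (rule pairwiseI)
      fix d e assume "d \<in> pairs A f" "e \<in> pairs A f" "d \<noteq> e"
      then obtain a b where "a \<in> A" "b \<in> A" and de: "d = {a, f a}" "e = {b, f b}" "d \<noteq> e"
        by (auto simp: pairs_def)
      then have "f (f a) = a" "f (f b) = b" using assms(2) by (auto simp: involution_on_def)
      then have "a \<noteq> b" "a \<noteq> f b" "f a \<noteq> b" "f a \<noteq> f b" using de by (metis insert_commute)+
      then show "disjnt d e" using de by (auto simp: disjnt_def)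
    qed
  qed (auto simp: pairs_def)
  also have "\<dots> = (\<Sum>e\<in>pairs A f. 2)"
    by (rule sum.cong) (use assms(2) in \<open>auto simp: pairs_def involution_on_def card_insert_if\<close>)
  also have "\<Union>(pairs A f) = A" using assms(2) by (auto simp: pairs_def involution_on_def)
  finally show ?thesis by simp
qed

text \<open>Each edge of a factor in group \<open>i\<close> is joined with each edge of the same
  factor in group \<open>j\<close>. A pair in one group and a point of the other then lie in the
  block given by the factor of the pair and the partner of the point. The sets \<open>A k\<close>
  may be smaller than the group; this serves the groups of size 12.\<close>

definition cross :: "'k set \<Rightarrow> ('k \<Rightarrow> nat set) \<Rightarrow> ('k \<Rightarrow> nat \<Rightarrow> nat) \<Rightarrow> nat \<Rightarrow> nat \<Rightarrow> pt set set" where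
  "cross K A f i j = (\<Union>k\<in>K. (\<lambda>(d, e). Pt i ` d \<union> Pt j ` e) ` (pairs (A k) (f k) \<times> pairs (A k) (f k)))"

lemma card_cross:
  assumes "finite K" "\<And>k. k \<in> K \<Longrightarrow> finite (A k) \<and> card (A k) = h \<and> involution_on (A k) (f k)"
  shows "4 * card (cross K A f i j) \<le> card K * (h * h)"
proof -
  have "4 * card ((\<lambda>(d, e). Pt i ` d \<union> Pt j ` e) ` (pairs (A k) (f k) \<times> pairs (A k) (f k))) \<le> h * h"
    if k: "k \<in> K" for k
  proof -
    let ?P = "pairs (A k) (f k)"
    have fin: "finite ?P" using assms(2)[OF k] by (simp add: pairs_def)
    have "card ((\<lambda>(d, e). Pt i ` d \<union> Pt j ` e) ` (?P \<times> ?P)) \<le> card ?P * card ?P"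
      using card_image_le[of "?P \<times> ?P"] fin by (simp add: card_cartesian_product)
    then have "4 * card ((\<lambda>(d, e). Pt i ` d \<union> Pt j ` e) ` (?P \<times> ?P)) \<le> (2 * card ?P) * (2 * card ?P)"
      by simp
    then show ?thesis using card_pairs[of "A k" "f k"] assms(2)[OF k] by simp
  qed
  then have "(\<Sum>k\<in>K. 4 * card ((\<lambda>(d, e). Pt i ` d \<union> Pt j ` e) ` (pairs (A k) (f k) \<times> pairs (A k) (f k)))) \<le> (\<Sum>k\<in>K. h * h)"
    by (rule sum_mono)
  moreover have "card (cross K A f i j) \<le> (\<Sum>k\<in>K. card ((\<lambda>(d, e). Pt i ` d \<union> Pt j ` e) ` (pairs (A k) (f k) \<times> pairs (A k) (f k))))"
    unfolding cross_def by (rule card_UN_le[OF assms(1)])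
  ultimately show ?thesis by (simp flip: sum_distrib_left)
qed

lemma cross_block:
  assumes "b \<in> cross K A f i j" "i \<noteq> j" "i < n" "j < n"
    and "\<And>k. k \<in> K \<Longrightarrow> A k \<subseteq> {..<g} \<and> involution_on (A k) (f k)"
  shows "b \<subseteq> pts n g s \<and> card b = 4"
proof -
  obtain k a c where k: "k \<in> K" "a \<in> A k" "c \<in> A k" and b: "b = {Pt i a, Pt i (f k a), Pt j c, Pt j (f k c)}"
    using assms(1) unfolding cross_def pairs_def by (auto simp: insert_commute)
  have "f k a \<in> A k" "f k a \<noteq> a" "f k c \<in> A k" "f k c \<noteq> c"
    using assms(5)[OF k(1)] k by (auto simp: involution_on_def)
  then show ?thesis using assms(2-4) assms(5)[OF k(1)] k b by (auto simp: card_insert_if)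
qed

lemma cross_covered:
  assumes "k \<in> K" "involution_on (A k) (f k)" "a \<in> A k" "b \<in> A k"
  shows "covered (cross K A f i j) {Pt i a, Pt i (f k a), Pt j b}"
    and "covered (cross K A f i j) {Pt j a, Pt j (f k a), Pt i b}"
proof -
  have "Pt i ` {a, f k a} \<union> Pt j ` {b, f k b} \<in> cross K A f i j"
    "Pt i ` {b, f k b} \<union> Pt j ` {a, f k a} \<in> cross K A f i j"
    unfolding cross_def pairs_def using assms by blast+
  then show "covered (cross K A f i j) {Pt i a, Pt i (f k a), Pt j b}"
    "covered (cross K A f i j) {Pt j a, Pt j (f k a), Pt i b}"
    by (blast intro: coveredI)+
qed

text \<open>The points of \<open>{..<2 * m}\<close> are read as two copies of the integers modulo \<open>m\<close>, the even and the
  odd numbers. For \<open>k < m\<close> the map matches the points whose sum is a constant within each copy, and the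
  remaining points by an edge between the copies of offset \<open>d\<close>; for \<open>k = m + c\<close> it matches the two copies
  with offset \<open>c\<close>.\<close>

definition factor :: "nat \<Rightarrow> nat \<Rightarrow> nat \<Rightarrow> nat \<Rightarrow> nat" where
  "factor m d k a = (let x = a div 2 in
     if k < m then
       if even a then
         if (k + m - x) mod m = x then 2 * ((x + d) mod m) + 1 else 2 * ((k + m - x) mod m)
       else
         if (k + 2 * d + m - x) mod m = x then 2 * ((x + (m - d)) mod m) else 2 * ((k + 2 * d + m - x) mod m) + 1
     else if even a then 2 * ((x + (k - m)) mod m) + 1 else 2 * ((x + (m - (k - m))) mod m))"

lemma sub_mod_iff:
  fixes x y m :: nat
  assumes "x < m" "y < m"
  shows "(k + m - x) mod m = y \<longleftrightarrow> (x + y) mod m = k mod m"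
proof
  assume "(k + m - x) mod m = y"
  then have "(x + y) mod m = (x + (k + m - x)) mod m" by (metis mod_add_right_eq)
  then show "(x + y) mod m = k mod m" using assms by simp
next
  assume *: "(x + y) mod m = k mod m"
  have "(k + m - x) mod m = (k + (m - x)) mod m" using assms by simp
  also have "\<dots> = ((x + y) + (m - x)) mod m" using * by (metis mod_add_left_eq)
  also have "\<dots> = y" using assms by simp
  finally show "(k + m - x) mod m = y" .
qed

lemma add_mod_iff:
  fixes x y m :: nat
  assumes "x < m" "y < m" "c \<le> m"
  shows "(x + c) mod m = y \<longleftrightarrow> (y + (m - c)) mod m = x"
proof
  assume "(x + c) mod m = y"
  then have "(y + (m - c)) mod m = (x + c + (m - c)) mod m" by (metis mod_add_left_eq)
  then show "(y + (m - c)) mod m = x" using assms by simp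
next
  assume "(y + (m - c)) mod m = x"
  then have "(x + c) mod m = (y + (m - c) + c) mod m" by (metis mod_add_left_eq)
  then show "(x + c) mod m = y" using assms by simp
qed

lemma factor_lt:
  assumes "m > 0" shows "factor m d k a < 2 * m"
proof -
  have "2 * (z mod m) + 1 < 2 * m" "2 * (z mod m) < 2 * m" for z
    using mod_less_divisor[OF assms, of z] by linarith+
  then show ?thesis by (simp add: factor_def Let_def)
qed

lemma factor_even:
  assumes "k < m" "x < m" "y < m" "x \<noteq> y" "(x + y) mod m = k mod m"
  shows "factor m d k (2 * x) = 2 * y"
  using assms sub_mod_iff[of x m y k] by (auto simp: factor_def)

lemma factor_odd:
  assumes "k < m" "x < m" "y < m" "x \<noteq> y" "(x + y) mod m = (k + 2 * d) mod m"
  shows "factor m d k (2 * x + 1) = 2 * y + 1"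
  using assms sub_mod_iff[of x m y "k + 2 * d"] by (auto simp: factor_def)

text \<open>The reflections \<open>k - x\<close> of the even copy and \<open>k + 2 * d - x\<close>
  of the odd copy have fixed points that correspond under \<open>x \<mapsto> x + d\<close>, which is
  why the second constant is shifted by \<open>2 * d\<close>. Joining corresponding fixed points
  completes the factor and uses up the edges of offset \<open>d\<close>.\<close>

lemma factor_special:
  assumes "k < m" "x < m" "y < m" "d < m" "y = (x + d) mod m" "(x + x) mod m = k mod m"
  shows "factor m d k (2 * x) = 2 * y + 1" "factor m d k (2 * y + 1) = 2 * x"
proof -
  show "factor m d k (2 * x) = 2 * y + 1"
    using assms sub_mod_iff[of x m x k] by (auto simp: factor_def)
  have "(y + y) mod m = ((x + d) + (x + d)) mod m" using assms by (metis mod_add_eq)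
  also have "(x + d) + (x + d) = (x + x) + 2 * d" by simp
  also have "((x + x) + 2 * d) mod m = (k + 2 * d) mod m" using assms by (metis mod_add_left_eq)
  finally have "(k + 2 * d + m - y) mod m = y" using assms sub_mod_iff[of y m y "k + 2 * d"] by simp
  then show "factor m d k (2 * y + 1) = 2 * x"
    using assms add_mod_iff[of x m y d] by (simp add: factor_def)
qed

lemma factor_offset:
  assumes "c < m" "x < m" "y < m" "y = (x + c) mod m"
  shows "factor m d (m + c) (2 * x) = 2 * y + 1" "factor m d (m + c) (2 * y + 1) = 2 * x"
  using assms add_mod_iff[of x m y c] by (auto simp: factor_def)

lemma involution_factor:
  assumes "d < m" "k < 2 * m"
  shows "involution_on {..<2 * m} (factor m d k)"
  unfolding involution_on_def
proof
  fix a assume "a \<in> {..<2 * m}"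
  then have a: "a < 2 * m" by simp
  define x where "x = a div 2"
  have x: "x < m" using a by (simp add: x_def less_mult_imp_div_less mult.commute)
  have m: "m > 0" using x by simp
  have odd_even: "Suc (2 * p) \<noteq> 2 * q" "2 * q \<noteq> Suc (2 * p)" for p q :: nat by presburger+
  have "factor m d k a \<noteq> a \<and> factor m d k (factor m d k a) = a"
  proof (cases "k < m")
    case k: True
    show ?thesis
    proof (cases "even a")
      case True
      then have ax: "a = 2 * x" by (simp add: x_def)
      define y where "y = (k + m - x) mod m"
      have y: "y < m" "(x + y) mod m = k mod m"
        using m sub_mod_iff[OF x, of y k] by (simp_all add: y_def)
      show ?thesis
      proof (cases "y = x")
        case True
        then show ?thesis using factor_special[OF k x _ assms(1), of "(x + d) mod m"] y m ax odd_even by auto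
      next
        case False
        then show ?thesis using factor_even[OF k x y(1)] factor_even[OF k y(1) x] y ax by (auto simp: add.commute)
      qed
    next
      case False
      then have ax: "a = 2 * x + 1" by (simp add: x_def)
      define y where "y = (k + 2 * d + m - x) mod m"
      have y: "y < m" "(x + y) mod m = (k + 2 * d) mod m"
        using m sub_mod_iff[OF x, of y "k + 2 * d"] by (simp_all add: y_def)
      show ?thesis
      proof (cases "y = x")
        case True
        define z where "z = (x + (m - d)) mod m"
        have z: "z < m" "(z + d) mod m = x" using add_mod_iff[of z m x d] x m assms(1) by (auto simp: z_def)
        have "(z + z) mod m = (x + (m - d) + (x + (m - d))) mod m" by (metis z_def mod_add_eq)
        also have "x + (m - d) + (x + (m - d)) = x + y + 2 * (m - d)" using True by simp
        also have "(x + y + 2 * (m - d)) mod m = (k + 2 * d + 2 * (m - d)) mod m" using y(2) by (metis mod_add_left_eq)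
        also have "k + 2 * d + 2 * (m - d) = k + 2 * m" using assms(1) by simp
        finally have "(z + z) mod m = k mod m" by simp
        then show ?thesis using factor_special[OF k z(1) x assms(1)] z ax odd_even by auto
      next
        case False
        then show ?thesis using factor_odd[OF k x y(1)] factor_odd[OF k y(1) x] y ax by (auto simp: add.commute)
      qed
    qed
  next
    case False
    define c where "c = k - m"
    have c: "k = m + c" "c < m" using False assms by (auto simp: c_def)
    show ?thesis
    proof (cases "even a")
      case True
      then have ax: "a = 2 * x" by (simp add: x_def)
      show ?thesis using factor_offset[OF c(2) x, of "(x + c) mod m"] m ax c odd_even by auto
    next
      case False
      then have ax: "a = 2 * x + 1" by (simp add: x_def)
      define z where "z = (x + (m - c)) mod m"
      have z: "z < m" "(z + c) mod m = x" using add_mod_iff[of z m x c] x m c(2) by (auto simp: z_def)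
      then show ?thesis using factor_offset[OF c(2) z(1) x] ax c odd_even by auto
    qed
  qed
  then show "factor m d k a \<in> {..<2 * m} \<and> factor m d k a \<noteq> a \<and> factor m d k (factor m d k a) = a"
    using factor_lt[OF m] by simp
qed

text \<open>The graph that the factors decompose. In terms of differences modulo
  \<open>2 * m\<close>, it has all even differences, and an edge from an even to an odd point has
  difference \<open>2 * c + 1\<close> for an offset \<open>c\<close> in \<open>J\<close>. Its degree
  is \<open>m - 1 + card J\<close>.\<close>

definition joined :: "nat \<Rightarrow> nat set \<Rightarrow> nat \<Rightarrow> nat \<Rightarrow> bool" where
  "joined m J a b \<longleftrightarrow> (even a \<longleftrightarrow> even b) \<or>
     (even a \<and> odd b \<and> (b div 2 + (m - a div 2)) mod m \<in> J) \<or>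
     (odd a \<and> even b \<and> (a div 2 + (m - b div 2)) mod m \<in> J)"

lemma factor_covers:
  assumes J: "J \<subseteq> {..<m}" "d \<in> J" and ab: "a < 2 * m" "b < 2 * m" "a \<noteq> b" "joined m J a b"
  shows "\<exists>k \<in> {..<m} \<union> (+) m ` (J - {d}). factor m d k a = b"
proof -
  define x where "x = a div 2"
  define y where "y = b div 2"
  have xy: "x < m" "y < m" using ab by (auto simp: x_def y_def less_mult_imp_div_less mult.commute)
  have d: "d < m" using J by auto
  define K where "K = {..<m} \<union> (+) m ` (J - {d})"
  have offs: "\<exists>k\<in>K. factor m d k (2 * x) = 2 * y + 1 \<and> factor m d k (2 * y + 1) = 2 * x"
    if x: "x < m" and y: "y < m" and c: "(y + (m - x)) mod m \<in> J" for x y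
  proof -
    define c where "c = (y + (m - x)) mod m"
    have c: "c \<in> J" "c < m" using c J by (auto simp: c_def)
    have "(c + x) mod m = y" using add_mod_iff[of c m y x] x y c by (auto simp: c_def)
    then have yc: "y = (x + c) mod m" by (simp add: add.commute)
    show ?thesis
    proof (cases "c = d")
      case True
      then show ?thesis using factor_special[of "(x + x) mod m" m x y d] x y yc d
        by (intro bexI[of _ "(x + x) mod m"]) (auto simp: K_def)
    next
      case False
      then show ?thesis using factor_offset[OF c(2) x y yc, of d] c
        by (intro bexI[of _ "m + c"]) (auto simp: K_def)
    qed
  qed
  consider "even a" "even b" | "odd a" "odd b" | "even a" "odd b" | "odd a" "even b" by blast
  then have "\<exists>k\<in>K. factor m d k a = b"
  proof cases
    case 1
    then have "a = 2 * x" "b = 2 * y" by (auto simp: x_def y_def)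
    then show ?thesis using factor_even[of "(x + y) mod m" m x y d] xy ab
      by (intro bexI[of _ "(x + y) mod m"]) (auto simp: K_def)
  next
    case 2
    then have axy: "a = 2 * x + 1" "b = 2 * y + 1" by (auto simp: x_def y_def)
    \<comment> \<open>The index is \<open>x + y - 2 * d\<close> modulo \<open>m\<close>, with
      \<open>m - d\<close> in place of \<open>- d\<close> to stay within the natural
      numbers.\<close>
    define k where "k = (x + y + 2 * (m - d)) mod m"
    have "(k + 2 * d) mod m = (x + y + 2 * (m - d) + 2 * d) mod m" unfolding k_def by (rule mod_add_left_eq)
    also have "x + y + 2 * (m - d) + 2 * d = x + y + 2 * m" using d by simp
    finally have "(x + y) mod m = (k + 2 * d) mod m" by simp
    moreover have "k < m" using d by (simp add: k_def)
    ultimately show ?thesis using factor_odd[of k m x y d] xy ab axy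
      by (intro bexI[of _ k]) (auto simp: K_def)
  next
    case 3
    then have axy: "a = 2 * x" "b = 2 * y + 1" by (auto simp: x_def y_def)
    then have "(y + (m - x)) mod m \<in> J" using ab(4) 3 by (simp add: joined_def)
    then show ?thesis using offs[OF xy] axy by auto
  next
    case 4
    then have axy: "a = 2 * x + 1" "b = 2 * y" by (auto simp: x_def y_def)
    then have "(x + (m - y)) mod m \<in> J" using ab(4) 4 by (simp add: joined_def)
    then show ?thesis using offs[OF xy(2,1)] axy by auto
  qed
  then show ?thesis by (simp add: K_def)
qed

definition factor_cross :: "nat \<Rightarrow> nat set \<Rightarrow> nat \<Rightarrow> nat \<Rightarrow> nat \<Rightarrow> pt set set" where
  "factor_cross m J d = cross ({..<m} \<union> (+) m ` (J - {d})) (\<lambda>_. {..<2 * m}) (factor m d)"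

context
  fixes m d :: nat and J :: "nat set"
  assumes J: "J \<subseteq> {..<m}" "d \<in> J"
begin

lemma card_factor_cross: "4 * card (factor_cross m J d i j) \<le> (m + card J - 1) * (2 * m * (2 * m))"
proof -
  have "finite J" "d < m" using J finite_subset by auto
  moreover have "card ({..<m} \<union> (+) m ` (J - {d})) = m + card J - 1"
  proof -
    have "card J > 0" using J \<open>finite J\<close> by (auto simp: card_gt_0_iff)
    moreover have "card ((+) m ` (J - {d})) = card J - 1" using J \<open>finite J\<close> by (simp add: card_image)
    moreover have "{..<m} \<inter> (+) m ` (J - {d}) = {}" by auto
    ultimately show ?thesis using \<open>finite J\<close> by (subst card_Un_disjoint) auto
  qed
  moreover have "involution_on {..<2 * m} (factor m d k)" if "k \<in> {..<m} \<union> (+) m ` (J - {d})" for k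
    using that J \<open>d < m\<close> by (intro involution_factor) auto
  ultimately show ?thesis
    unfolding factor_cross_def
    using card_cross[of "{..<m} \<union> (+) m ` (J - {d})" "\<lambda>_. {..<2 * m}" "2 * m" "factor m d" i j] by simp
qed

lemma factor_cross_block:
  assumes "b \<in> factor_cross m J d i j" "i \<noteq> j" "i < n" "j < n"
  shows "b \<subseteq> pts n (2 * m) s" "card b = 4"
proof -
  have "involution_on {..<2 * m} (factor m d k)" if "k \<in> {..<m} \<union> (+) m ` (J - {d})" for k
    using that J by (intro involution_factor) auto
  then show "b \<subseteq> pts n (2 * m) s" "card b = 4"
    using cross_block[OF assms(1)[unfolded factor_cross_def] assms(2-4), of "2 * m" s] by auto
qed

lemma factor_cross_covered:
  assumes "a < 2 * m" "a' < 2 * m" "b < 2 * m" "a \<noteq> a'" "joined m J a a'"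
  shows "covered (factor_cross m J d i j) {Pt i a, Pt i a', Pt j b}"
    and "covered (factor_cross m J d i j) {Pt j a, Pt j a', Pt i b}"
proof -
  obtain k where k: "k \<in> {..<m} \<union> (+) m ` (J - {d})" "factor m d k a = a'"
    using factor_covers[OF J assms(1,2,4,5)] by blast
  have "involution_on {..<2 * m} (factor m d k)"
    using k J by (intro involution_factor) auto
  then show "covered (factor_cross m J d i j) {Pt i a, Pt i a', Pt j b}"
    "covered (factor_cross m J d i j) {Pt j a, Pt j a', Pt i b}"
    unfolding factor_cross_def k(2)[symmetric]
    using cross_covered[OF k(1), of "\<lambda>_. {..<2 * m}" "factor m d" a b] assms by auto
qed

end

text \<open>If all offsets are allowed, the factors form a one-factorization of the complete graph
  on a group. Two groups have no transversal triples, so these blocks are all that is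
  required.\<close>

lemma sqs_double:
  assumes "sqs_exists u" "even u" "u > 0"
  shows "sqs_exists (2 * u)"
proof -
  define m where "m = u div 2"
  have u: "u = 2 * m" and m: "m > 0" using assms by (auto simp: m_def)
  have J: "{..<m} \<subseteq> {..<m}" "0 \<in> {..<m}" using m by auto
  define C where "C = factor_cross m {..<m} 0 0 1"
  have jo: "joined m {..<m} a b" for a b using m by (auto simp: joined_def)
  have "candelabra 2 u 0 C"
    unfolding candelabra_def
  proof (intro conjI allI ballI impI)
    show "b \<subseteq> pts 2 u 0" "card b = 4" if "b \<in> C" for b
      using factor_cross_block[OF J that[unfolded C_def]] by (auto simp: u)
    show "covered C {Pt i a, Pt i a', Pt j b}"
      if "i < 2" "j < 2" "a < u" "a' < u" "b < u" "i \<noteq> j" "a \<noteq> a'" for i j a a' b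
    proof -
      have "i = 0 \<and> j = 1 \<or> i = 1 \<and> j = 0" using that by auto
      then show ?thesis using factor_cross_covered[OF J, of a a' b 0 1] that jo by (auto simp: u C_def)
    qed
    have "4 * card C \<le> (m + card {..<m} - 1) * (2 * m * (2 * m))"
      unfolding C_def by (rule card_factor_cross[OF J])
    then have "int (4 * card C) \<le> int ((m + card {..<m} - 1) * (2 * m * (2 * m)))" by (rule zle_int[THEN iffD2])
    then show "24 * int (card C) \<le> int 2 * (int 2 - 1) * int u * int u * (3 * int 0 + 3 * int u - 3 + (int 2 - 2) * int u)"
      using m by (simp add: u of_nat_diff algebra_simps)
  qed auto
  then show ?thesis using candelabra_fill[of 2 u 0 C] assms by simp
qed

section \<open>Three groups\<close>

definition third :: "nat \<Rightarrow> nat \<Rightarrow> nat \<Rightarrow> nat \<Rightarrow> nat" where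
  "third g t b c = (t + (g - b) + (g - c)) mod g"

lemma third_iff:
  assumes "a < g" "b < g" "c < g"
  shows "third g t b c = a \<longleftrightarrow> (a + b + c) mod g = t mod g"
proof
  assume "third g t b c = a"
  then have "(a + (b + c)) mod g = (t + (g - b) + (g - c) + (b + c)) mod g"
    unfolding third_def by (metis mod_add_left_eq)
  also have "t + (g - b) + (g - c) + (b + c) = t + g + g" using assms by simp
  also have "(t + g + g) mod g = t mod g" by simp
  finally show "(a + b + c) mod g = t mod g" by (simp only: add.assoc)
next
  assume *: "(a + b + c) mod g = t mod g"
  have "third g t b c = (a + b + c + ((g - b) + (g - c))) mod g"
    unfolding third_def using * by (metis add.assoc mod_add_left_eq)
  also have "a + b + c + ((g - b) + (g - c)) = a + g + g" using assms by simp
  finally show "third g t b c = a" using assms by simp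
qed

lemma third_lt: "g > 0 \<Longrightarrow> third g t b c < g"
  by (simp add: third_def)

lemma third_sum:
  assumes "b < g" "c < g"
  shows "(third g t b c + b + c) mod g = t mod g"
  using third_iff[of "third g t b c" g b c t] assms third_lt[of g t b c] by auto

text \<open>The transversal triples of sum \<open>t\<close> form a Latin square, so any two points
  of different groups lie in exactly one of them. Joined to one stem point, they serve all triples
  of that point with two groups.\<close>

definition star :: "nat \<Rightarrow> nat \<Rightarrow> nat \<Rightarrow> nat \<Rightarrow> nat \<Rightarrow> nat \<Rightarrow> pt set set" where
  "star g x t i j k = (\<lambda>(b, c). {Stem x, Pt i (third g t b c), Pt j b, Pt k c}) ` ({..<g} \<times> {..<g})"

text \<open>The two points of the middle group complete \<open>b\<close>, \<open>c\<close> to the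
  sums \<open>t\<close> and \<open>t'\<close>, so their difference is \<open>t' - t\<close>.
  Restricting \<open>(b, c)\<close> to a set \<open>D\<close> makes it possible to share two sums
  among the three middle groups.\<close>

definition mid :: "nat \<Rightarrow> (nat \<times> nat) set \<Rightarrow> nat \<Rightarrow> nat \<Rightarrow> nat \<Rightarrow> nat \<Rightarrow> nat \<Rightarrow> pt set set" where
  "mid g D t t' i j k = (\<lambda>(b, c). {Pt i (third g t b c), Pt i (third g t' b c), Pt j b, Pt k c}) ` D"

lemma card_star: "card (star g x t i j k) \<le> g * g"
  using card_image_le[of "{..<g} \<times> {..<g}"] by (simp add: star_def card_cartesian_product)

lemma card_mid: "finite D \<Longrightarrow> card (mid g D t t' i j k) \<le> card D"
  using card_image_le[of D] by (simp add: mid_def)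

lemma star_block:
  assumes "b \<in> star g x t i j k" "i \<noteq> j" "i \<noteq> k" "j \<noteq> k" "i < n" "j < n" "k < n" "x < s"
  shows "b \<subseteq> pts n g s" "card b = 4"
  using assms third_lt by (auto simp: star_def card_insert_if)

lemma mid_block:
  assumes "b \<in> mid g D t t' i j k" "D \<subseteq> {..<g} \<times> {..<g}" "t mod g \<noteq> t' mod g"
    and "i \<noteq> j" "i \<noteq> k" "j \<noteq> k" "i < n" "j < n" "k < n"
  shows "b \<subseteq> pts n g s" "card b = 4"
proof -
  obtain p q where pq: "(p, q) \<in> D" and b: "b = {Pt i (third g t p q), Pt i (third g t' p q), Pt j p, Pt k q}"
    using assms(1) by (auto simp: mid_def)
  then have "p < g" "q < g" using assms(2) by auto
  then have "third g t p q \<noteq> third g t' p q"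
    using third_sum[of p g q t] third_sum[of p g q t'] assms(3) by auto
  then show "b \<subseteq> pts n g s" "card b = 4"
    using b assms \<open>p < g\<close> \<open>q < g\<close> third_lt[of g] by (auto simp: card_insert_if)
qed

lemma star_covered_transversal:
  assumes "a < g" "b < g" "c < g" "(a + b + c) mod g = t mod g"
  shows "covered (star g x t i j k) {Pt i a, Pt j b, Pt k c}"
    "covered (star g x t i j k) {Stem x, Pt i a, Pt j b}"
    "covered (star g x t i j k) {Stem x, Pt i a, Pt k c}"
    "covered (star g x t i j k) {Stem x, Pt j b, Pt k c}"
proof -
  have "{Stem x, Pt i a, Pt j b, Pt k c} \<in> star g x t i j k"
    using assms third_iff[of a g b c t] by (force simp: star_def)
  then show "covered (star g x t i j k) {Pt i a, Pt j b, Pt k c}"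
    "covered (star g x t i j k) {Stem x, Pt i a, Pt j b}"
    "covered (star g x t i j k) {Stem x, Pt i a, Pt k c}"
    "covered (star g x t i j k) {Stem x, Pt j b, Pt k c}"
    by (rule coveredI; blast)+
qed

lemma star_covered:
  assumes "a < g" "b < g"
  shows "covered (star g x t i j k) {Stem x, Pt i a, Pt j b}"
    "covered (star g x t i j k) {Stem x, Pt i a, Pt k b}"
    "covered (star g x t i j k) {Stem x, Pt j a, Pt k b}"
proof -
  define c where "c = third g t a b"
  have c: "c < g" "(c + a + b) mod g = t mod g"
    using assms third_lt[of g t a b] third_sum[of a g b t] by (auto simp: c_def)
  show "covered (star g x t i j k) {Stem x, Pt i a, Pt j b}"
    using star_covered_transversal(2)[of a g b c t x i j k] assms c by (simp add: ac_simps)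
  show "covered (star g x t i j k) {Stem x, Pt i a, Pt k b}"
    using star_covered_transversal(3)[of a g c b t x i j k] assms c by (simp add: ac_simps)
  show "covered (star g x t i j k) {Stem x, Pt j a, Pt k b}"
    using star_covered_transversal(4)[of c g a b t x i j k] assms c by (simp add: ac_simps)
qed

lemma mid_covered:
  assumes "a < g" "a' < g" "b < g" "c < g" "(b, c) \<in> D"
    and "(a + b + c) mod g = t mod g" "(a' + b + c) mod g = t' mod g"
  shows "covered (mid g D t t' i j k) {Pt i a, Pt j b, Pt k c}"
    "covered (mid g D t t' i j k) {Pt i a', Pt j b, Pt k c}"
    "covered (mid g D t t' i j k) {Pt i a, Pt i a', Pt j b}"
    "covered (mid g D t t' i j k) {Pt i a, Pt i a', Pt k c}"
proof -
  have "third g t b c = a" "third g t' b c = a'"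
    using assms third_iff[of a g b c t] third_iff[of a' g b c t'] by auto
  then have "{Pt i a, Pt i a', Pt j b, Pt k c} \<in> mid g D t t' i j k"
    using assms by (force simp: mid_def)
  then show "covered (mid g D t t' i j k) {Pt i a, Pt j b, Pt k c}"
    "covered (mid g D t t' i j k) {Pt i a', Pt j b, Pt k c}"
    "covered (mid g D t t' i j k) {Pt i a, Pt i a', Pt j b}"
    "covered (mid g D t t' i j k) {Pt i a, Pt i a', Pt k c}"
    by (rule coveredI; blast)+
qed

lemma mid_covered_transversal:
  assumes "a < g" "b < g" "c < g" "(b, c) \<in> D" "(a + b + c) mod g = t mod g \<or> (a + b + c) mod g = t' mod g"
  shows "covered (mid g D t t' i j k) {Pt i a, Pt j b, Pt k c}"
  using assms(5)
proof
  assume "(a + b + c) mod g = t mod g"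
  then show ?thesis
    using mid_covered(1)[of a g "third g t' b c" b c D t t' i j k] assms(1-4) third_lt[of g t' b c] third_sum[of b g c t']
    by simp
next
  assume "(a + b + c) mod g = t' mod g"
  then show ?thesis
    using mid_covered(2)[of "third g t b c" g a b c D t t' i j k] assms(1-4) third_lt[of g t b c] third_sum[of b g c t]
    by simp
qed

text \<open>A pair whose difference is \<open>t' - t\<close> and a point \<open>b\<close> of one
  outer group determine the point of the other outer group through the sum \<open>t\<close>, and the
  sum \<open>t'\<close> then comes out right by itself.\<close>

lemma mid_covered_pair:
  assumes "a < g" "a' < g" "b < g" "(a + t') mod g = (a' + t) mod g"
  shows "(b, third g t a b) \<in> D \<Longrightarrow> covered (mid g D t t' i j k) {Pt i a, Pt i a', Pt j b}"
    and "(third g t a b, b) \<in> D \<Longrightarrow> covered (mid g D t t' i j k) {Pt i a, Pt i a', Pt k b}"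
proof -
  define c where "c = third g t a b"
  have c: "c < g" "(c + a + b) mod g = t mod g"
    using assms third_lt[of g t a b] third_sum[of a g b t] by (auto simp: c_def)
  have "(a' + b + c + t) mod g = (a + t' + (b + c)) mod g"
    using assms(4) by (metis (no_types, opaque_lifting) add.assoc add.commute mod_add_left_eq)
  also have "\<dots> = (t' + (c + a + b)) mod g" by (simp add: ac_simps)
  also have "\<dots> = (t' + t) mod g" using c(2) by (metis mod_add_right_eq)
  finally have c': "(a' + b + c) mod g = t' mod g" using cong_add_rcancel_nat[of "a' + b + c" t t' g] by (simp add: cong_def)
  show "covered (mid g D t t' i j k) {Pt i a, Pt i a', Pt j b}" if "(b, third g t a b) \<in> D"
    using mid_covered(3)[of a g a' b c D t t' i j k] assms c c' that by (simp add: ac_simps flip: c_def)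
  show "covered (mid g D t t' i j k) {Pt i a, Pt i a', Pt k b}" if "(third g t a b, b) \<in> D"
    using mid_covered(4)[of a g a' c b D t t' i j k] assms c c' that by (simp add: ac_simps flip: c_def)
qed

text \<open>The offsets below \<open>n\<close> are the differences 1, 3, ...,
  \<open>2 * n - 1\<close>, and the \<open>n\<close> largest offsets are their negatives. These are
  the differences that the blocks of type \<open>mid\<close> can supply.\<close>

lemma not_joined_odd_difference:
  assumes "a < 2 * m" "b < 2 * m" "\<not> joined m {n..<m - n} a b"
  shows "\<exists>e<n. (a + (2 * e + 1)) mod (2 * m) = b \<or> (b + (2 * e + 1)) mod (2 * m) = a"
proof -
  have main: "\<exists>e<n. (2 * x + (2 * e + 1)) mod (2 * m) = 2 * y + 1 \<or> (2 * y + 1 + (2 * e + 1)) mod (2 * m) = 2 * x"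
    if xy: "x < m" "y < m" and c: "(y + (m - x)) mod m \<notin> {n..<m - n}" for x y
  proof -
    define c where "c = (y + (m - x)) mod m"
    have cm: "c < m" using xy by (simp add: c_def)
    have y: "(x + c) mod m = y" using add_mod_iff[of c m y x] xy cm by (auto simp: c_def add.commute)
    have x: "(y + (m - c)) mod m = x" using add_mod_iff[of x m y c] xy cm y by auto
    consider "c < n" | "m - n \<le> c" using c by (auto simp: c_def)
    then show ?thesis
    proof cases
      case 1
      have "2 * x + (2 * c + 1) = 2 * (x + c) + 1" by simp
      moreover have "(2 * (x + c)) mod (2 * m) = 2 * y" using y by (metis mult_mod_right)
      ultimately have "(2 * x + (2 * c + 1)) mod (2 * m) = (2 * y + 1) mod (2 * m)"
        by (metis mod_add_left_eq)
      then show ?thesis using 1 xy by (intro exI[of _ c]) auto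
    next
      case 2
      define e where "e = m - c - 1"
      have "2 * y + 1 + (2 * e + 1) = 2 * (y + (m - c))" using cm by (simp add: e_def)
      moreover have "(2 * (y + (m - c))) mod (2 * m) = 2 * x" using x by (metis mult_mod_right)
      ultimately have "(2 * y + 1 + (2 * e + 1)) mod (2 * m) = 2 * x" by (simp only:)
      moreover have "e < n" using 2 cm by (auto simp: e_def)
      ultimately show ?thesis by blast
    qed
  qed
  have half: "a div 2 < m" "b div 2 < m" using assms by (auto simp: less_mult_imp_div_less mult.commute)
  consider "even a" "odd b" | "odd a" "even b" using assms(3) by (auto simp: joined_def)
  then show ?thesis
  proof cases
    case 1
    then have "(b div 2 + (m - a div 2)) mod m \<notin> {n..<m - n}" using assms(3) by (auto simp: joined_def)
    then show ?thesis using main[OF half] 1 by simp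
  next
    case 2
    then have "(a div 2 + (m - b div 2)) mod m \<notin> {n..<m - n}" using assms(3) by (auto simp: joined_def)
    then show ?thesis using main[OF half(2,1)] 2 by auto
  qed
qed

lemma candelabra_three:
  assumes blocks: "\<And>b. b \<in> C \<Longrightarrow> b \<subseteq> pts 3 g s \<and> card b = 4"
    and star: "\<And>x a b. x < s \<Longrightarrow> a < g \<Longrightarrow> b < g \<Longrightarrow>
      covered C {Stem x, Pt 0 a, Pt 1 b} \<and> covered C {Stem x, Pt 0 a, Pt 2 b} \<and> covered C {Stem x, Pt 1 a, Pt 2 b}"
    and pair: "\<And>i j a a' b. i < 3 \<Longrightarrow> j < 3 \<Longrightarrow> i \<noteq> j \<Longrightarrow> a < g \<Longrightarrow> a' < g \<Longrightarrow> b < g \<Longrightarrow> a \<noteq> a' \<Longrightarrow>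
      covered C {Pt i a, Pt i a', Pt j b}"
    and trans: "\<And>a b c. a < g \<Longrightarrow> b < g \<Longrightarrow> c < g \<Longrightarrow> covered C {Pt 0 a, Pt 1 b, Pt 2 c}"
    and card: "24 * int (card C) \<le> 6 * int g * int g * (3 * int s + 4 * int g - 3)"
  shows "candelabra 3 g s C"
  unfolding candelabra_def
proof (intro conjI allI ballI impI)
  show "b \<subseteq> pts 3 g s" "card b = 4" if "b \<in> C" for b using blocks that by auto
  show "covered C {Stem x, Pt i a, Pt j b}"
    if "x < s" "i < 3" "j < 3" "a < g" "b < g" "i \<noteq> j" for x i j a b
  proof -
    have "i = 0 \<and> j = 1 \<or> i = 0 \<and> j = 2 \<or> i = 1 \<and> j = 2 \<or> j = 0 \<and> i = 1 \<or> j = 0 \<and> i = 2 \<or> j = 1 \<and> i = 2"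
      using that by linarith
    then show ?thesis using star[of x a b] star[of x b a] that by (auto simp: insert_commute)
  qed
  show "covered C {Pt i a, Pt j b, Pt k c}"
    if "i < 3" "j < 3" "k < 3" "a < g" "b < g" "c < g" "i \<noteq> j" "i \<noteq> k" "j \<noteq> k" for i j k a b c
  proof -
    have "i = 0 \<or> i = 1 \<or> i = 2" "j = 0 \<or> j = 1 \<or> j = 2" "k = 0 \<or> k = 1 \<or> k = 2"
      using that(1-3) by linarith+
    then show ?thesis
      using trans[of a b c] trans[of a c b] trans[of b a c] trans[of c a b] trans[of b c a] trans[of c b a] that
      by (auto simp: insert_commute)
  qed
qed (use pair card in \<open>auto simp: algebra_simps\<close>)

text \<open>The sums from \<open>6 * n\<close> on belong to the stem. Each middle group has an
  interval of \<open>2 * n\<close> of the other sums, folded about its centre: the sums at positions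
  \<open>y\<close> and \<open>2 * n - 1 - y\<close> form a pair, and their differences run through
  1, 3, ..., \<open>2 * n - 1\<close>. All even differences and the larger odd ones go to
  one-factors, with the offsets in \<open>J\<close>. Positivity of \<open>s\<close> makes
  \<open>J\<close> nonempty.\<close>

lemma candelabra_triple:
  assumes g: "g = 6 * n + s" and s: "even s" "s > 0"
  shows "\<exists>C. candelabra 3 g s C"
proof -
  define m where "m = 3 * n + s div 2"
  have gm: "g = 2 * m" using g s by (auto simp: m_def)
  have mn: "2 * n < m" using s by (auto simp: m_def elim: evenE)
  define J where "J = {n..<m - n}"
  have J: "J \<subseteq> {..<m}" "n \<in> J" using mn by (auto simp: J_def)
  have cJ: "card J = m - 2 * n" by (simp add: J_def)
  define G where "G = {..<g} \<times> {..<g}"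
  define M where "M i y = mid g G (2 * n * i + y) (2 * n * i + (2 * n - 1 - y)) i (Suc i mod 3) (Suc (Suc i) mod 3)" for i y
  define S where "S = (\<Union>x<s. star g x (6 * n + x) 0 1 2)"
  define X where "X = factor_cross m J n"
  define C where "C = S \<union> (\<Union>(i, y)\<in>{..<3} \<times> {..<n}. M i y) \<union> X 0 1 \<union> X 0 2 \<union> X 1 2"
  have inM: "covered C t" if "covered (M i y) t" "i < 3" "y < n" for t i y
    using that unfolding C_def covered_def by blast
  have inS: "covered C t" if "covered (star g x (6 * n + x) 0 1 2) t" "x < s" for t x
    using that unfolding C_def S_def covered_def by blast
  have inX: "covered C t" if "covered (X 0 1) t \<or> covered (X 0 2) t \<or> covered (X 1 2) t" for t
    using that unfolding C_def covered_def by blast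
  have tlt: "2 * n * i + y < g" if "i < 3" "y < 2 * n" for i y
  proof -
    have "2 * n * i \<le> 2 * n * 2" using that by (intro mult_le_mono) auto
    then show ?thesis using that(2) g by linarith
  qed
  have "candelabra 3 g s C"
  proof (rule candelabra_three)
    fix b assume "b \<in> C"
    then consider x where "b \<in> star g x (6 * n + x) 0 1 2" "x < s" | i y where "b \<in> M i y" "i < 3" "y < n"
      | "b \<in> X 0 1" | "b \<in> X 0 2" | "b \<in> X 1 2"
      unfolding C_def S_def by blast
    then show "b \<subseteq> pts 3 g s \<and> card b = 4"
    proof cases
      case 1
      then show ?thesis using star_block[OF 1(1), where n = 3 and s = s] by simp
    next
      case 2
      have "(2 * n * i + y) mod g \<noteq> (2 * n * i + (2 * n - 1 - y)) mod g"
      proof -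
        have "y \<noteq> 2 * n - 1 - y" using 2(3) by linarith
        then show ?thesis using tlt[of i y] tlt[of i "2 * n - 1 - y"] 2 by simp
      qed
      moreover have "i \<noteq> Suc i mod 3" "i \<noteq> Suc (Suc i) mod 3" "Suc i mod 3 \<noteq> Suc (Suc i) mod 3"
        using 2(2) by presburger+
      ultimately show ?thesis
        using mid_block(1)[OF 2(1)[unfolded M_def], of 3 s] mid_block(2)[OF 2(1)[unfolded M_def], of 3] 2
        by (simp add: G_def)
    next
      case 3
      then show ?thesis using factor_cross_block[OF J 3[unfolded X_def], of 3] by (simp add: gm)
    next
      case 4
      then show ?thesis using factor_cross_block[OF J 4[unfolded X_def], of 3] by (simp add: gm)
    next
      case 5
      then show ?thesis using factor_cross_block[OF J 5[unfolded X_def], of 3] by (simp add: gm)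
    qed
  next
    fix x a b assume "x < s" "a < g" "b < g"
    then show "covered C {Stem x, Pt 0 a, Pt 1 b} \<and> covered C {Stem x, Pt 0 a, Pt 2 b} \<and> covered C {Stem x, Pt 1 a, Pt 2 b}"
      using star_covered[of a g b x "6 * n + x" 0 1 2] inS[of x] by blast
  next
    fix i j a a' b assume ij: "i < (3::nat)" "j < (3::nat)" "i \<noteq> j" and ab: "a < g" "a' < g" "b < g" "a \<noteq> a'"
    show "covered C {Pt i a, Pt i a', Pt j b}"
    proof (cases "joined m J a a'")
      case True
      have X: "covered (X p q) {Pt p a, Pt p a', Pt q b}" "covered (X p q) {Pt q a, Pt q a', Pt p b}" for p q
        using factor_cross_covered[OF J, of a a' b p q] True ab gm by (simp_all add: X_def)
      consider "i = 0" "j = 1" | "i = 0" "j = 2" | "i = 1" "j = 2" | "i = 1" "j = 0" | "i = 2" "j = 0" | "i = 2" "j = 1"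
        using ij by linarith
      then show ?thesis
      proof cases
        case 1 then show ?thesis using inX X(1)[of 0 1] by simp
      next
        case 2 then show ?thesis using inX X(1)[of 0 2] by simp
      next
        case 3 then show ?thesis using inX X(1)[of 1 2] by simp
      next
        case 4 then show ?thesis using inX X(2)[of 0 1] by simp
      next
        case 5 then show ?thesis using inX X(2)[of 0 2] by simp
      next
        case 6 then show ?thesis using inX X(2)[of 1 2] by simp
      qed
    next
      case False
      have "i = 0 \<or> i = 1 \<or> i = 2" "j = 0 \<or> j = 1 \<or> j = 2" using ij(1,2) by linarith+
      then have j: "j = Suc i mod 3 \<or> j = Suc (Suc i) mod 3" using ij(3) by auto
      have cov: "covered C {Pt i p, Pt i q, Pt j b}"
        if "p < g" "q < g" "e < n" "(p + (2 * e + 1)) mod g = q" for p q e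
      proof -
        \<comment> \<open>With this position the two folded sums differ by
          \<open>2 * n - 1 - 2 * y\<close>, which is \<open>2 * e + 1\<close>.\<close>
        define y where "y = n - 1 - e"
        define t where "t = 2 * n * i + y"
        define t' where "t' = 2 * n * i + (2 * n - 1 - y)"
        have t': "t' = t + (2 * e + 1)" using that by (simp add: t_def t'_def y_def)
        have "(p + t') mod g = (p + (2 * e + 1) + t) mod g" by (simp add: t' ac_simps)
        also have "\<dots> = (q + t) mod g" using that(4) by (metis mod_add_left_eq)
        finally have eq: "(p + t') mod g = (q + t) mod g" .
        have "third g t p b < g" using ab by (intro third_lt) simp
        then have "covered (M i y) {Pt i p, Pt i q, Pt j b}"
          using j mid_covered_pair[OF that(1,2) ab(3) eq, of G i "Suc i mod 3" "Suc (Suc i) mod 3"] ab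
          by (auto simp: M_def t_def t'_def G_def)
        then show ?thesis using inM ij that by (auto simp: y_def)
      qed
      obtain e where "e < n" "(a + (2 * e + 1)) mod g = a' \<or> (a' + (2 * e + 1)) mod g = a"
        using not_joined_odd_difference[of a m a' n] False ab by (auto simp: J_def gm)
      then show ?thesis using cov[of a a' e] cov[of a' a e] ab by (auto simp: insert_commute)
    qed
  next
    fix a b c assume abc: "a < g" "b < g" "c < g"
    define r where "r = (a + b + c) mod g"
    have "r < g" using abc by (simp add: r_def)
    then have r: "r < 6 * n + s" using g by simp
    show "covered C {Pt 0 a, Pt 1 b, Pt 2 c}"
    proof (cases "r < 6 * n")
      case False
      define x where "x = r - 6 * n"
      have x: "x < s" "r = 6 * n + x" using False r by (auto simp: x_def)
      have "6 * n + x < g" using x(1) g by simp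
      then have "(a + b + c) mod g = (6 * n + x) mod g" using x(2) unfolding r_def by simp
      then show ?thesis using star_covered_transversal(1)[OF abc] inS x(1) by blast
    next
      case True
      define i where "i = r div (2 * n)"
      define z where "z = r mod (2 * n)"
      have n: "n > 0" using True by (cases n) auto
      have i: "i < 3" using True by (simp add: i_def less_mult_imp_div_less)
      have z: "z < 2 * n" "r = 2 * n * i + z" using n by (simp_all add: z_def i_def)
      define y where "y = (if z < n then z else 2 * n - 1 - z)"
      have y: "y < n" "r = 2 * n * i + y \<or> r = 2 * n * i + (2 * n - 1 - y)"
        using z by (auto simp: y_def)
      have cov: "covered (M i y) {Pt i p, Pt (Suc i mod 3) q, Pt (Suc (Suc i) mod 3) u}"
        if "p < g" "q < g" "u < g" "(p + q + u) mod g = r" for p q u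
        unfolding M_def
        by (rule mid_covered_transversal)
           (use that y tlt[OF i, of y] tlt[OF i, of "2 * n - 1 - y"] in \<open>auto simp: G_def\<close>)
      consider "i = 0" | "i = 1" | "i = 2" using i by linarith
      then have "covered (M i y) {Pt 0 a, Pt 1 b, Pt 2 c}"
      proof cases
        case 1
        then show ?thesis using cov[of a b c] abc by (simp add: r_def numeral_2_eq_2)
      next
        case 2
        then show ?thesis using cov[of b c a] abc by (simp add: r_def ac_simps insert_commute numeral_2_eq_2)
      next
        case 3
        then show ?thesis using cov[of c a b] abc by (simp add: r_def ac_simps insert_commute numeral_2_eq_2)
      qed
      then show ?thesis using inM i y by blast
    qed
  next
    have "card S \<le> (\<Sum>x<s. card (star g x (6 * n + x) 0 1 2))" unfolding S_def by (rule card_UN_le) simp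
    also have "\<dots> \<le> (\<Sum>x<s. g * g)" by (intro sum_mono card_star)
    finally have cS: "card S \<le> s * (g * g)" by simp
    have "card (M i y) \<le> g * g" for i y
      unfolding M_def using card_mid[of G] by (simp add: G_def card_cartesian_product)
    then have "(\<Sum>(i, y)\<in>{..<3::nat} \<times> {..<n}. card (M i y)) \<le> (\<Sum>(i, y)\<in>{..<3::nat} \<times> {..<n}. g * g)"
      by (intro sum_mono) auto
    moreover have "card (\<Union>(i, y)\<in>{..<3} \<times> {..<n}. M i y) \<le> (\<Sum>(i, y)\<in>{..<3} \<times> {..<n}. card (M i y))"
      using card_UN_le[of "{..<3::nat} \<times> {..<n}" "\<lambda>(i, y). M i y"] by (simp add: case_prod_unfold)
    ultimately have cM: "card (\<Union>(i, y)\<in>{..<3} \<times> {..<n}. M i y) \<le> 3 * n * (g * g)" by simp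
    have cX: "4 * card (X i j) \<le> (g - 1 - 2 * n) * (g * g)" for i j
      using card_factor_cross[OF J, of i j] mn by (simp add: X_def cJ gm mult_2)
    have "card C \<le> card S + card (\<Union>(i, y)\<in>{..<3} \<times> {..<n}. M i y) + card (X 0 1) + card (X 0 2) + card (X 1 2)"
      unfolding C_def by (intro order_trans[OF card_Un_le] add_mono) auto
    then have "4 * card C \<le> 4 * (s * (g * g)) + 4 * (3 * n * (g * g)) + 3 * ((g - 1 - 2 * n) * (g * g))"
      using cS cM cX[of 0 1] cX[of 0 2] cX[of 1 2] by linarith
    then have "4 * int (card C) \<le> int (4 * (s * (g * g)) + 4 * (3 * n * (g * g)) + 3 * ((g - 1 - 2 * n) * (g * g)))"
      by linarith
    also have "\<dots> = 4 * (int s * (int g * int g)) + 4 * (3 * int n * (int g * int g)) + 3 * ((int g - 1 - 2 * int n) * (int g * int g))"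
      using mn by (simp add: gm of_nat_diff)
    finally show "24 * int (card C) \<le> 6 * int g * int g * (3 * int s + 4 * int g - 3)"
      using g by (simp add: algebra_simps)
  qed
  then show ?thesis by blast
qed

section \<open>Four groups\<close>

lemma covered_sorted:
  assumes sorted: "\<And>i j k a b c. i < j \<Longrightarrow> j < k \<Longrightarrow> k < n \<Longrightarrow> a < g \<Longrightarrow> b < g \<Longrightarrow> c < g \<Longrightarrow>
      covered C {Pt i a, Pt j b, Pt k c}"
    and "i < n" "j < n" "k < n" "a < g" "b < g" "c < g" "i \<noteq> j" "i \<noteq> k" "j \<noteq> k"
  shows "covered C {Pt i a, Pt j b, Pt k c}"
proof -
  consider "i < j" "j < k" | "i < k" "k < j" | "j < i" "i < k" | "j < k" "k < i" | "k < i" "i < j" | "k < j" "j < i"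
    using assms(8-10) by linarith
  then show ?thesis
  proof cases
    case 1 then show ?thesis using sorted[of i j k a b c] assms by simp
  next
    case 2 then show ?thesis using sorted[of i k j a c b] assms by (simp add: insert_commute)
  next
    case 3 then show ?thesis using sorted[of j i k b a c] assms by (simp add: insert_commute)
  next
    case 4 then show ?thesis using sorted[of j k i b c a] assms by (simp add: insert_commute)
  next
    case 5 then show ?thesis using sorted[of k i j c a b] assms by (simp add: insert_commute)
  next
    case 6 then show ?thesis using sorted[of k j i c b a] assms by (simp add: insert_commute)
  qed
qed

lemma ex_residue:
  fixes m :: nat
  assumes "m > 0"
  shows "\<exists>r<m. (b + r) mod m = h mod m"
proof -
  have "((h + m - b mod m) mod m) < m" "(b mod m + (h + m - b mod m) mod m) mod m = h mod m"
    using assms sub_mod_iff[of "b mod m" m "(h + m - b mod m) mod m" h] by auto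
  then show ?thesis by (metis mod_add_left_eq)
qed

lemma half_mod: "((x::nat) div 2) mod m = x mod (2 * m) div 2"
  by (simp add: mod_mult2_eq)

lemma ex_point:
  fixes m e r :: nat
  assumes "r < m"
  obtains c where "c < 2 * m" "c div m = e mod 2" "c mod m = r"
proof
  have "e mod 2 < 2" by simp
  then have "e mod 2 = 0 \<or> e mod 2 = 1" by linarith
  then show "e mod 2 * m + r < 2 * m" using assms by auto
  show "(e mod 2 * m + r) div m = e mod 2" "(e mod 2 * m + r) mod m = r" using assms by auto
qed

lemma eq_mod_two_iff: "x < 2 \<Longrightarrow> x = y mod 2 \<longleftrightarrow> (even x \<longleftrightarrow> even (y::nat))"
  by presburger

lemma parity_aux:
  fixes p q w x t t' :: nat
  shows "odd (p + (p + q + 1) mod 2 + q)" "odd ((p + q + 1) mod 2 + p + q)"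
    and "x < 2 \<Longrightarrow> ((x + p + q) mod 2 + p + q) mod 2 = x"
    and "\<lbrakk>x < 2; x \<noteq> (p + q + t) mod 2; even (t + w + t')\<rbrakk> \<Longrightarrow> x = (q + (p + w + 1) mod 2 + t') mod 2"
    and "q < 2 \<Longrightarrow> odd (p + q + w) \<Longrightarrow> q = (p + w + 1) mod 2"
    and "x = (q + p + t) mod 2 \<Longrightarrow> q < 2 \<Longrightarrow> q = (x + p + t) mod 2"
proof -
  show "odd (p + (p + q + 1) mod 2 + q)" "odd ((p + q + 1) mod 2 + p + q)" by auto
  show "((x + p + q) mod 2 + p + q) mod 2 = x" if "x < 2"
    by (rule sym, subst eq_mod_two_iff[OF that]) auto
  show "x = (q + (p + w + 1) mod 2 + t') mod 2" if "x < 2" "x \<noteq> (p + q + t) mod 2" "even (t + w + t')"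
    using that(2,3) by (auto simp: eq_mod_two_iff[OF that(1)])
  show "q = (p + w + 1) mod 2" if "q < 2" "odd (p + q + w)"
    using that(2) by (auto simp: eq_mod_two_iff[OF that(1)])
  show "q = (x + p + t) mod 2" if "x = (q + p + t) mod 2" "q < 2"
    using that(1) by (auto simp: eq_mod_two_iff[OF that(2)])
qed

text \<open>A system with four groups indexed cyclically. A block of the first kind joins two points of the
  middle group \<open>i\<close> with one point of each neighbouring group; the pairs of points of the middle group
  belonging to fixed outer points \<open>b\<close>, \<open>c\<close> form a matching that is perfect or misses two points, and in
  the second case the two missed points are joined to the two points of the stem. The shifts \<open>wt\<close> and \<open>tw\<close>
  of the parities are chosen such that two points of different groups and a point of the stem lie in only one
  block, although two different middle groups could provide it.\<close>

definition prv :: "nat \<Rightarrow> nat" where "prv i = (i + 3) mod 4"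
definition nxt :: "nat \<Rightarrow> nat" where "nxt i = (i + 1) mod 4"
definition wt :: "nat \<Rightarrow> nat" where "wt i = (if i \<ge> 2 then 1 else 0)"
definition tw :: "nat \<Rightarrow> nat" where "tw i = (if i = 3 then 1 else 0)"

text \<open>An outer point is read as a half, \<open>b div m\<close>, and a residue modulo
  \<open>m\<close>. For fixed \<open>b\<close>, \<open>c\<close> the two conditions say that
  \<open>a + a'\<close> is \<open>2 * (b + c) + \<delta>\<close> modulo \<open>2 * m\<close>, where
  \<open>\<delta>\<close> is 0 or 1 according to the halves. So \<open>a'\<close> is a reflection of
  \<open>a\<close>.\<close>

definition matched :: "nat \<Rightarrow> nat \<Rightarrow> nat \<Rightarrow> nat \<Rightarrow> nat \<Rightarrow> nat \<Rightarrow> bool" where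
  "matched m i a a' b c \<longleftrightarrow>
     odd (a + a' + b div m + c div m + wt i) \<and> (b + c) mod m = (a + a') div 2 mod m"

text \<open>For \<open>\<delta> = 0\<close> the reflection fixes the two points congruent to
  \<open>b + c\<close> modulo \<open>m\<close>. They lie in different halves, so the last equation
  gives them different stem points.\<close>

definition missed :: "nat \<Rightarrow> nat \<Rightarrow> nat \<Rightarrow> nat \<Rightarrow> nat \<Rightarrow> nat \<Rightarrow> bool" where
  "missed m i x a b c \<longleftrightarrow>
     odd (b div m + c div m + wt i) \<and> a mod m = (b + c) mod m \<and> x = (a div m + b div m + tw i) mod 2"

definition inner_blocks :: "nat \<Rightarrow> nat \<Rightarrow> pt set set" where
  "inner_blocks m i = {{Pt (prv i) b, Pt i a, Pt i a', Pt (nxt i) c} | a a' b c.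
     a < 2 * m \<and> a' < 2 * m \<and> b < 2 * m \<and> c < 2 * m \<and> a \<noteq> a' \<and> matched m i a a' b c}"

definition stem_blocks :: "nat \<Rightarrow> nat \<Rightarrow> pt set set" where
  "stem_blocks m i = {{Stem x, Pt (prv i) b, Pt i a, Pt (nxt i) c} | x a b c.
     a < 2 * m \<and> b < 2 * m \<and> c < 2 * m \<and> missed m i x a b c}"

lemma matched_sym: "matched m i a a' b c \<Longrightarrow> matched m i a' a b c" "matched m i a a' b c \<Longrightarrow> matched m i a a' c b"
  by (auto simp: matched_def ac_simps)

lemma ex_matched_outer:
  assumes "m > 0" shows "\<exists>c<2 * m. matched m i a a' b c"
proof -
  obtain r where r: "r < m" "(b + r) mod m = (a + a') div 2 mod m"
    using ex_residue[OF assms, of b "(a + a') div 2"] by auto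
  obtain c where c: "c < 2 * m" "c div m = (a + a' + b div m + wt i + 1) mod 2" "c mod m = r"
    using ex_point[OF r(1)] .
  have "(b + c) mod m = (a + a') div 2 mod m" using c(3) r(2) by (metis mod_add_right_eq)
  moreover have "odd (a + a' + b div m + c div m + wt i)" unfolding c(2) by (rule parity_aux(1))
  ultimately have "matched m i a a' b c" unfolding matched_def by (intro conjI)
  then show ?thesis using c(1) by blast
qed

lemma matched_outer_unique:
  assumes "matched m i a a' b c" "matched m i a a' b c'" "c < 2 * m" "c' < 2 * m"
  shows "c = c'"
proof -
  have "c div m < 2" "c' div m < 2" using assms by (auto simp: less_mult_imp_div_less mult.commute)
  moreover have "even (c div m) \<longleftrightarrow> even (c' div m)" using assms(1,2) by (auto simp: matched_def)
  ultimately have "c div m = c' div m" by (auto simp: less_2_cases_iff)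
  moreover have "[b + c = b + c'] (mod m)" using assms(1,2) by (simp add: matched_def cong_def)
  then have "c mod m = c' mod m" using cong_add_lcancel_nat[of b c c' m] by (simp add: cong_def)
  ultimately show ?thesis by (metis div_mult_mod_eq)
qed

text \<open>The reflection of \<open>a\<close> for the given \<open>b\<close>, \<open>c\<close> is
  either another point, and then it is the partner, or \<open>a\<close> itself, and then
  \<open>a\<close> is one of the two missed points.\<close>

lemma matched_or_missed:
  assumes "m > 0" "a < 2 * m"
  shows "(\<exists>a'<2 * m. a' \<noteq> a \<and> matched m i a a' b c) \<or> missed m i ((a div m + b div m + tw i) mod 2) a b c"
proof -
  define \<delta> where "\<delta> = (b div m + c div m + wt i + 1) mod 2"
  define N where "N = 2 * (b + c) + \<delta>"
  have N: "N div 2 = b + c" "odd N \<longleftrightarrow> even (b div m + c div m + wt i)"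
    by (auto simp: N_def \<delta>_def)
  obtain a' where a': "a' < 2 * m" "(a + a') mod (2 * m) = N mod (2 * m)"
    using ex_residue[of "2 * m" a N] assms by auto
  have "odd (a + a') \<longleftrightarrow> odd N" using a'(2) by (metis dvd_triv_left dvd_mod_iff)
  moreover have "(a + a') div 2 mod m = (b + c) mod m"
    unfolding half_mod a'(2) using N(1) by (simp flip: half_mod)
  ultimately have mt: "matched m i a a' b c" using N(2) by (auto simp: matched_def)
  show ?thesis
  proof (cases "a' = a")
    case True
    then show ?thesis using mt by (auto simp: matched_def missed_def)
  next
    case False
    then show ?thesis using mt a' by blast
  qed
qed

lemma groups4: "i < 4 \<Longrightarrow> i = 0 \<or> i = 1 \<or> i = 2 \<or> i = (3::nat)"
  by linarith

lemma prv_nxt: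
  assumes "i < 4"
  shows "prv i < 4" "nxt i < 4" "prv i \<noteq> i" "nxt i \<noteq> i" "prv i \<noteq> nxt i" "nxt i \<noteq> prv i"
    "nxt (prv i) = i" "prv (nxt i) = i"
  using groups4[OF assms] by (auto simp: prv_def nxt_def)

lemma inner_blocks_covered:
  assumes "a < 2 * m" "a' < 2 * m" "b < 2 * m" "c < 2 * m" "a \<noteq> a'" "matched m i a a' b c"
  shows "covered (inner_blocks m i) {Pt i a, Pt i a', Pt (prv i) b}"
    "covered (inner_blocks m i) {Pt i a, Pt i a', Pt (nxt i) c}"
    "covered (inner_blocks m i) {Pt (prv i) b, Pt i a, Pt (nxt i) c}"
proof -
  have "{Pt (prv i) b, Pt i a, Pt i a', Pt (nxt i) c} \<in> inner_blocks m i"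
    using assms unfolding inner_blocks_def by blast
  then show "covered (inner_blocks m i) {Pt i a, Pt i a', Pt (prv i) b}"
    "covered (inner_blocks m i) {Pt i a, Pt i a', Pt (nxt i) c}"
    "covered (inner_blocks m i) {Pt (prv i) b, Pt i a, Pt (nxt i) c}"
    by (rule coveredI; blast)+
qed

lemma stem_blocks_covered:
  assumes "a < 2 * m" "b < 2 * m" "c < 2 * m" "missed m i x a b c"
  shows "covered (stem_blocks m i) {Pt (prv i) b, Pt i a, Pt (nxt i) c}"
    "covered (stem_blocks m i) {Stem x, Pt (prv i) b, Pt i a}"
    "covered (stem_blocks m i) {Stem x, Pt i a, Pt (nxt i) c}"
    "covered (stem_blocks m i) {Stem x, Pt (prv i) b, Pt (nxt i) c}"
proof -
  have "{Stem x, Pt (prv i) b, Pt i a, Pt (nxt i) c} \<in> stem_blocks m i"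
    using assms unfolding stem_blocks_def by blast
  then show "covered (stem_blocks m i) {Pt (prv i) b, Pt i a, Pt (nxt i) c}"
    "covered (stem_blocks m i) {Stem x, Pt (prv i) b, Pt i a}"
    "covered (stem_blocks m i) {Stem x, Pt i a, Pt (nxt i) c}"
    "covered (stem_blocks m i) {Stem x, Pt (prv i) b, Pt (nxt i) c}"
    by (rule coveredI; blast)+
qed

lemma stem_blocks_covered_opposite:
  assumes "b < 2 * m" "c < 2 * m" "odd (b div m + c div m + wt i)" "x < 2" "m > 0"
  shows "covered (stem_blocks m i) {Stem x, Pt (prv i) b, Pt (nxt i) c}"
proof -
  have "(b + c) mod m < m" using assms(5) by simp
  from ex_point[OF this]
  obtain a where a: "a < 2 * m" "a div m = (x + b div m + tw i) mod 2" "a mod m = (b + c) mod m" .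
  have "(a div m + b div m + tw i) mod 2 = x" unfolding a(2) using assms(4) by (rule parity_aux)
  then have "missed m i x a b c" using a assms by (auto simp: missed_def)
  then show ?thesis using stem_blocks_covered(4) a assms by blast
qed

lemma stem_blocks_covered_adjacent:
  assumes ab: "a < 2 * m" "b < 2 * m" and x: "x < 2" and m: "m > 0" and i: "i < 4"
  shows "covered (stem_blocks m i) {Stem x, Pt (prv i) b, Pt i a} \<or>
    covered (stem_blocks m (prv i)) {Stem x, Pt (prv i) b, Pt i a}"
proof (cases "x = (a div m + b div m + tw i) mod 2")
  case True
  obtain r where r: "r < m" "(b + r) mod m = a mod m" using ex_residue[OF m, of b a] by auto
  obtain c where c: "c < 2 * m" "c div m = (b div m + wt i + 1) mod 2" "c mod m = r"
    using ex_point[OF r(1)] .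
  have "(b + c) mod m = a mod m" using r c(3) by (metis mod_add_right_eq)
  moreover have "odd (b div m + c div m + wt i)" unfolding c(2) by (rule parity_aux)
  ultimately have "missed m i x a b c" using True by (simp add: missed_def)
  then show ?thesis using stem_blocks_covered(2)[OF ab c(1)] by blast
next
  case False
  define j where "j = prv i"
  \<comment> \<open>Two adjacent points and a stem point can be served by either point acting as the
    middle one. The middle group \<open>i\<close> requires \<open>x\<close> to have the parity of
    the two halves plus \<open>tw i\<close>; the middle group \<open>j\<close> requires that of the
    halves plus \<open>wt j + 1 + tw j\<close>. By this parity condition exactly one of the
    requirements holds.\<close>
  have j: "nxt j = i" "even (tw i + wt j + tw j)" using groups4[OF i]
    by (auto simp: j_def prv_def nxt_def tw_def wt_def)
  obtain r where r: "r < m" "(a + r) mod m = b mod m" using ex_residue[OF m, of a b] by auto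
  obtain d where d: "d < 2 * m" "d div m = (a div m + wt j + 1) mod 2" "d mod m = r"
    using ex_point[OF r(1)] .
  have "(d + a) mod m = b mod m" using r d(3) by (metis mod_add_right_eq add.commute)
  moreover have "odd (d div m + a div m + wt j)" unfolding d(2) by (rule parity_aux)
  moreover have "x = (b div m + d div m + tw j) mod 2"
    unfolding d(2) using x False j(2) by (rule parity_aux)
  ultimately have "missed m j x b d a" by (simp add: missed_def)
  then show ?thesis using stem_blocks_covered(3)[OF ab(2) d(1) ab(1), of j x] j(1) by (simp add: j_def)
qed

lemma inner_blocks_block:
  assumes "B \<in> inner_blocks m i" "i < 4"
  shows "B \<subseteq> pts 4 (2 * m) s" "card B = 4"
proof -
  obtain a a' b c where "B = {Pt (prv i) b, Pt i a, Pt i a', Pt (nxt i) c}"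
    and "a < 2 * m" "a' < 2 * m" "b < 2 * m" "c < 2 * m" "a \<noteq> a'"
    using assms(1) unfolding inner_blocks_def by blast
  then show "B \<subseteq> pts 4 (2 * m) s" "card B = 4"
    using prv_nxt[OF assms(2)] assms(2) by simp_all
qed

lemma stem_blocks_block:
  assumes "B \<in> stem_blocks m i" "i < 4"
  shows "B \<subseteq> pts 4 (2 * m) 2" "card B = 4"
proof -
  obtain x a b c where "B = {Stem x, Pt (prv i) b, Pt i a, Pt (nxt i) c}"
    and "a < 2 * m" "b < 2 * m" "c < 2 * m" "missed m i x a b c"
    using assms(1) unfolding stem_blocks_def by blast
  moreover from this have "x < 2" by (simp add: missed_def)
  ultimately show "B \<subseteq> pts 4 (2 * m) 2" "card B = 4"
    using prv_nxt[OF assms(2)] assms(2) by simp_all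
qed

text \<open>A block is determined by its pair in the middle group, taken in decreasing order, and by
  \<open>b\<close>, because \<open>c\<close> is then unique.\<close>

lemma card_inner_blocks:
  "2 * card (inner_blocks m i) \<le> (2 * m) * ((2 * m) * (2 * m - 1))"
proof -
  define g where "g = 2 * m"
  define h where "h = (\<lambda>(a, a', b). {Pt (prv i) b, Pt i a, Pt i a', Pt (nxt i) (SOME c. c < g \<and> matched m i a a' b c)})"
  define D where "D = (SIGMA a:{..<g}. {..<a} \<times> {..<g})"
  have sub: "inner_blocks m i \<subseteq> h ` D"
  proof
    fix B assume "B \<in> inner_blocks m i"
    then obtain a a' b c where B: "B = {Pt (prv i) b, Pt i a, Pt i a', Pt (nxt i) c}"
      and lt: "a < g" "a' < g" "b < g" "c < g" "a \<noteq> a'" and mt: "matched m i a a' b c"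
      unfolding inner_blocks_def g_def by blast
    have some: "(SOME c. c < g \<and> matched m i p p' b c) = c" if pp: "matched m i p p' b c" for p p'
    proof (rule some_equality)
      show "c < g \<and> matched m i p p' b c" using lt pp by blast
      show "d = c" if "d < g \<and> matched m i p p' b d" for d
        using matched_outer_unique[OF _ pp, of d] that lt by (simp add: g_def)
    qed
    show "B \<in> h ` D"
    proof (cases "a' < a")
      case True
      then show ?thesis using B lt some[OF mt]
        by (intro image_eqI[of _ _ "(a, a', b)"]) (auto simp: h_def D_def)
    next
      case False
      then show ?thesis using B lt some[OF matched_sym(1)[OF mt]]
        by (intro image_eqI[of _ _ "(a', a, b)"]) (auto simp: h_def D_def)
    qed
  qed
  have finD: "finite D" by (simp add: D_def)
  have "card D = (\<Sum>a<g. a * g)" by (simp add: D_def card_cartesian_product)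
  also have "\<dots> = (\<Sum>a<g. a) * g" by (simp add: sum_distrib_right)
  finally have "2 * card D = (2 * (\<Sum>a<g. a)) * g" by simp
  also have "2 * (\<Sum>a<g. a) = g * (g - 1)"
    by (induction g) (auto simp: algebra_simps)
  finally have "2 * card D = g * (g - 1) * g" .
  moreover have "card (inner_blocks m i) \<le> card D" by (rule surj_card_le[OF finD sub])
  ultimately show ?thesis by (simp add: g_def ac_simps)
qed

text \<open>The stem point, \<open>b\<close> and the residue of \<open>c\<close> modulo
  \<open>m\<close> determine the block: the half of \<open>c\<close> follows from the parity
  condition, and then both half and residue of \<open>a\<close> are forced.\<close>

lemma card_stem_blocks: "card (stem_blocks m i) \<le> (2 * m) * (2 * m)"
proof -
  define h where "h = (\<lambda>(x, b, r). let c = ((b div m + wt i + 1) mod 2) * m + r;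
    a = ((x + b div m + tw i) mod 2) * m + (b + c) mod m in {Stem x, Pt (prv i) b, Pt i a, Pt (nxt i) c})"
  define D where "D = {..<2::nat} \<times> {..<2 * m} \<times> {..<m}"
  have sub: "stem_blocks m i \<subseteq> h ` D"
  proof
    fix B assume "B \<in> stem_blocks m i"
    then obtain x a b c where B: "B = {Stem x, Pt (prv i) b, Pt i a, Pt (nxt i) c}"
      and lt: "a < 2 * m" "b < 2 * m" "c < 2 * m" and mt: "missed m i x a b c"
      unfolding stem_blocks_def by blast
    have m: "m > 0" using lt by auto
    have d: "a div m < 2" "c div m < 2" using lt by (auto simp: less_mult_imp_div_less mult.commute)
    have x: "x < 2" and o: "odd (b div m + c div m + wt i)" and x': "x = (a div m + b div m + tw i) mod 2"
      and am: "a mod m = (b + c) mod m" using mt by (auto simp: missed_def)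
    have c1: "c div m = (b div m + wt i + 1) mod 2" using d(2) o by (rule parity_aux)
    have a1: "a div m = (x + b div m + tw i) mod 2" using x' d(1) by (rule parity_aux)
    have c: "c = ((b div m + wt i + 1) mod 2) * m + c mod m" unfolding c1[symmetric] by simp
    have a: "a = ((x + b div m + tw i) mod 2) * m + (b + c) mod m" unfolding a1[symmetric] am[symmetric] by simp
    have "h (x, b, c mod m) = B" unfolding h_def B prod.case c[symmetric] Let_def a[symmetric] ..
    moreover have "(x, b, c mod m) \<in> D" using x lt m by (simp add: D_def)
    ultimately show "B \<in> h ` D" by blast
  qed
  have "card (stem_blocks m i) \<le> card D" by (rule surj_card_le[OF _ sub]) (simp add: D_def)
  then show ?thesis by (simp add: D_def card_cartesian_product)
qed

lemma candelabra_quadruple: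
  assumes m: "m > 0"
  shows "\<exists>C. candelabra 4 (2 * m) 2 C"
proof -
  define g where "g = 2 * m"
  have J: "{..<m} \<subseteq> {..<m}" "0 \<in> {..<m}" using m by auto
  have jo: "joined m {..<m} a b" for a b using m by (auto simp: joined_def)
  \<comment> \<open>The inner blocks combine the pairs inside a group with points of its two
    neighbours only, so the opposite groups remain, to be treated by one-factors.\<close>
  define X where "X = factor_cross m {..<m} 0"
  define C where "C = (\<Union>i<4. inner_blocks m i) \<union> (\<Union>i<4. stem_blocks m i) \<union> X 0 2 \<union> X 1 3"
  have inM: "covered C t" if "covered (inner_blocks m i) t" "i < 4" for t i
    using that unfolding C_def covered_def by blast
  have inI: "covered C t" if "covered (stem_blocks m i) t" "i < 4" for t i
    using that unfolding C_def covered_def by blast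
  have inX: "covered C t" if "covered (X 0 2) t \<or> covered (X 1 3) t" for t
    using that unfolding C_def covered_def by blast
  have opp: "covered C {Stem x, Pt (prv i) b, Pt (nxt i) c}"
    if lt: "i < 4" "x < 2" "b < g" "c < g" for i x b c
  proof (cases "odd (b div m + c div m + wt i)")
    case True
    then show ?thesis using stem_blocks_covered_opposite[of b m c i x] that m inI by (simp add: g_def)
  next
    case False
    define j where "j = nxt (nxt i)"
    \<comment> \<open>Two opposite points have two possible middle groups, \<open>i\<close> and the
      group opposite to it. Their values of \<open>wt\<close> have different parities, so whichever
      the halves of the points are, one of the two groups has missed points.\<close>
    have j: "j < 4" "prv j = nxt i" "nxt j = prv i" "odd (c div m + b div m + wt j)"
      using False groups4[OF lt(1)] by (auto simp: j_def prv_def nxt_def wt_def)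
    then show ?thesis using stem_blocks_covered_opposite[of c m b j x] that m inI[of j] by (simp add: g_def insert_commute)
  qed
  have adj: "covered C {Stem x, Pt (prv i) b, Pt i a}" if "i < 4" "x < 2" "b < g" "a < g" for i x a b
    using stem_blocks_covered_adjacent[of a m b x i] that m inI prv_nxt(1)[of i] by (auto simp: g_def)
  have trans: "covered C {Pt (prv i) b, Pt i a, Pt (nxt i) c}" if "i < 4" "a < g" "b < g" "c < g" for i a b c
    using matched_or_missed[OF m, of a i b c]
  proof
    assume "\<exists>a'<2 * m. a' \<noteq> a \<and> matched m i a a' b c"
    then show ?thesis using inner_blocks_covered(3)[of a m _ b c i] that inM by (auto simp: g_def)
  next
    assume "missed m i ((a div m + b div m + tw i) mod 2) a b c"
    then show ?thesis using stem_blocks_covered(1)[of a m b c i] that inI by (auto simp: g_def)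
  qed (use that in \<open>simp add: g_def\<close>)
  have inner: "covered C {Pt i a, Pt i a', Pt (prv i) b}" "covered C {Pt i a, Pt i a', Pt (nxt i) b}"
    if lt: "i < 4" "a < g" "a' < g" "b < g" "a \<noteq> a'" for i a a' b
  proof -
    obtain c where c: "c < 2 * m" "matched m i a a' b c" using ex_matched_outer[OF m, of i a a' b] by blast
    show "covered C {Pt i a, Pt i a', Pt (prv i) b}"
      using inM[OF inner_blocks_covered(1)[of a m a' b c i] lt(1)] c lt by (simp add: g_def)
    show "covered C {Pt i a, Pt i a', Pt (nxt i) b}"
      using inM[OF inner_blocks_covered(2)[of a m a' c b i] lt(1)] c(1) matched_sym(2)[OF c(2)] lt by (simp add: g_def)
  qed
  have far: "covered C {Pt i a, Pt i a', Pt j b}"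
    if "i = 0 \<and> j = 2 \<or> i = 2 \<and> j = 0 \<or> i = 1 \<and> j = 3 \<or> i = 3 \<and> j = 1"
      "a < g" "a' < g" "b < g" "a \<noteq> a'" for i j a a' b
  proof -
    have "covered (X p q) {Pt p a, Pt p a', Pt q b} \<and> covered (X p q) {Pt q a, Pt q a', Pt p b}" for p q
      using factor_cross_covered[OF J, of a a' b p q] that jo by (simp add: X_def g_def)
    then show ?thesis using that(1) inX by metis
  qed
  have "candelabra 4 g 2 C"
    unfolding candelabra_def
  proof (intro conjI allI ballI impI)
    fix B assume "B \<in> C"
    then consider i where "i < 4" "B \<in> inner_blocks m i" | i where "i < 4" "B \<in> stem_blocks m i" | "B \<in> X 0 2" | "B \<in> X 1 3"
      unfolding C_def by blast
    then have "B \<subseteq> pts 4 g 2 \<and> card B = 4"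
    proof cases
      case 1
      then show ?thesis using inner_blocks_block[OF 1(2,1)] by (simp add: g_def)
    next
      case 2
      then show ?thesis using stem_blocks_block[OF 2(2,1)] by (simp add: g_def)
    next
      case 3
      then show ?thesis using factor_cross_block[OF J 3[unfolded X_def], of 4] by (simp add: g_def)
    next
      case 4
      then show ?thesis using factor_cross_block[OF J 4[unfolded X_def], of 4] by (simp add: g_def)
    qed
    then show "B \<subseteq> pts 4 g 2" "card B = 4" by auto
  next
    fix x i j a b assume lt: "x < (2::nat)" "i < (4::nat)" "j < (4::nat)" "a < g" "b < g" "i \<noteq> j"
    have "i = prv j \<or> j = prv i \<or> (\<exists>k<4. i = prv k \<and> j = nxt k)"
    proof -
      have "i = prv 0 \<and> j = nxt 0 \<or> i = prv 1 \<and> j = nxt 1 \<or> i = prv 2 \<and> j = nxt 2 \<or> i = prv 3 \<and> j = nxt 3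
        \<or> i = prv j \<or> j = prv i"
        using groups4[OF lt(2)] groups4[OF lt(3)] lt(6) by (auto simp: prv_def nxt_def)
      then show ?thesis by (metis less_numeral_extra(1) numeral_less_iff semiring_norm(76,78,81) zero_less_numeral one_less_numeral_iff)
    qed
    then show "covered C {Stem x, Pt i a, Pt j b}"
      using adj[of j x a b] adj[of i x b a] opp[of _ x a b] lt by (auto simp: insert_commute)
  next
    fix i j a a' b assume lt: "i < (4::nat)" "j < (4::nat)" "a < g" "a' < g" "b < g" "i \<noteq> j" "a \<noteq> a'"
    have "j = prv i \<or> j = nxt i \<or> (i = 0 \<and> j = 2 \<or> i = 2 \<and> j = 0 \<or> i = 1 \<and> j = 3 \<or> i = 3 \<and> j = 1)"
      using groups4[OF lt(1)] groups4[OF lt(2)] lt(6) by (auto simp: prv_def nxt_def)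
    then show "covered C {Pt i a, Pt i a', Pt j b}"
      using inner[OF lt(1,3,4,5,7)] far[OF _ lt(3,4,5,7)] by blast
  next
    fix i j k a b c
    assume lt: "i < (4::nat)" "j < (4::nat)" "k < (4::nat)" "a < g" "b < g" "c < g" and ne: "i \<noteq> j" "i \<noteq> k" "j \<noteq> k"
    show "covered C {Pt i a, Pt j b, Pt k c}"
    proof (rule covered_sorted[OF _ lt ne])
      fix i j k a b c assume ijk: "i < j" "j < k" "k < (4::nat)" and lt: "a < g" "b < g" "c < g"
      consider "i = 0" "j = 1" "k = 2" | "i = 0" "j = 1" "k = 3" | "i = 0" "j = 2" "k = 3" | "i = 1" "j = 2" "k = 3"
        using ijk by linarith
      then show "covered C {Pt i a, Pt j b, Pt k c}"
      proof cases
        case 1 then show ?thesis using trans[of 1 b a c] lt by (simp add: prv_def nxt_def numeral_2_eq_2)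
      next
        case 2 then show ?thesis using trans[of 0 a c b] lt by (simp add: prv_def nxt_def insert_commute)
      next
        case 3 then show ?thesis using trans[of 3 c b a] lt by (simp add: prv_def nxt_def insert_commute)
      next
        case 4 then show ?thesis using trans[of 2 b a c] lt by (simp add: prv_def nxt_def)
      qed
    qed
  next
    have cM: "card (\<Union>i<4. inner_blocks m i) \<le> (\<Sum>i<4. card (inner_blocks m i))" by (rule card_UN_le) simp
    have "(\<Sum>i<4::nat. 2 * card (inner_blocks m i)) \<le> (\<Sum>i<4::nat. g * (g * (g - 1)))"
      unfolding g_def by (intro sum_mono card_inner_blocks)
    then have "2 * (\<Sum>i<4::nat. card (inner_blocks m i)) \<le> 4 * (g * (g * (g - 1)))" by (simp add: sum_distrib_left)
    with cM have cM: "2 * card (\<Union>i<4. inner_blocks m i) \<le> 4 * (g * (g * (g - 1)))" by linarith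
    have "card (\<Union>i<4. stem_blocks m i) \<le> (\<Sum>i<4. card (stem_blocks m i))" by (rule card_UN_le) simp
    also have "\<dots> \<le> (\<Sum>i<4::nat. g * g)" unfolding g_def by (intro sum_mono card_stem_blocks)
    finally have cI: "card (\<Union>i<4. stem_blocks m i) \<le> 4 * (g * g)" by simp
    have cX: "4 * card (X i j) \<le> (g - 1) * (g * g)" for i j
      using card_factor_cross[OF J, of i j] by (simp add: X_def g_def mult_2)
    have "card C \<le> card (\<Union>i<4. inner_blocks m i) + card (\<Union>i<4. stem_blocks m i) + card (X 0 2) + card (X 1 3)"
      unfolding C_def by (intro order_trans[OF card_Un_le] add_mono) auto
    then have "4 * card C \<le> 8 * (g * (g * (g - 1))) + 16 * (g * g) + 2 * ((g - 1) * (g * g))"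
      using cM cI cX[of 0 2] cX[of 1 3] by linarith
    then have "4 * int (card C) \<le> int (8 * (g * (g * (g - 1))) + 16 * (g * g) + 2 * ((g - 1) * (g * g)))"
      by linarith
    also have "\<dots> = 8 * (int g * (int g * (int g - 1))) + 16 * (int g * int g) + 2 * ((int g - 1) * (int g * int g))"
      using m by (simp add: g_def of_nat_diff)
    finally show "24 * int (card C) \<le> int 4 * (int 4 - 1) * int g * int g * (3 * int 2 + 3 * int g - 3 + (int 4 - 2) * int g)"
      by (simp add: algebra_simps)
  qed
  then show ?thesis unfolding g_def by blast
qed

section \<open>Small systems\<close>

text \<open>The automorphism of order seven shifts both halves of the point set \<open>{..<14}\<close>.\<close>

definition fourteen_blocks :: "nat list list" where
  "fourteen_blocks = concat (map (\<lambda>b. map (\<lambda>k. map (\<lambda>x. 7 * (x div 7) + (x + k - 7 * (x div 7)) mod 7) b) [0..<7])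
     [[0,1,2,4], [0,1,5,9], [0,1,7,13], [0,1,8,12], [0,1,10,11], [0,2,7,9], [0,2,8,13], [0,2,10,12],
      [0,3,7,8], [0,3,9,12], [0,3,10,13], [0,8,9,11], [7,8,9,12]])"

lemma sqs_exists_14: "sqs_exists 14"
proof (rule sqs_existsI)
  show "steiner_quadruple_system 14 {..<14::nat} (set ` set fourteen_blocks)"
  proof (rule steiner_quadruple_system_by_counting)
    have "\<forall>b\<in>set fourteen_blocks. (\<forall>x\<in>set b. x < 14) \<and> length b = 4 \<and> distinct b" by code_simp
    then show "b \<subseteq> {..<14} \<and> card b = 4" if "b \<in> set ` set fourteen_blocks" for b
      using that by (auto simp: distinct_card)
    have cov: "\<forall>z\<in>set [0..<14]. \<forall>y\<in>set [0..<z]. \<forall>x\<in>set [0..<y].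
        \<exists>b\<in>set fourteen_blocks. x \<in> set b \<and> y \<in> set b \<and> z \<in> set b" by code_simp
    have "\<exists>b\<in>set ` set fourteen_blocks. {x, y, z} \<subseteq> b" if "x < y" "y < z" "z < 14" for x y z
    proof -
      have "\<exists>b\<in>set fourteen_blocks. x \<in> set b \<and> y \<in> set b \<and> z \<in> set b"
        by (rule cov[THEN bspec, THEN bspec, THEN bspec]) (use that in auto)
      then obtain b where "b \<in> set fourteen_blocks" "{x, y, z} \<subseteq> set b" by auto
      then show ?thesis by (intro bexI[of _ "set b"]) auto
    qed
    note sorted = this
    show "\<exists>b\<in>set ` set fourteen_blocks. {x, y, z} \<subseteq> b"
      if "x \<in> {..<14}" "y \<in> {..<14}" "z \<in> {..<14}" and ne: "x \<noteq> y" "x \<noteq> z" "y \<noteq> z" for x y z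
    proof -
      have lt: "x < 14" "y < 14" "z < 14" using that by auto
      consider "x < y" "y < z" | "x < z" "z < y" | "y < x" "x < z" | "y < z" "z < x" | "z < x" "x < y" | "z < y" "y < x"
        using ne by linarith
      then show ?thesis
      proof cases
        case 1 then show ?thesis using sorted[of x y z] lt by simp
      next
        case 2 then show ?thesis using sorted[of x z y] lt by (simp add: insert_commute)
      next
        case 3 then show ?thesis using sorted[of y x z] lt by (simp add: insert_commute)
      next
        case 4 then show ?thesis using sorted[of y z x] lt by (simp add: insert_commute)
      next
        case 5 then show ?thesis using sorted[of z x y] lt by (simp add: insert_commute)
      next
        case 6 then show ?thesis using sorted[of z y x] lt by (simp add: insert_commute)
      qed
    qed
    have "card (set ` set fourteen_blocks) \<le> card (set fourteen_blocks)" by (rule card_image_le) simp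
    also have "\<dots> \<le> length fourteen_blocks" by (rule card_length)
    also have "length fourteen_blocks = 91" by code_simp
    finally show "24 * card (set ` set fourteen_blocks) \<le> 14 * (14 - 1) * (14 - 2)" by simp
  qed auto
qed

text \<open>Modulo 3 a sum is nonzero exactly if two of the three terms agree and the third differs.
  The blocks \<open>two\<close> cover these triples and the pairs that avoid the third point
  \<open>q\<close>; the blocks \<open>flat\<close> cover the pairs together with a point other than
  \<open>q\<close>; the star takes the sum zero.\<close>

lemma candelabra_three_base: "\<exists>C. candelabra 3 3 1 C"
proof -
  define G where "G = {..<3::nat} \<times> {..<3::nat}"
  define P where "P = [((0::nat), (1::nat), (2::nat)), (1, 2, 0), (2, 0, 1)]"
  define two where "two = (\<lambda>((i, j, k), q). {Pt i ((q + 1) mod 3), Pt i ((q + 2) mod 3), Pt j q, Pt k q}) ` (set P \<times> {..<3::nat})"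
  define flat where "flat = (\<lambda>((i, j, k), q). {Pt i ((q + 1) mod 3), Pt i ((q + 2) mod 3), Pt j ((q + 1) mod 3), Pt j ((q + 2) mod 3)}) ` (set P \<times> {..<3::nat})"
  define C where "C = star 3 0 0 0 1 2 \<union> two \<union> flat"
  have range3: "{..<3::nat} = {0, 1, 2}" by auto
  have two: "two = {{Pt 0 1, Pt 0 2, Pt 1 0, Pt 2 0}, {Pt 0 2, Pt 0 0, Pt 1 1, Pt 2 1}, {Pt 0 0, Pt 0 1, Pt 1 2, Pt 2 2},
     {Pt 1 1, Pt 1 2, Pt 2 0, Pt 0 0}, {Pt 1 2, Pt 1 0, Pt 2 1, Pt 0 1}, {Pt 1 0, Pt 1 1, Pt 2 2, Pt 0 2},
     {Pt 2 1, Pt 2 2, Pt 0 0, Pt 1 0}, {Pt 2 2, Pt 2 0, Pt 0 1, Pt 1 1}, {Pt 2 0, Pt 2 1, Pt 0 2, Pt 1 2}}"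
    unfolding two_def P_def range3 by (simp add: numeral_2_eq_2)
  have flat: "flat = {{Pt 0 1, Pt 0 2, Pt 1 1, Pt 1 2}, {Pt 0 2, Pt 0 0, Pt 1 2, Pt 1 0}, {Pt 0 0, Pt 0 1, Pt 1 0, Pt 1 1},
     {Pt 1 1, Pt 1 2, Pt 2 1, Pt 2 2}, {Pt 1 2, Pt 1 0, Pt 2 2, Pt 2 0}, {Pt 1 0, Pt 1 1, Pt 2 0, Pt 2 1},
     {Pt 2 1, Pt 2 2, Pt 0 1, Pt 0 2}, {Pt 2 2, Pt 2 0, Pt 0 2, Pt 0 0}, {Pt 2 0, Pt 2 1, Pt 0 0, Pt 0 1}}"
    unfolding flat_def P_def range3 by (simp add: numeral_2_eq_2)
  have cases3: "x = 0 \<or> x = 1 \<or> x = 2" if "x < 3" for x :: nat using that by linarith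
  have "candelabra 3 3 1 C"
  proof (rule candelabra_three)
    fix B assume "B \<in> C"
    then consider "B \<in> star 3 0 0 0 1 2" | "B \<in> two" | "B \<in> flat" unfolding C_def by blast
    then show "B \<subseteq> pts 3 3 1 \<and> card B = 4"
    proof cases
      case 1 then show ?thesis using star_block[OF 1, of 3 1] by simp
    next
      case 2 then show ?thesis unfolding two by auto
    next
      case 3 then show ?thesis unfolding flat by auto
    qed
  next
    fix x a b :: nat assume "x < 1" "a < 3" "b < 3"
    then show "covered C {Stem x, Pt 0 a, Pt 1 b} \<and> covered C {Stem x, Pt 0 a, Pt 2 b} \<and> covered C {Stem x, Pt 1 a, Pt 2 b}"
      using star_covered[of a 3 b 0 0 0 1 2] by (simp add: C_def covered_Un)
  next
    fix i j a a' b :: nat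
    assume lt: "i < 3" "j < 3" and ne: "i \<noteq> j" and lt': "a < 3" "a' < 3" "b < 3" and ne': "a \<noteq> a'"
    have "covered (two \<union> flat) {Pt i a, Pt i a', Pt j b}"
      using cases3[OF lt(1)] cases3[OF lt(2)] cases3[OF lt'(1)] cases3[OF lt'(2)] cases3[OF lt'(3)] ne ne'
      unfolding two flat covered_def by (elim disjE) (simp_all only: refl not_True_eq_False, simp_all)
    then show "covered C {Pt i a, Pt i a', Pt j b}" by (auto simp: C_def covered_Un)
  next
    fix a b c :: nat
    assume abc: "a < 3" "b < 3" "c < 3"
    show "covered C {Pt 0 a, Pt 1 b, Pt 2 c}"
    proof (cases "(a + b + c) mod 3 = 0")
      case True
      then show ?thesis using star_covered_transversal(1)[of a 3 b c 0 0 0 1 2] abc by (simp add: C_def covered_Un)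
    next
      case False
      have "covered (two \<union> flat) {Pt 0 a, Pt 1 b, Pt 2 c}"
        using cases3[OF abc(1)] cases3[OF abc(2)] cases3[OF abc(3)] False
        unfolding two flat covered_def by (elim disjE) simp_all
      then show ?thesis by (auto simp: C_def covered_Un)
    qed
  next
    have "card (set P \<times> {..<3::nat}) \<le> 9"
      using card_length[of P] by (simp add: card_cartesian_product P_def)
    note le = order_trans[OF card_image_le this]
    have "card two \<le> 9" "card flat \<le> 9" unfolding two_def flat_def by (rule le; simp)+
    moreover have "card C \<le> card (star 3 0 0 0 1 2) + card two + card flat"
      unfolding C_def by (intro order_trans[OF card_Un_le] add_mono) auto
    ultimately have "card C \<le> 27" using card_star[of 3 0 0 0 1 2] by linarith
    then show "24 * int (card C) \<le> 6 * int 3 * int 3 * (3 * int 1 + 4 * int 3 - 3)" by simp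
  qed
  then show ?thesis by blast
qed

section \<open>Multiplying the groups of a quadruple system\<close>

definition relabel :: "(nat \<Rightarrow> nat) \<Rightarrow> pt \<Rightarrow> pt" where
  "relabel f p = (case p of Stem x \<Rightarrow> Stem x | Pt i a \<Rightarrow> Pt (f i) a)"

lemma relabel_simps [simp]: "relabel f (Stem x) = Stem x" "relabel f (Pt i a) = Pt (f i) a"
  by (simp_all add: relabel_def)

text \<open>The words of zero sum over the four groups of \<open>b\<close>: any three letters
  determine the fourth, so each transversal triple on three of the groups extends to one
  word.\<close>

definition transversals :: "nat \<Rightarrow> nat set \<Rightarrow> pt set set" where
  "transversals g b = {(\<lambda>i. Pt i (h i)) ` b | h. (\<forall>i\<in>b. h i < g) \<and> (\<Sum>i\<in>b. h i) mod g = 0}"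

lemma transversalsE:
  assumes "S \<in> transversals g b"
  obtains h where "S = (\<lambda>i. Pt i (h i)) ` b" "\<forall>i\<in>b. h i < g" "(\<Sum>i\<in>b. h i) mod g = 0"
  using assms unfolding transversals_def mem_Collect_eq by (elim exE conjE)

lemma card_transversals:
  assumes "card b = 4"
  shows "card (transversals g b) \<le> g * g * g"
proof -
  have "finite b" using assms by (metis card.infinite zero_neq_numeral)
  then obtain xs where xs: "set xs = b" "distinct xs" "length xs = 4"
    using assms by (metis distinct_card finite_distinct_list)
  then obtain p q r t where pqrt: "xs = [p, q, r, t]"
    by (auto simp: numeral_eq_Suc length_Suc_conv)
  with xs have b: "b = {p, q, r, t}" "p \<noteq> q" "p \<noteq> r" "p \<noteq> t" "q \<noteq> r" "q \<noteq> t" "r \<noteq> t" by auto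
  define F where "F = (\<lambda>(x, y, z). {Pt p x, Pt q y, Pt r z, Pt t (THE w. w < g \<and> (x + y + z + w) mod g = 0)})"
  have "transversals g b \<subseteq> F ` ({..<g} \<times> {..<g} \<times> {..<g})"
  proof
    fix S assume "S \<in> transversals g b"
    then obtain h where S: "S = (\<lambda>i. Pt i (h i)) ` b" and lt: "\<forall>i\<in>b. h i < g" and s: "(\<Sum>i\<in>b. h i) mod g = 0"
      by (rule transversalsE)
    have s: "(h p + h q + h r + h t) mod g = 0" using s b by (simp add: ac_simps)
    have "(THE w. w < g \<and> (h p + h q + h r + w) mod g = 0) = h t"
    proof (rule the_equality)
      show "h t < g \<and> (h p + h q + h r + h t) mod g = 0" using lt b s by simp
      fix w assume w: "w < g \<and> (h p + h q + h r + w) mod g = 0"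
      then have "[h p + h q + h r + w = h p + h q + h r + h t] (mod g)" using s by (simp add: cong_def)
      then have "[w = h t] (mod g)" by (simp only: cong_add_lcancel_nat)
      then show "w = h t" using w lt b by (simp add: cong_def)
    qed
    then have "S = F (h p, h q, h r)" using S b by (simp add: F_def)
    then show "S \<in> F ` ({..<g} \<times> {..<g} \<times> {..<g})" using lt b by auto
  qed
  then have "card (transversals g b) \<le> card ({..<g} \<times> {..<g} \<times> {..<g})"
    by (rule surj_card_le[rotated]) simp
  then show ?thesis by (simp add: card_cartesian_product)
qed

lemma transversals_covered:
  assumes b: "card b = 4" and ijk: "i \<in> b" "j \<in> b" "k \<in> b" "i \<noteq> j" "i \<noteq> k" "j \<noteq> k" and lt: "x < g" "y < g" "z < g"
  shows "covered (transversals g b) {Pt i x, Pt j y, Pt k z}"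
proof -
  have fin: "finite b" using b by (metis card.infinite zero_neq_numeral)
  have "card (b - {i, j, k}) = 1" using b ijk fin by (simp add: card_Diff_subset)
  then obtain l where "b - {i, j, k} = {l}" by (rule card_1_singletonE)
  then have bl: "b = {i, j, k, l}" "l \<noteq> i" "l \<noteq> j" "l \<noteq> k" using ijk by auto
  define w where "w = third g 0 x ((y + z) mod g)"
  have g: "g > 0" using lt by simp
  have "(w + x + (y + z) mod g) mod g = 0"
    using third_sum[of x g "(y + z) mod g" 0] lt g by (simp add: w_def)
  then have "(w + x + (y + z)) mod g = 0" by (simp only: mod_add_right_eq)
  then have "(x + y + z + w) mod g = 0" by (simp only: ac_simps)
  moreover have w: "w < g" using g by (simp add: w_def third_lt)
  moreover define h where "h = (\<lambda>n. if n = i then x else if n = j then y else if n = k then z else w)"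
  ultimately have "(\<Sum>n\<in>b. h n) mod g = 0" using bl ijk by (simp add: ac_simps)
  moreover have "\<forall>n\<in>b. h n < g" using lt w by (simp add: h_def)
  ultimately have "(\<lambda>n. Pt n (h n)) ` b \<in> transversals g b"
    unfolding transversals_def mem_Collect_eq by (intro exI[of _ h] conjI refl)
  moreover have "{Pt i x, Pt j y, Pt k z} \<subseteq> (\<lambda>n. Pt n (h n)) ` b"
    using bl ijk by (auto simp: h_def)
  ultimately show ?thesis by (rule coveredI)
qed

text \<open>The point \<open>n = u - 1\<close> is deleted and every other point becomes a group. Two
  groups lie with \<open>n\<close> in one block, and the copy of \<open>C0\<close> on the three
  groups of that block covers the triples that meet exactly these two. Three groups lie in one
  block: if it contains \<open>n\<close>, the copy of \<open>C0\<close> covers their transversals,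
  and otherwise the words of zero sum do.\<close>

lemma candelabra_product:
  assumes sqs: "sqs_exists u" and u: "u \<ge> 4" and C0: "candelabra 3 g s C0"
  shows "\<exists>C. candelabra (u - 1) g s C"
proof -
  define n where "n = u - 1"
  obtain \<B> where \<B>: "steiner_quadruple_system u {..<u} \<B>"
    using sqs_exists_onE[OF sqs, of "{..<u}"] by auto
  have blk: "b \<subseteq> {..<u}" "card b = 4" if "b \<in> \<B>" for b
    using \<B> that by (auto simp: steiner_quadruple_system_def)
  have finB: "finite \<B>" by (rule finite_blocks[OF \<B>])
  define \<B>1 where "\<B>1 = {b \<in> \<B>. n \<in> b}"
  define \<B>0 where "\<B>0 = {b \<in> \<B>. n \<notin> b}"
  have "\<exists>f. bij_betw f {..<3::nat} (b - {n})" if "b \<in> \<B>1" for b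
  proof -
    have "b \<in> \<B>" "n \<in> b" using that by (auto simp: \<B>1_def)
    then have "card (b - {n}) = 3" "finite (b - {n})"
      using blk[of b] finite_subset[of b "{..<u}"] by auto
    then show ?thesis using finite_same_card_bij[of "{..<3::nat}" "b - {n}"] by simp
  qed
  then obtain \<phi> where \<phi>: "\<And>b. b \<in> \<B>1 \<Longrightarrow> bij_betw (\<phi> b) {..<3::nat} (b - {n})" by metis
  define D1 where "D1 b = (`) (relabel (\<phi> b)) ` C0" for b
  define C where "C = (\<Union>b\<in>\<B>1. D1 b) \<union> (\<Union>b\<in>\<B>0. transversals g b)"
  have in1: "covered C (relabel (\<phi> b) ` t)" if "covered C0 t" "b \<in> \<B>1" for b t
    using that unfolding C_def D1_def covered_def by blast
  have in0: "covered C t" if "covered (transversals g b) t" "b \<in> \<B>0" for b t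
    using that unfolding C_def covered_def by blast
  have pre: "\<exists>i'<3. \<phi> b i' = i" if "b \<in> \<B>1" "i \<in> b" "i \<noteq> n" for b i
    using \<phi>[OF that(1)] that unfolding bij_betw_def by (metis DiffI imageE lessThan_iff singletonD)
  have thr: "\<exists>b\<in>\<B>1. i \<in> b \<and> j \<in> b" if "i < n" "j < n" "i \<noteq> j" for i j
  proof -
    have un: "n < u" "i < u" "j < u" "n \<noteq> i" "n \<noteq> j" using that u by (auto simp: n_def)
    then obtain b where "b \<in> \<B>" "n \<in> b" "i \<in> b" "j \<in> b"
      using sqs_blockE[OF \<B>, of n i j] \<open>i \<noteq> j\<close> by (metis lessThan_iff)
    then show ?thesis by (auto simp: \<B>1_def)
  qed
  have "candelabra n g s C"
    unfolding candelabra_def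
  proof (intro conjI allI ballI impI)
    fix B assume "B \<in> C"
    then consider b where "b \<in> \<B>1" "B \<in> D1 b" | b where "b \<in> \<B>0" "B \<in> transversals g b"
      unfolding C_def by blast
    then have "B \<subseteq> pts n g s \<and> card B = 4"
    proof cases
      case 1
      then obtain c where c: "c \<in> C0" "B = relabel (\<phi> b) ` c" by (auto simp: D1_def)
      have c3: "c \<subseteq> pts 3 g s" "card c = 4" using candelabraD(1,2)[OF C0 c(1)] by auto
      have inj: "inj_on (\<phi> b) {..<3}" and img: "\<phi> b ` {..<3} = b - {n}"
        using \<phi>[OF 1(1)] by (auto simp: bij_betw_def)
      have "b \<subseteq> {..<u}" using blk 1 by (auto simp: \<B>1_def)
      then have lt: "\<phi> b i < n" if "i < 3" for i
      proof -
        have "\<phi> b i \<in> b - {n}" using img that by blast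
        then have "\<phi> b i < u" "\<phi> b i \<noteq> n" using \<open>b \<subseteq> {..<u}\<close> by auto
        then show ?thesis by (simp add: n_def)
      qed
      have "relabel (\<phi> b) p \<in> pts n g s" if "p \<in> pts 3 g s" for p
        using that by (cases rule: pts_cases) (auto simp: lt)
      moreover have "inj_on (relabel (\<phi> b)) (pts 3 g s)"
      proof (rule inj_onI)
        fix p q assume p: "p \<in> pts 3 g s" and q: "q \<in> pts 3 g s" and eq: "relabel (\<phi> b) p = relabel (\<phi> b) q"
        show "p = q"
          using p q eq by (cases p; cases q) (auto dest: inj_onD[OF inj])
      qed
      then have "card B = 4" using c c3 card_image[OF inj_on_subset] by metis
      ultimately show ?thesis using c c3 by auto
    next
      case 2
      then have b: "b \<subseteq> {..<u}" "card b = 4" "n \<notin> b" using blk by (auto simp: \<B>0_def)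
      obtain h where h: "B = (\<lambda>i. Pt i (h i)) ` b" "\<forall>i\<in>b. h i < g"
        using 2(2) by (rule transversalsE)
      have "i < n" if "i \<in> b" for i
      proof -
        have "i < u" "i \<noteq> n" using b that by auto
        then show ?thesis by (simp add: n_def)
      qed
      moreover have "card B = card b" unfolding h(1) by (rule card_image) (simp add: inj_on_def)
      ultimately show ?thesis using h b by auto
    qed
    then show "B \<subseteq> pts n g s" "card B = 4" by auto
  next
    fix x i j a b assume lt: "x < s" "i < n" "j < n" "a < g" "b < g" "i \<noteq> j"
    obtain d where d: "d \<in> \<B>1" "i \<in> d" "j \<in> d" using thr lt by blast
    obtain i' j' where ij: "i' < 3" "\<phi> d i' = i" "j' < 3" "\<phi> d j' = j" using pre d lt by (metis nat_neq_iff)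
    have "covered C0 {Stem x, Pt i' a, Pt j' b}" using candelabraD(3)[OF C0] ij lt by blast
    then show "covered C {Stem x, Pt i a, Pt j b}" using in1[OF _ d(1)] ij by force
  next
    fix i j a a' b assume lt: "i < n" "j < n" "a < g" "a' < g" "b < g" "i \<noteq> j" "a \<noteq> a'"
    obtain d where d: "d \<in> \<B>1" "i \<in> d" "j \<in> d" using thr lt by blast
    obtain i' j' where ij: "i' < 3" "\<phi> d i' = i" "j' < 3" "\<phi> d j' = j" using pre d lt by (metis nat_neq_iff)
    have "covered C0 {Pt i' a, Pt i' a', Pt j' b}" using candelabraD(4)[OF C0] ij lt by blast
    then show "covered C {Pt i a, Pt i a', Pt j b}" using in1[OF _ d(1)] ij by force
  next
    fix i j k a b c assume lt: "i < n" "j < n" "k < n" "a < g" "b < g" "c < g" and ne: "i \<noteq> j" "i \<noteq> k" "j \<noteq> k"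
    have "i \<in> {..<u}" "j \<in> {..<u}" "k \<in> {..<u}" using lt by (auto simp: n_def)
    then obtain d where d: "d \<in> \<B>" "i \<in> d" "j \<in> d" "k \<in> d" using sqs_blockE[OF \<B>] ne by metis
    show "covered C {Pt i a, Pt j b, Pt k c}"
    proof (cases "n \<in> d")
      case True
      then have d1: "d \<in> \<B>1" using d by (simp add: \<B>1_def)
      obtain i' j' k' where ij: "i' < 3" "\<phi> d i' = i" "j' < 3" "\<phi> d j' = j" "k' < 3" "\<phi> d k' = k"
        using pre[OF d1] d lt by (metis nat_neq_iff)
      have "covered C0 {Pt i' a, Pt j' b, Pt k' c}"
        by (rule candelabraD(5)[OF C0]) (use ij lt ne in auto)
      then show ?thesis using in1[OF _ d1] ij by force
    next
      case False
      then have "d \<in> \<B>0" using d by (simp add: \<B>0_def)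
      moreover have "covered (transversals g d) {Pt i a, Pt j b, Pt k c}"
        using transversals_covered[OF blk(2)[OF d(1)] d(2-4) ne lt(4-6)] .
      ultimately show ?thesis using in0 by blast
    qed
  next
    define r where "r = card \<B>1"
    have fin: "finite \<B>0" "finite \<B>1" using finB by (auto simp: \<B>0_def \<B>1_def)
    have BB: "card \<B> = card \<B>0 + r"
    proof -
      have "\<B> = \<B>0 \<union> \<B>1" "\<B>0 \<inter> \<B>1 = {}" by (auto simp: \<B>0_def \<B>1_def)
      then show ?thesis using fin by (simp add: card_Un_disjoint r_def)
    qed
    have nu: "int u = int n + 1" using u by (simp add: n_def)
    have "6 * r = (u - 1) * (u - 2)"
      using card_blocks_point[OF \<B>, of n] u by (simp add: r_def \<B>1_def n_def)
    then have "6 * int r = int ((u - 1) * (u - 2))" by (metis of_nat_mult of_nat_numeral)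
    also have "\<dots> = int n * (int n - 1)" using u by (simp add: n_def of_nat_diff)
    finally have r: "6 * int r = int n * (int n - 1)" .
    have "int (24 * card \<B>) = int u * (int u - 1) * (int u - 2)"
      unfolding card_blocks[OF \<B>] by (rule int_falling)
    then have "24 * int (card \<B>) = (int n + 1) * int n * (int n - 1)"
      unfolding nu by simp
    then have r0: "24 * int (card \<B>0) = (int n + 1) * int n * (int n - 1) - 4 * (int n * (int n - 1))"
    proof -
      have "24 * int (card \<B>0) + 4 * (6 * int r) = 24 * int (card \<B>)" using BB by simp
      then show ?thesis using \<open>24 * int (card \<B>) = _\<close> unfolding r by simp
    qed
    have "card (\<Union>b\<in>\<B>1. D1 b) \<le> (\<Sum>b\<in>\<B>1. card (D1 b))" by (rule card_UN_le[OF fin(2)])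
    also have "\<dots> \<le> (\<Sum>b\<in>\<B>1. card C0)"
      unfolding D1_def using candelabra_finite[OF C0] by (intro sum_mono card_image_le)
    finally have c1: "card (\<Union>b\<in>\<B>1. D1 b) \<le> r * card C0" by (simp add: r_def)
    have "card (\<Union>b\<in>\<B>0. transversals g b) \<le> (\<Sum>b\<in>\<B>0. card (transversals g b))" by (rule card_UN_le[OF fin(1)])
    also have "\<dots> \<le> (\<Sum>b\<in>\<B>0. g * g * g)"
    proof (rule sum_mono)
      fix b assume "b \<in> \<B>0"
      then have "card b = 4" using blk(2)[of b] by (simp add: \<B>0_def)
      then show "card (transversals g b) \<le> g * g * g" by (rule card_transversals)
    qed
    finally have c0: "card (\<Union>b\<in>\<B>0. transversals g b) \<le> card \<B>0 * (g * g * g)" by simp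
    have "card C \<le> r * card C0 + card \<B>0 * (g * g * g)"
      unfolding C_def using c0 c1 by (intro order_trans[OF card_Un_le] add_mono)
    then have "24 * int (card C) \<le> 24 * int (r * card C0 + card \<B>0 * (g * g * g))"
      by (simp only: mult_le_cancel_left_pos zero_less_numeral of_nat_le_iff)
    also have "\<dots> = int r * (24 * int (card C0)) + (24 * int (card \<B>0)) * (int g * int g * int g)"
      by (simp add: algebra_simps)
    also have "\<dots> \<le> int r * (6 * int g * int g * (3 * int s + 4 * int g - 3)) + (24 * int (card \<B>0)) * (int g * int g * int g)"
    proof -
      have "24 * int (card C0) \<le> 6 * int g * int g * (3 * int s + 4 * int g - 3)"
        using candelabraD(6)[OF C0] by (simp add: algebra_simps)
      then show ?thesis by (intro add_mono mult_left_mono) auto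
    qed
    also have "\<dots> = (6 * int r) * (int g * int g * (3 * int s + 4 * int g - 3)) + (24 * int (card \<B>0)) * (int g * int g * int g)"
      by simp
    also have "\<dots> = int n * (int n - 1) * int g * int g * (3 * int s + 3 * int g - 3 + (int n - 2) * int g)"
      unfolding r r0 by (simp add: algebra_simps)
    finally show "24 * int (card C) \<le> int n * (int n - 1) * int g * int g * (3 * int s + 3 * int g - 3 + (int n - 2) * int g)" .
  qed
  then show ?thesis unfolding n_def by blast
qed

section \<open>Twelvefold groups and Hanani's theorem\<close>

text \<open>A residue class modulo 3 is a cycle of length four under the difference 3 modulo 12. Its
  two one-factors have the indices \<open>k\<close> and \<open>k + 3\<close>: the edges start at the
  points congruent to the index modulo 6.\<close>

definition sixth :: "nat \<Rightarrow> nat \<Rightarrow> nat" where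
  "sixth k x = (if (x + 12 - k) mod 6 = 0 then (x + 3) mod 12 else (x + 9) mod 12)"

definition class3 :: "nat \<Rightarrow> nat set" where
  "class3 k = {x. x < 12 \<and> x mod 3 = k mod 3}"

text \<open>The differences 3 of the integers modulo 12 are treated by means of the residues modulo 3: in a
  transversal triple whose sum is not divisible by 3, exactly two of the residues agree.\<close>

lemma candelabra_twelve: "\<exists>C. candelabra 3 12 2 C"
proof -
  define G where "G = {..<12::nat} \<times> {..<12::nat}"
  define H where "H = {(b, c) \<in> G. b mod 3 = c mod 3}"
  \<comment> \<open>The offsets 2 and 3 are the differences 5 and 7, that is, 5 up to sign. The odd
    differences 1 and 3 up to sign are left to the other blocks.\<close>
  define J where "J = {2, 3::nat}"
  define mids3 where "mids3 t t' D = mid 12 D t t' 0 1 2 \<union> mid 12 D t t' 1 2 0 \<union> mid 12 D t t' 2 0 1" for t t' D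
  \<comment> \<open>The consecutive sums 6, 7 and 8, 9 and 10, 11 each serve one middle group and
    settle the difference 1. The sums 0 and 3 belong to the stem, and 1, 4 and 2, 5 are used for the
    difference 3.\<close>
  define M where "M = mid 12 G 6 7 0 1 2 \<union> mid 12 G 8 9 1 2 0 \<union> mid 12 G 10 11 2 0 1"
  define X where "X i j = factor_cross 6 J 2 i j \<union> cross {..<6} class3 sixth i j" for i j
  define C where "C = star 12 0 0 0 1 2 \<union> star 12 1 3 0 1 2 \<union> M \<union> mids3 1 4 H \<union> mids3 2 5 H \<union> X 0 1 \<union> X 0 2 \<union> X 1 2"
  have J: "J \<subseteq> {..<6}" "2 \<in> J" by (auto simp: J_def)
  have GH: "G \<subseteq> {..<12} \<times> {..<12}" "H \<subseteq> {..<12} \<times> {..<12}" by (auto simp: G_def H_def)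
  have c3: "class3 k \<subseteq> {..<12}" "finite (class3 k)" for k
    by (auto simp: class3_def)
  have inv: "involution_on (class3 k) (sixth k)" and cc: "card (class3 k) = 4" if "k < 6" for k
  proof -
    have "\<forall>k\<in>set [0..<6]. \<forall>x\<in>set [0..<12]. x mod 3 = k mod 3 \<longrightarrow>
        sixth k x < 12 \<and> sixth k x mod 3 = k mod 3 \<and> sixth k x \<noteq> x \<and> sixth k (sixth k x) = x" by code_simp
    then show "involution_on (class3 k) (sixth k)"
      using that by (simp add: involution_on_def class3_def)
    have "\<forall>k\<in>set [0..<6]. length (filter (\<lambda>x. x mod 3 = k mod 3) [0..<12]) = 4" by code_simp
    then have "length (filter (\<lambda>x. x mod 3 = k mod 3) [0..<12]) = 4" using that by simp
    moreover have "class3 k = set (filter (\<lambda>x. x mod 3 = k mod 3) [0..<12])" by (auto simp: class3_def)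
    ultimately show "card (class3 k) = 4" by (metis distinct_card distinct_filter distinct_upt)
  qed
  have covs: "covered C t" if "covered (star 12 0 0 0 1 2) t \<or> covered (star 12 1 3 0 1 2) t \<or> covered M t \<or>
      covered (mids3 1 4 H) t \<or> covered (mids3 2 5 H) t \<or> covered (X 0 1) t \<or> covered (X 0 2) t \<or> covered (X 1 2) t" for t
    using that by (auto simp: C_def covered_Un)
  have "candelabra 3 12 2 C"
  proof (rule candelabra_three)
    fix B assume "B \<in> C"
    then consider "B \<in> star 12 0 0 0 1 2" | "B \<in> star 12 1 3 0 1 2" | "B \<in> M" | "B \<in> mids3 1 4 H" | "B \<in> mids3 2 5 H"
      | i j where "B \<in> X i j" "i < 3" "j < 3" "i \<noteq> j"
      unfolding C_def by fastforce
    then show "B \<subseteq> pts 3 12 2 \<and> card B = 4"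
    proof cases
      case 1 then show ?thesis using star_block[OF 1, where n = 3 and s = 2] by simp
    next
      case 2 then show ?thesis using star_block[OF 2, where n = 3 and s = 2] by simp
    next
      case 3
      then show ?thesis
        unfolding M_def using mid_block(1)[OF _ GH(1), of B _ _ _ _ _ 3 2] mid_block(2)[OF _ GH(1), of B _ _ _ _ _ 3]
        by (elim UnE) simp_all
    next
      case 4
      then show ?thesis
        unfolding mids3_def using mid_block(1)[OF _ GH(2), of B _ _ _ _ _ 3 2] mid_block(2)[OF _ GH(2), of B _ _ _ _ _ 3]
        by (elim UnE) simp_all
    next
      case 5
      then show ?thesis
        unfolding mids3_def using mid_block(1)[OF _ GH(2), of B _ _ _ _ _ 3 2] mid_block(2)[OF _ GH(2), of B _ _ _ _ _ 3]
        by (elim UnE) simp_all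
    next
      case (6 i j)
      from 6(1) show ?thesis unfolding X_def
      proof
        assume "B \<in> factor_cross 6 J 2 i j"
        then show ?thesis using factor_cross_block[OF J _ 6(4,2,3)] by simp
      next
        assume "B \<in> cross {..<6} class3 sixth i j"
        then show ?thesis by (rule cross_block[OF _ 6(4,2,3)]) (use inv c3 in auto)
      qed
    qed
  next
    fix x a b :: nat assume "x < 2" "a < 12" "b < 12"
    then show "covered C {Stem x, Pt 0 a, Pt 1 b} \<and> covered C {Stem x, Pt 0 a, Pt 2 b} \<and> covered C {Stem x, Pt 1 a, Pt 2 b}"
      using star_covered[of a 12 b 0 0 0 1 2] star_covered[of a 12 b 1 3 0 1 2] covs by (auto simp: less_2_cases_iff)
  next
    fix i j a a' b :: nat
    assume lt: "i < 3" "j < 3" and ne: "i \<noteq> j" and ab: "a < 12" "a' < 12" "b < 12" "a \<noteq> a'"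
    have Xcov: "covered C {Pt i p, Pt i q, Pt j b}"
      if X: "\<And>k l. covered (X k l) {Pt k p, Pt k q, Pt l b} \<and> covered (X k l) {Pt l p, Pt l q, Pt k b}" for p q
    proof -
      consider "i = 0" "j = 1" | "i = 0" "j = 2" | "i = 1" "j = 2" | "i = 1" "j = 0" | "i = 2" "j = 0" | "i = 2" "j = 1"
        using lt ne by linarith
      then show ?thesis
      proof cases
        case 1 then show ?thesis using covs X[of 0 1] by simp
      next
        case 2 then show ?thesis using covs X[of 0 2] by simp
      next
        case 3 then show ?thesis using covs X[of 1 2] by simp
      next
        case 4 then show ?thesis using covs X[of 0 1] by simp
      next
        case 5 then show ?thesis using covs X[of 0 2] by simp
      next
        case 6 then show ?thesis using covs X[of 1 2] by simp
      qed
    qed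
    have i3: "i = 0 \<or> i = 1 \<or> i = 2" and "j = 0 \<or> j = 1 \<or> j = 2" using lt by linarith+
    then have j3: "j = Suc i mod 3 \<or> j = Suc (Suc i) mod 3" using ne by auto
    have Mcov: "covered C {Pt i p, Pt i q, Pt j b}" if "p < 12" "q < 12" "(p + 1) mod 12 = q" for p q
    proof -
      define y where "y = third 12 (6 + 2 * i) p b"
      have "(p + (7 + 2 * i)) mod 12 = (p + 1 + (6 + 2 * i)) mod 12"
        by (rule arg_cong[where f = "\<lambda>x. x mod 12"]) simp
      also have "\<dots> = (q + (6 + 2 * i)) mod 12" using that(3) by (metis mod_add_left_eq)
      finally have "(p + (7 + 2 * i)) mod 12 = (q + (6 + 2 * i)) mod 12" .
      moreover have "(b, y) \<in> G" "(y, b) \<in> G" using ab third_lt[of 12] by (auto simp: G_def y_def)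
      ultimately have "covered (mid 12 G (6 + 2 * i) (7 + 2 * i) i (Suc i mod 3) (Suc (Suc i) mod 3)) {Pt i p, Pt i q, Pt j b}"
        using mid_covered_pair[OF that(1,2) ab(3)] j3 by (auto simp: y_def)
      then have "covered M {Pt i p, Pt i q, Pt j b}"
        using i3 by (elim disjE) (simp_all add: M_def covered_Un numeral_2_eq_2)
      then show ?thesis using covs by blast
    qed
    have Hcov: "covered C {Pt i p, Pt i q, Pt j b}" if "p < 12" "q < 12" "(p + 3) mod 12 = q" for p q
    proof -
      \<comment> \<open>Modulo 3, the point completing \<open>p\<close>, \<open>b\<close> to the sum
        \<open>t\<close> agrees with \<open>b\<close> exactly if \<open>p - b\<close> is
        \<open>t\<close>. So the sums starting from 1 and 2 handle two of the values of
        \<open>p - b\<close>, and for the value 0 both points lie in one residue class, where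
        \<open>sixth\<close> applies.\<close>
      have "\<forall>p\<in>set [0..<12]. \<forall>b\<in>set [0..<12]. third 12 1 p b mod 3 = b mod 3 \<or> third 12 2 p b mod 3 = b mod 3 \<or> p mod 3 = b mod 3"
        by code_simp
      then have "third 12 1 p b mod 3 = b mod 3 \<or> third 12 2 p b mod 3 = b mod 3 \<or> p mod 3 = b mod 3"
        using that(1) ab(3) by simp
      moreover have "covered (mids3 t (t + 3) H) {Pt i p, Pt i q, Pt j b}" if t: "third 12 t p b mod 3 = b mod 3" for t
      proof -
        define y where "y = third 12 t p b"
        have "(p + (t + 3)) mod 12 = (p + 3 + t) mod 12" by (simp only: ac_simps)
        also have "\<dots> = (q + t) mod 12" using \<open>(p + 3) mod 12 = q\<close> by (metis mod_add_left_eq)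
        finally have "(p + (t + 3)) mod 12 = (q + t) mod 12" .
        moreover have "(b, y) \<in> H" "(y, b) \<in> H" using ab third_lt[of 12] t by (auto simp: H_def G_def y_def)
        ultimately have "covered (mid 12 H t (t + 3) i (Suc i mod 3) (Suc (Suc i) mod 3)) {Pt i p, Pt i q, Pt j b}"
          using mid_covered_pair[OF \<open>p < 12\<close> \<open>q < 12\<close> ab(3)] j3 by (auto simp: y_def)
        then show ?thesis
          using i3 by (elim disjE) (simp_all add: mids3_def covered_Un numeral_2_eq_2)
      qed
      note inner_blocks = this[of 1] this[of 2]
      moreover have "covered C {Pt i p, Pt i q, Pt j b}" if "p mod 3 = b mod 3"
      proof (rule Xcov)
        fix k l
        have k: "p mod 6 \<in> {..<6}" "p mod 6 < 6" by auto
        have "p mod 6 mod 3 = p mod 3" by (simp add: mod_mod_cancel)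
        then have pb: "p \<in> class3 (p mod 6)" "b \<in> class3 (p mod 6)"
          using \<open>p < 12\<close> ab that by (auto simp: class3_def)
        have "\<forall>p\<in>set [0..<12]. sixth (p mod 6) p = (p + 3) mod 12" by code_simp
        then have "sixth (p mod 6) p = q" using \<open>p < 12\<close> \<open>(p + 3) mod 12 = q\<close> by simp
        then show "covered (X k l) {Pt k p, Pt k q, Pt l b} \<and> covered (X k l) {Pt l p, Pt l q, Pt k b}"
          using cross_covered[where A = class3 and f = sixth, OF k(1) inv[OF k(2)] pb, of k l] by (simp add: X_def covered_Un)
      qed
      ultimately show ?thesis using covs by (elim disjE) simp_all
    qed
    have "\<forall>a\<in>set [0..<12]. \<forall>a'\<in>set [0..<12]. joined 6 {2, 3} a a' \<or> (a + 1) mod 12 = a' \<or> (a' + 1) mod 12 = a \<or>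
        (a + 3) mod 12 = a' \<or> (a' + 3) mod 12 = a"
      unfolding joined_def by code_simp
    then consider "joined 6 J a a'" | "(a + 1) mod 12 = a'" | "(a' + 1) mod 12 = a" | "(a + 3) mod 12 = a'" | "(a' + 3) mod 12 = a"
      using ab unfolding J_def by fastforce
    then show "covered C {Pt i a, Pt i a', Pt j b}"
    proof cases
      case 1
      then show ?thesis
        using factor_cross_covered[OF J, of a a' b] ab by (intro Xcov) (simp add: X_def covered_Un)
    qed (use Mcov[of a a'] Mcov[of a' a] Hcov[of a a'] Hcov[of a' a] ab in \<open>simp_all add: insert_commute\<close>)
  next
    fix a b c :: nat assume abc: "a < 12" "b < 12" "c < 12"
    define r where "r = (a + b + c) mod 12"
    have r: "r < 12" by (simp add: r_def)
    have bc: "(a + b + c) mod 12 = r" "(b + c + a) mod 12 = r" "(c + a + b) mod 12 = r"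
      by (simp_all add: r_def ac_simps)
    have G: "(p, q) \<in> G" if "p < 12" "q < 12" for p q using that by (simp add: G_def)
    have mid3: "covered (mids3 t t' H) {Pt 0 a, Pt 1 b, Pt 2 c}"
      if "r mod 3 \<noteq> 0" and t: "r = t mod 12 \<or> r = t' mod 12" for t t'
    proof -
      have "(a + b + c) mod 3 \<noteq> 0" using that(1) by (simp add: r_def mod_mod_cancel)
      moreover have "(a mod 3 + b mod 3 + c mod 3) mod 3 = (a + b + c) mod 3"
      proof -
        have "(a mod 3 + b mod 3 + c mod 3) mod 3 = ((a mod 3 + b mod 3) mod 3 + c mod 3) mod 3"
          by (rule mod_add_left_eq[symmetric])
        also have "\<dots> = ((a + b) mod 3 + c mod 3) mod 3" by (simp only: mod_add_eq)
        also have "\<dots> = (a + b + c) mod 3" by (rule mod_add_eq)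
        finally show ?thesis .
      qed
      ultimately have "(a mod 3 + b mod 3 + c mod 3) mod 3 \<noteq> 0" by simp
      moreover have res: "x mod 3 = 0 \<or> x mod 3 = 1 \<or> x mod 3 = 2" for x :: nat by presburger
      ultimately have "b mod 3 = c mod 3 \<or> c mod 3 = a mod 3 \<or> a mod 3 = b mod 3"
        using res[of a] res[of b] res[of c] by (elim disjE) simp_all
      then have "(b, c) \<in> H \<or> (c, a) \<in> H \<or> (a, b) \<in> H" using abc by (auto simp: H_def G_def)
      then show ?thesis
      proof (elim disjE)
        assume "(b, c) \<in> H"
        then have "covered (mid 12 H t t' 0 1 2) {Pt 0 a, Pt 1 b, Pt 2 c}"
          using mid_covered_transversal[OF abc] bc(1) t by simp
        then show ?thesis by (simp add: mids3_def covered_Un)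
      next
        assume "(c, a) \<in> H"
        then have "covered (mid 12 H t t' 1 2 0) {Pt 1 b, Pt 2 c, Pt 0 a}"
          using mid_covered_transversal[OF abc(2,3,1)] bc(2) t by simp
        then show ?thesis by (simp add: mids3_def covered_Un insert_commute)
      next
        assume "(a, b) \<in> H"
        then have "covered (mid 12 H t t' 2 0 1) {Pt 2 c, Pt 0 a, Pt 1 b}"
          using mid_covered_transversal[OF abc(3,1,2)] bc(3) t by simp
        then show ?thesis by (simp add: mids3_def covered_Un insert_commute)
      qed
    qed
    have "r = 0 \<or> r = 3 \<or> r = 1 \<or> r = 4 \<or> r = 2 \<or> r = 5 \<or> r = 6 \<or> r = 7 \<or> r = 8 \<or> r = 9 \<or> r = 10 \<or> r = 11"
      using r by presburger
    then consider "r = 0" | "r = 3" | "r = 1 \<or> r = 4" | "r = 2 \<or> r = 5" | "r = 6 \<or> r = 7" | "r = 8 \<or> r = 9" | "r = 10 \<or> r = 11"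
      by blast
    then show "covered C {Pt 0 a, Pt 1 b, Pt 2 c}"
    proof cases
      case 1 then show ?thesis using star_covered_transversal(1)[OF abc, of 0 0 0 1 2] covs bc by simp
    next
      case 2 then show ?thesis using star_covered_transversal(1)[OF abc, of 3 1 0 1 2] covs bc by simp
    next
      case 3 then show ?thesis using mid3[of 1 4] covs by auto
    next
      case 4 then show ?thesis using mid3[of 2 5] covs by auto
    next
      case 5
      then have "covered (mid 12 G 6 7 0 1 2) {Pt 0 a, Pt 1 b, Pt 2 c}"
        using mid_covered_transversal[OF abc G[OF abc(2,3)]] bc by simp
      then show ?thesis using covs by (simp add: M_def covered_Un)
    next
      case 6
      then have "covered (mid 12 G 8 9 1 2 0) {Pt 1 b, Pt 2 c, Pt 0 a}"
        using mid_covered_transversal[OF abc(2,3,1) G[OF abc(3,1)]] bc by simp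
      then show ?thesis using covs by (simp add: M_def covered_Un insert_commute)
    next
      case 7
      then have "covered (mid 12 G 10 11 2 0 1) {Pt 2 c, Pt 0 a, Pt 1 b}"
        using mid_covered_transversal[OF abc(3,1,2) G[OF abc(1,2)]] bc by simp
      then show ?thesis using covs by (simp add: M_def covered_Un insert_commute)
    qed
  next
    have fin: "finite G" "finite H" using GH finite_subset by blast+
    have cG: "card G = 144" by (simp add: G_def card_cartesian_product)
    have "card H \<le> (\<Sum>k<3::nat. 16)"
    proof -
      have "H \<subseteq> (\<Union>k<3. class3 k \<times> class3 k)" by (auto simp: H_def G_def class3_def)
      then have "card H \<le> card (\<Union>k<3. class3 k \<times> class3 k)" using c3 by (intro card_mono) auto
      also have "\<dots> \<le> (\<Sum>k<3. card (class3 k \<times> class3 k))" by (rule card_UN_le) simp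
      also have "\<dots> = (\<Sum>k<3::nat. 16)" by (rule sum.cong) (simp_all add: card_cartesian_product cc)
      finally show ?thesis .
    qed
    then have cH: "card H \<le> 48" by simp
    have U3: "card (P \<union> Q \<union> R) \<le> card P + card Q + card R" for P Q R :: "pt set set"
      by (intro order_trans[OF card_Un_le] add_mono) auto
    have mG: "card (mid 12 G t t' i j k) \<le> 144" and mH: "card (mid 12 H t t' i j k) \<le> 48" for t t' i j k
      using card_mid[OF fin(1), of 12 t t' i j k] card_mid[OF fin(2), of 12 t t' i j k] cG cH by linarith+
    have M: "card M \<le> 432"
      unfolding M_def using U3[of "mid 12 G 6 7 0 1 2" "mid 12 G 8 9 1 2 0" "mid 12 G 10 11 2 0 1"]
        mG[of 6 7 0 1 2] mG[of 8 9 1 2 0] mG[of 10 11 2 0 1] by linarith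
    have m3: "card (mids3 t t' H) \<le> 144" for t t'
      unfolding mids3_def using U3[of "mid 12 H t t' 0 1 2" "mid 12 H t t' 1 2 0" "mid 12 H t t' 2 0 1"]
        mH[of t t' 0 1 2] mH[of t t' 1 2 0] mH[of t t' 2 0 1] by linarith
    have X: "card (X i j) \<le> 276" for i j
    proof -
      have "4 * card (factor_cross 6 J 2 i j) \<le> 1008" using card_factor_cross[OF J, of i j] by (simp add: J_def)
      moreover have "4 * card (cross {..<6} class3 sixth i j) \<le> card {..<6::nat} * (4 * 4)"
        by (rule card_cross) (use inv c3 cc in auto)
      moreover have "card (X i j) \<le> card (factor_cross 6 J 2 i j) + card (cross {..<6} class3 sixth i j)"
        unfolding X_def by (rule card_Un_le)
      ultimately show ?thesis by simp
    qed
    have "card C \<le> card (star 12 0 0 0 1 2) + card (star 12 1 3 0 1 2) + card M + card (mids3 1 4 H) + card (mids3 2 5 H)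
        + card (X 0 1) + card (X 0 2) + card (X 1 2)"
      unfolding C_def by (intro order_trans[OF card_Un_le] add_mono) auto
    then have "card C \<le> 1836"
      using card_star[of 12 0 0 0 1 2] card_star[of 12 1 3 0 1 2] M m3[of 1 4] m3[of 2 5] X[of 0 1] X[of 0 2] X[of 1 2]
      by linarith
    then show "24 * int (card C) \<le> 6 * int 12 * int 12 * (3 * int 2 + 4 * int 12 - 3)" by simp
  qed
  then show ?thesis by blast
qed

text \<open>Doubling and four groups leave the residues 14 and 22 modulo 24. Modulo 72 these are 14
  and 38, obtained from 12u - 10; 22 and 46, obtained from 3u - 2; and 62 and 70, obtained from
  three groups with a stem of 2 and of 4 points.\<close>

theorem hanani:
  assumes "v mod 6 = 2 \<or> v mod 6 = 4"
  shows "sqs_exists v"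
  using assms
proof (induction v rule: less_induct)
  case (less v)
  have small: "sqs_exists 2" "sqs_exists 4"
  proof -
    have "steiner_quadruple_system 2 {0, 1::nat} {}" by (auto simp: steiner_quadruple_system_def)
    then show "sqs_exists 2" by (rule sqs_existsI)
    have "steiner_quadruple_system 4 {..<4::nat} {{..<4}}" by (auto simp: steiner_quadruple_system_def)
    then show "sqs_exists 4" by (rule sqs_existsI)
  qed
  have ih: "sqs_exists u" if "u < v" "u mod 6 = 2 \<or> u mod 6 = 4" for u using less.IH that by blast
  consider "v = 2" | "v = 4" | "v = 14" | u where "v = 2 * u" "u mod 6 = 2 \<or> u mod 6 = 4" "even u" "u > 0"
    | m where "v = 4 * (2 * m) + 2" "(2 * m + 2) mod 6 = 2 \<or> (2 * m + 2) mod 6 = 4" "m > 0"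
    | u where "v = 3 * u - 2" "u mod 6 = 2 \<or> u mod 6 = 4" "u \<ge> 4"
    | n where "v = 3 * (6 * n + 4) + 4" "n > 0"
    | n where "v = 3 * (6 * n + 2) + 2" "n > 0"
    | u where "v = (u - 1) * 12 + 2" "u mod 6 = 2 \<or> u mod 6 = 4" "u \<ge> 4"
  proof -
    note cases = that
    have "\<forall>r\<in>set [0..<72]. r mod 6 = 2 \<or> r mod 6 = 4 \<longrightarrow> r mod 12 = 4 \<or> r mod 12 = 8 \<or> r mod 24 = 2 \<or> r mod 24 = 10 \<or>
        r = 14 \<or> r = 22 \<or> r = 38 \<or> r = 46 \<or> r = 62 \<or> r = 70" by code_simp
    moreover have "v mod 72 \<in> set [0..<72]" "v mod 72 mod 6 = 2 \<or> v mod 72 mod 6 = 4"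
      using less.prems by (simp_all add: mod_mod_cancel)
    ultimately have "v mod 72 mod 12 = 4 \<or> v mod 72 mod 12 = 8 \<or> v mod 72 mod 24 = 2 \<or> v mod 72 mod 24 = 10 \<or>
        v mod 72 = 14 \<or> v mod 72 = 22 \<or> v mod 72 = 38 \<or> v mod 72 = 46 \<or> v mod 72 = 62 \<or> v mod 72 = 70" by blast
    moreover have "v mod 72 mod 12 = v mod 12" "v mod 72 mod 24 = v mod 24" by (simp_all add: mod_mod_cancel)
    ultimately have "v mod 12 = 4 \<or> v mod 12 = 8 \<or> v mod 24 = 2 \<or> v mod 24 = 10 \<or>
        v mod 72 = 14 \<or> v mod 72 = 22 \<or> v mod 72 = 38 \<or> v mod 72 = 46 \<or> v mod 72 = 62 \<or> v mod 72 = 70" by simp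
    then show thesis
    proof (elim disjE)
      assume "v mod 12 = 4"
      then have v: "v = 12 * (v div 12) + 4" by presburger
      have "(6 * (v div 12) + 2) mod 6 = 2" by presburger
      then show thesis using cases(4)[of "6 * (v div 12) + 2"] v by simp
    next
      assume "v mod 12 = 8"
      then have v: "v = 12 * (v div 12) + 8" by presburger
      have "(6 * (v div 12) + 4) mod 6 = 4" by presburger
      then show thesis using cases(4)[of "6 * (v div 12) + 4"] v by simp
    next
      assume "v mod 24 = 2"
      then have v: "v = 24 * (v div 24) + 2" by presburger
      have "(2 * (3 * (v div 24)) + 2) mod 6 = 2" by presburger
      then show thesis using cases(1) cases(5)[of "3 * (v div 24)"] v by (cases "v div 24 = 0") simp_all
    next
      assume "v mod 24 = 10"
      then have v: "v = 24 * (v div 24) + 10" by presburger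
      have "(2 * (3 * (v div 24) + 1) + 2) mod 6 = 4" by presburger
      then show thesis using cases(5)[of "3 * (v div 24) + 1"] v by simp
    next
      assume "v mod 72 = 14"
      then have v: "v = 72 * (v div 72) + 14" by presburger
      have "(6 * (v div 72) + 2) mod 6 = 2" by presburger
      \<comment> \<open>For \<open>v = 14\<close> the smaller order would be 2, which is too small
        for the product, so the explicit system is used.\<close>
      then show thesis using cases(3) cases(9)[of "6 * (v div 72) + 2"] v by (cases "v div 72 = 0") simp_all
    next
      assume "v mod 72 = 22"
      then have v: "v = 72 * (v div 72) + 22" by presburger
      have "(24 * (v div 72) + 8) mod 6 = 2" by presburger
      then show thesis using cases(6)[of "24 * (v div 72) + 8"] v by simp
    next
      assume "v mod 72 = 38"
      then have v: "v = 72 * (v div 72) + 38" by presburger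
      have "(6 * (v div 72) + 4) mod 6 = 4" by presburger
      then show thesis using cases(9)[of "6 * (v div 72) + 4"] v by simp
    next
      assume "v mod 72 = 46"
      then have v: "v = 72 * (v div 72) + 46" by presburger
      have "(24 * (v div 72) + 16) mod 6 = 4" by presburger
      then show thesis using cases(6)[of "24 * (v div 72) + 16"] v by simp
    next
      assume "v mod 72 = 62"
      then have v: "v = 72 * (v div 72) + 62" by presburger
      show thesis using cases(8)[of "4 * (v div 72) + 3"] v by simp
    next
      assume "v mod 72 = 70"
      then have v: "v = 72 * (v div 72) + 70" by presburger
      show thesis using cases(7)[of "4 * (v div 72) + 3"] v by simp
    qed
  qed
  then show ?case
  proof cases
    case (4 u)
    then show ?thesis using sqs_double[of u] ih[of u] 4 by simp
  next
    case (5 m)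
    then have "sqs_exists (2 * m + 2)" by (intro ih) auto
    then show ?thesis using candelabra_quadruple[OF 5(3)] candelabra_fill[of 4 "2 * m" 2] 5(1) by auto
  next
    case (6 u)
    then have "sqs_exists u" by (intro ih) auto
    then obtain C where C: "candelabra (u - 1) 3 1 C"
      using candelabra_three_base candelabra_product 6(3) by blast
    then have "sqs_exists ((u - 1) * 3 + 1)" using candelabra_fill[OF C] small 6(3) by simp
    moreover have "(u - 1) * 3 + 1 = v" using 6 by simp
    ultimately show ?thesis by simp
  next
    case (7 n)
    have "sqs_exists (6 * n + 4 + 4)"
    proof (rule ih)
      have "6 * n + 4 + 4 = 2 + 6 * (n + 1)" by simp
      then show "(6 * n + 4 + 4) mod 6 = 2 \<or> (6 * n + 4 + 4) mod 6 = 4" by presburger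
    qed (use 7 in simp)
    moreover obtain C where C: "candelabra 3 (6 * n + 4) 4 C" using candelabra_triple[of "6 * n + 4" n 4] by auto
    ultimately show ?thesis using candelabra_fill[OF C] 7(1) by simp
  next
    case (8 n)
    have "sqs_exists (6 * n + 2 + 2)"
    proof (rule ih)
      show "(6 * n + 2 + 2) mod 6 = 2 \<or> (6 * n + 2 + 2) mod 6 = 4" by presburger
    qed (use 8 in simp)
    moreover obtain C where C: "candelabra 3 (6 * n + 2) 2 C" using candelabra_triple[of "6 * n + 2" n 2] by auto
    ultimately show ?thesis using candelabra_fill[OF C] 8(1) by simp
  next
    case (9 u)
    then have "sqs_exists u" by (intro ih) auto
    then obtain C where "candelabra (u - 1) 12 2 C"
      using candelabra_twelve candelabra_product 9(3) by blast
    then show ?thesis using candelabra_fill[of "u - 1" 12 2 C] sqs_exists_14 9 by simp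
  qed (use small sqs_exists_14 in auto)
qed

section \<open>Euler circuits and Hall's theorem\<close>

text \<open>An entry consists of an edge and the vertex that it leads to. Edges are named because
  different blocks may have the same pair of ends.\<close>

fun walk :: "('b \<Rightarrow> 'a set) \<Rightarrow> 'a \<Rightarrow> ('b \<times> 'a) list \<Rightarrow> 'a \<Rightarrow> bool" where
  "walk e x [] y \<longleftrightarrow> x = y"
| "walk e x ((b, t) # ts) y \<longleftrightarrow> e b = {x, t} \<and> x \<noteq> t \<and> walk e t ts y"

lemma walk_append: "walk e x (ts @ us) y \<longleftrightarrow> (\<exists>z. walk e x ts z \<and> walk e z us y)"
  by (induction ts arbitrary: x) auto

lemma walk_parity:
  assumes "walk e x ts y" "distinct (map fst ts)"
  shows "even (card {b \<in> fst ` set ts. u \<in> e b}) \<longleftrightarrow> (u = x \<longleftrightarrow> u = y)"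
  using assms
proof (induction ts arbitrary: x)
  case Nil
  then show ?case by auto
next
  case (Cons p ts)
  obtain b t where p: "p = (b, t)" by (cases p)
  have e: "e b = {x, t}" "x \<noteq> t" "walk e t ts y" and b: "b \<notin> fst ` set ts" and d: "distinct (map fst ts)"
    using Cons.prems p by auto
  define S where "S = {c \<in> fst ` set ts. u \<in> e c}"
  have S: "finite S" "b \<notin> S" "even (card S) \<longleftrightarrow> (u = t \<longleftrightarrow> u = y)"
    using b Cons.IH[OF e(3) d] by (auto simp: S_def)
  have "{c \<in> fst ` set (p # ts). u \<in> e c} = (if u \<in> e b then insert b S else S)"
    using p by (auto simp: S_def)
  then show ?case using S e by (cases "u \<in> e b") auto
qed

lemma walk_rotate:
  assumes w: "walk e x ts x" and b: "b \<in> fst ` set ts" and u: "u \<in> e b"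
  obtains us where "walk e u us u" "fst ` set us = fst ` set ts" "length us = length ts"
    "distinct (map fst us) \<longleftrightarrow> distinct (map fst ts)"
proof -
  obtain t where "(b, t) \<in> set ts" using b by auto
  then obtain vs ws where ts: "ts = vs @ (b, t) # ws" by (meson split_list)
  obtain z where z: "walk e x vs z" "e b = {z, t}" "z \<noteq> t" "walk e t ws x"
    using w by (auto simp: ts walk_append)
  from u z(2) consider "u = z" | "u = t" by auto
  then show thesis
  proof cases
    case 1
    have "walk e u ((b, t) # ws @ vs) u" using 1 z by (auto simp: walk_append)
    then show thesis by (rule that) (auto simp: ts)
  next
    case 2
    have "walk e u (ws @ vs @ [(b, t)]) u" using 2 z by (auto simp: walk_append)
    then show thesis by (rule that) (auto simp: ts)
  qed
qed

text \<open>A longest trail is closed, by parity of the degree at its last vertex, and contains all edges, as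
  otherwise it could be rotated and then prolonged.\<close>

lemma euler_circuit:
  fixes B :: "'b set" and e :: "'b \<Rightarrow> 'a set"
  assumes fin: "finite B" and ne: "B \<noteq> {}" and two: "\<And>b. b \<in> B \<Longrightarrow> card (e b) = 2"
    and even: "\<And>x. even (card {b \<in> B. x \<in> e b})"
    and conn: "\<And>S. S \<subset> B \<Longrightarrow> S \<noteq> {} \<Longrightarrow> \<exists>b\<in>S. \<exists>c\<in>B - S. e b \<inter> e c \<noteq> {}"
  obtains x ts where "walk e x ts x" "distinct (map fst ts)" "fst ` set ts = B"
proof -
  define trail where "trail ts \<longleftrightarrow> (\<exists>x y. walk e x ts y) \<and> distinct (map fst ts) \<and> fst ` set ts \<subseteq> B" for ts :: "('b \<times> 'a) list"
  have edge: "\<exists>t. e b = {x, t} \<and> x \<noteq> t" if "b \<in> B" "x \<in> e b" for b x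
    using two[OF that(1)] that(2) by (auto simp: card_2_iff)
  have bound: "length ts \<le> card B" if "trail ts" for ts
  proof -
    have "length ts = card (set (map fst ts))" using that distinct_card[of "map fst ts"] by (simp add: trail_def)
    also have "\<dots> \<le> card B" using that fin by (intro card_mono) (auto simp: trail_def)
    finally show ?thesis .
  qed
  have "trail []" by (auto simp: trail_def)
  then obtain ts where ts: "trail ts" and maxi: "\<And>us. trail us \<Longrightarrow> length us \<le> length ts"
    using ex_has_greatest_nat[of trail "[]" length "card B + 1"] bound by (metis less_Suc_eq_le Suc_eq_plus1)
  obtain x y where w: "walk e x ts y" using ts by (auto simp: trail_def)
  have d: "distinct (map fst ts)" and sub: "fst ` set ts \<subseteq> B" using ts by (auto simp: trail_def)
  have no_ext: False if "walk e u us z" "length us = length ts" "distinct (map fst us)" "fst ` set us = fst ` set ts"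
    and c: "c \<in> B" "c \<notin> fst ` set ts" "z \<in> e c" for u us z c
  proof -
    obtain t where "e c = {z, t}" "z \<noteq> t" using edge c by blast
    then have "walk e u (us @ [(c, t)]) t" using that(1) by (auto simp: walk_append)
    moreover have "distinct (map fst (us @ [(c, t)]))" "fst ` set (us @ [(c, t)]) \<subseteq> B"
      using that sub by auto
    ultimately have "trail (us @ [(c, t)])" unfolding trail_def by blast
    then show False using maxi that(2) by fastforce
  qed
  have closed: "x = y"
  proof (rule ccontr)
    assume "x \<noteq> y"
    then have odd: "odd (card {b \<in> fst ` set ts. y \<in> e b})" using walk_parity[OF w d, of y] by simp
    have "{b \<in> fst ` set ts. y \<in> e b} \<subseteq> {b \<in> B. y \<in> e b}" using sub by auto
    moreover have "{b \<in> fst ` set ts. y \<in> e b} \<noteq> {b \<in> B. y \<in> e b}" using odd even[of y] by metis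
    ultimately obtain c where "c \<in> B" "y \<in> e c" "c \<notin> fst ` set ts" by blast
    then show False using no_ext[OF w refl d refl] by blast
  qed
  have "fst ` set ts = B"
  proof (rule ccontr)
    assume neq: "fst ` set ts \<noteq> B"
    show False
    proof (cases "ts = []")
      case True
      obtain c where c: "c \<in> B" using ne by blast
      then obtain z where "z \<in> e c" using two[OF c] by (metis card.empty equals0I zero_neq_numeral)
      then show False using no_ext[of z ts z c] c True by simp
    next
      case False
      then have "fst ` set ts \<subset> B" "fst ` set ts \<noteq> {}" using neq sub by auto
      then obtain b c where bc: "b \<in> fst ` set ts" "c \<in> B - fst ` set ts" and "e b \<inter> e c \<noteq> {}"
        by (meson conn)
      then obtain u where u: "u \<in> e b" "u \<in> e c" by blast
      obtain us where "walk e u us u" "fst ` set us = fst ` set ts" "length us = length ts"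
        "distinct (map fst us) \<longleftrightarrow> distinct (map fst ts)"
        using walk_rotate[OF w[folded closed] bc(1) u(1)] .
      then show False using no_ext[of u us u c] bc u d by simp
    qed
  qed
  then show thesis using that w d closed by blast
qed

section \<open>From Euler circuits to 1-ocycles\<close>

lemma walk_nth:
  assumes "walk e x ts y" "i < length ts"
  shows "e (fst (ts ! i)) = {if i = 0 then x else snd (ts ! (i - 1)), snd (ts ! i)} \<and>
    (if i = 0 then x else snd (ts ! (i - 1))) \<noteq> snd (ts ! i)"
  using assms
proof (induction ts arbitrary: x i)
  case (Cons p ts)
  obtain b t where p: "p = (b, t)" by (cases p)
  have w: "e b = {x, t}" "x \<noteq> t" "walk e t ts y" using Cons.prems p by auto
  show ?case
  proof (cases i)
    case 0
    then show ?thesis using w p by simp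
  next
    case (Suc j)
    then have "j < length ts" using Cons.prems by simp
    from Cons.IH[OF w(3) this] show ?thesis using Suc p by (cases j) auto
  qed
qed simp

lemma walk_last: "walk e x ts y \<Longrightarrow> ts \<noteq> [] \<Longrightarrow> y = snd (last ts)"
proof (induction ts arbitrary: x)
  case (Cons p ts)
  then show ?case by (cases p; cases ts) auto
qed simp

lemma ex_block_string:
  assumes "card b = 4" "s \<in> b" "t \<in> b" "s \<noteq> t"
  shows "\<exists>w. string_of_block b w \<and> hd w = s \<and> last w = t"
proof -
  have "finite b" using assms(1) by (metis card.infinite zero_neq_numeral)
  then have "card (b - {s, t}) = 2" using assms by (simp add: card_Diff_subset)
  then obtain c d where "b - {s, t} = {c, d}" "c \<noteq> d" by (auto simp: card_2_iff)
  then have "b = {s, c, d, t}" "c \<noteq> s" "c \<noteq> t" "d \<noteq> s" "d \<noteq> t" using assms by auto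
  then have "string_of_block b [s, c, d, t]" using assms \<open>c \<noteq> d\<close> by (auto simp: string_of_block_def)
  then show ?thesis by force
qed

text \<open>The vertices before and after an edge of the circuit become the first and last letters
  of the string of that block; the two inner letters are arbitrary. \<open>st i\<close> is the
  vertex from which edge \<open>i\<close> departs, and closedness of the circuit settles the
  wrap-around.\<close>

lemma admits_one_ocycle_if_even_connected:
  assumes fin: "finite B" and ne: "B \<noteq> {}" and four: "\<And>b. b \<in> B \<Longrightarrow> card b = 4"
    and e: "\<And>b. b \<in> B \<Longrightarrow> e b \<subseteq> b \<and> card (e b) = 2"
    and even: "\<And>x. even (card {b \<in> B. x \<in> e b})"
    and conn: "\<And>S. S \<subset> B \<Longrightarrow> S \<noteq> {} \<Longrightarrow> \<exists>b\<in>S. \<exists>c\<in>B - S. e b \<inter> e c \<noteq> {}"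
  shows "admits_one_ocycle B"
proof -
  have "card (e b) = 2" if "b \<in> B" for b using e[OF that] by simp
  from euler_circuit[OF fin ne this even conn]
  obtain x ts where w: "walk e x ts x" and d: "distinct (map fst ts)" and B: "fst ` set ts = B" by metis
  define st where "st i = (if i = 0 then x else snd (ts ! (i - 1)))" for i
  define n where "n = length ts"
  have "\<exists>s. string_of_block (fst (ts ! i)) s \<and> hd s = st i \<and> last s = snd (ts ! i)" if "i < n" for i
  proof -
    have b: "fst (ts ! i) \<in> B" using B that by (auto simp: n_def)
    have "e (fst (ts ! i)) = {st i, snd (ts ! i)}" "st i \<noteq> snd (ts ! i)"
      using walk_nth[OF w, of i] that by (auto simp: st_def n_def)
    then show ?thesis using ex_block_string[OF four[OF b], of "st i" "snd (ts ! i)"] e[OF b] by auto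
  qed
  then obtain s where s: "\<And>i. i < n \<Longrightarrow> string_of_block (fst (ts ! i)) (s i) \<and> hd (s i) = st i \<and> last (s i) = snd (ts ! i)"
    by metis
  have n: "ts \<noteq> []" "n > 0" using B ne by (auto simp: n_def)
  have next_start: "snd (ts ! i) = st (Suc i mod n)" if "i < n" for i
  proof (cases "Suc i = n")
    case True
    then have "snd (ts ! i) = snd (last ts)" using n by (simp add: last_conv_nth n_def[symmetric] flip: True)
    then show ?thesis using walk_last[OF w n(1)] True by (simp add: st_def)
  next
    case False
    then show ?thesis using that by (simp add: st_def)
  qed
  have "one_ocycle B (map fst ts) (map s [0..<n])"
    unfolding one_ocycle_def
    using n d B s next_start by (auto simp: n_def[symmetric])
  then show ?thesis unfolding admits_one_ocycle_def by blast
qed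

section \<open>Hall's marriage theorem\<close>

lemma hall_marriage:
  assumes "finite A" "\<And>a. a \<in> A \<Longrightarrow> finite (N a)" "\<And>J. J \<subseteq> A \<Longrightarrow> card J \<le> card (\<Union>(N ` J))"
  shows "\<exists>f. inj_on f A \<and> (\<forall>a\<in>A. f a \<in> N a)"
  using assms
proof (induction "card A" arbitrary: A N rule: less_induct)
  case less
  note fin = less.prems(1) and finN = less.prems(2) and hall = less.prems(3)
  have finU: "finite (\<Union>(N ` J))" if "J \<subseteq> A" for J
    using that fin finN finite_subset by blast
  show ?case
  proof (cases "A = {}")
    case False
    then obtain a where a: "a \<in> A" by blast
    \<comment> \<open>If some proper nonempty \<open>J\<close> has just as many neighbours as
      elements, it is matched by itself. Outside the neighbours of \<open>J\<close> the condition
      survives for the rest, as is seen by applying it to \<open>K \<union> J\<close>.\<close>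
    show ?thesis
    proof (cases "\<exists>J. J \<subset> A \<and> J \<noteq> {} \<and> card J = card (\<Union>(N ` J))")
      case True
      then obtain J where J: "J \<subset> A" "J \<noteq> {}" "card J = card (\<Union>(N ` J))" by blast
      have JA: "J \<subseteq> A" and finJ: "finite J" using J fin finite_subset by auto
      have "\<exists>f. inj_on f J \<and> (\<forall>a\<in>J. f a \<in> N a)"
      proof (rule less.hyps)
        show "card J < card A" using fin J(1) by (rule psubset_card_mono)
      qed (use finJ finN hall JA in auto)
      then obtain f where f: "inj_on f J" "\<And>a. a \<in> J \<Longrightarrow> f a \<in> N a" by blast
      define M where "M b = N b - \<Union>(N ` J)" for b
      have "\<exists>g. inj_on g (A - J) \<and> (\<forall>a\<in>A - J. g a \<in> M a)"
      proof (rule less.hyps)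
        show "card (A - J) < card A" using J fin by (intro psubset_card_mono) auto
        show "card K \<le> card (\<Union>(M ` K))" if K: "K \<subseteq> A - J" for K
        proof -
          have finK: "finite K" using K fin finite_subset by blast
          have "card K + card J = card (K \<union> J)" using K finK finJ by (subst card_Un_disjoint) auto
          also have "\<dots> \<le> card (\<Union>(N ` (K \<union> J)))" using K JA by (intro hall) auto
          also have "\<Union>(N ` (K \<union> J)) = \<Union>(M ` K) \<union> \<Union>(N ` J)" by (auto simp: M_def)
          also have "card (\<Union>(M ` K) \<union> \<Union>(N ` J)) \<le> card (\<Union>(M ` K)) + card (\<Union>(N ` J))" by (rule card_Un_le)
          finally show ?thesis using J(3) by simp
        qed
      qed (use fin finN in \<open>auto simp: M_def\<close>)
      then obtain g where g: "inj_on g (A - J)" "\<And>a. a \<in> A - J \<Longrightarrow> g a \<in> M a" by blast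
      define h where "h b = (if b \<in> J then f b else g b)" for b
      have "inj_on h (J \<union> (A - J))"
      proof (subst inj_on_Un, intro conjI)
        show "inj_on h J" using f(1) by (rule inj_on_cong[THEN iffD1, rotated]) (simp add: h_def)
        show "inj_on h (A - J)" using g(1) by (rule inj_on_cong[THEN iffD1, rotated]) (simp add: h_def)
        show "h ` (J - (A - J)) \<inter> h ` (A - J - J) = {}" using f(2) g(2) by (fastforce simp: h_def M_def)
      qed
      moreover have "J \<union> (A - J) = A" using JA by auto
      ultimately show ?thesis using f g by (intro exI[of _ h]) (auto simp: h_def M_def)
    next
      case no_tight: False
      \<comment> \<open>Otherwise all proper nonempty subsets have a neighbour to spare, so
        \<open>a\<close> may take any neighbour \<open>y\<close>, and removing \<open>y\<close>
        preserves the condition.\<close>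
      have "card {a} \<le> card (\<Union>(N ` {a}))" using a by (intro hall) auto
      then obtain y where y: "y \<in> N a" by fastforce
      define M where "M b = N b - {y}" for b
      have "\<exists>g. inj_on g (A - {a}) \<and> (\<forall>b\<in>A - {a}. g b \<in> M b)"
      proof (rule less.hyps)
        show "card (A - {a}) < card A" using a fin by (intro psubset_card_mono) auto
        show "card K \<le> card (\<Union>(M ` K))" if K: "K \<subseteq> A - {a}" for K
        proof (cases "K = {}")
          case False
          have "K \<subset> A" using K a by auto
          then have "card K < card (\<Union>(N ` K))" using no_tight False hall[of K] by (metis le_neq_implies_less psubset_imp_subset)
          moreover have "\<Union>(N ` K) \<subseteq> insert y (\<Union>(M ` K))" by (auto simp: M_def)
          moreover have finM: "finite (\<Union>(M ` K))"
            using finU[OF psubset_imp_subset[OF \<open>K \<subset> A\<close>]] by (rule finite_subset[rotated]) (auto simp: M_def)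
          ultimately have "card K < card (insert y (\<Union>(M ` K)))"
            by (meson card_mono finite_insert less_le_trans)
          then show ?thesis using finM by (simp add: card_insert_if split: if_splits)
        qed simp
      qed (use fin finN in \<open>auto simp: M_def\<close>)
      then obtain g where g: "inj_on g (A - {a})" "\<And>b. b \<in> A - {a} \<Longrightarrow> g b \<in> M b" by blast
      have "inj_on (g(a := y)) A"
        using g by (auto simp: inj_on_def M_def)
      moreover have "\<forall>b\<in>A. (g(a := y)) b \<in> N b" using g y by (auto simp: M_def)
      ultimately show ?thesis by blast
    qed
  qed auto
qed

section \<open>One-overlap cycles\<close>

definition valid_choice :: "'a set set \<Rightarrow> ('a set \<Rightarrow> 'a set) \<Rightarrow> bool" where
  "valid_choice \<B> e \<longleftrightarrow> (\<forall>b\<in>\<B>. e b \<subseteq> b \<and> card (e b) = 2)"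

definition deg :: "'a set set \<Rightarrow> ('a set \<Rightarrow> 'a set) \<Rightarrow> 'a \<Rightarrow> nat" where
  "deg \<B> e u = card {b \<in> \<B>. u \<in> e b}"

lemma deg_fun_upd:
  assumes "finite \<B>" "b \<in> \<B>"
  shows "even (deg \<B> (e(b := d)) u) \<longleftrightarrow> (even (deg \<B> e u) \<longleftrightarrow> (u \<in> d \<longleftrightarrow> u \<in> e b))"
proof -
  define S where "S = {c \<in> \<B> - {b}. u \<in> e c}"
  have S: "finite S" "b \<notin> S" using assms by (auto simp: S_def)
  have "{c \<in> \<B>. u \<in> e c} = (if u \<in> e b then insert b S else S)"
    "{c \<in> \<B>. u \<in> (e(b := d)) c} = (if u \<in> d then insert b S else S)"
    using assms by (auto simp: S_def)
  then show ?thesis using S unfolding deg_def by auto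
qed

text \<open>If the chosen pair of a block separates two of its points, exchanging them in the pair
  changes the degree parities of these two points and of no others.\<close>

lemma toggle:
  assumes fin: "finite \<B>" and v: "valid_choice \<B> e" and b: "b \<in> \<B>" "x \<in> b" "z \<in> b" and ne: "x \<in> e b \<longleftrightarrow> z \<notin> e b"
  obtains d where "valid_choice \<B> (e(b := d))"
    "\<And>u. even (deg \<B> (e(b := d)) u) \<longleftrightarrow> (even (deg \<B> e u) \<longleftrightarrow> u \<notin> {x, z})"
proof -
  have e: "e b \<subseteq> b" "card (e b) = 2" "finite (e b)"
    using v b by (auto simp: valid_choice_def intro: card_ge_0_finite)
  define d where "d = (if x \<in> e b then insert z (e b - {x}) else insert x (e b - {z}))"
  have d: "d \<subseteq> b" "card d = 2" "\<And>u. (u \<in> d \<longleftrightarrow> u \<in> e b) \<longleftrightarrow> u \<notin> {x, z}"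
    using e ne b by (auto simp: d_def card_insert_if)
  have "valid_choice \<B> (e(b := d))" using v d by (simp add: valid_choice_def)
  moreover have "even (deg \<B> (e(b := d)) u) \<longleftrightarrow> (even (deg \<B> e u) \<longleftrightarrow> u \<notin> {x, z})" for u
    unfolding deg_fun_upd[OF fin b(1)] d(3) ..
  ultimately show thesis by (rule that)
qed

text \<open>The only block through \<open>x\<close>, \<open>y\<close> that must not be touched is
  the one containing \<open>p\<close>. Another block through \<open>x\<close>, \<open>y\<close>
  either separates them, or it separates \<open>y\<close> from a third point \<open>z\<close>; in
  the latter case a detour over \<open>z\<close> works, provided that \<open>z\<close> is separated
  from \<open>x\<close> in a further block that avoids \<open>p\<close>.\<close>

lemma toggle_pair:
  assumes sqs: "steiner_quadruple_system v X \<B>" and v8: "v \<ge> 8" and val: "valid_choice \<B> e"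
    and pxy: "p \<in> X" "x \<in> X" "y \<in> X" "p \<noteq> x" "p \<noteq> y" "x \<noteq> y"
  obtains e' where "valid_choice \<B> e'" "\<And>b. p \<in> b \<Longrightarrow> e' b = e b"
    "\<And>u. even (deg \<B> e' u) \<longleftrightarrow> (even (deg \<B> e u) \<longleftrightarrow> u \<notin> {x, y})"
proof -
  have fin: "finite \<B>" by (rule finite_blocks[OF sqs])
  have X: "finite X" "card X = v" and blk: "\<And>b. b \<in> \<B> \<Longrightarrow> b \<subseteq> X" "\<And>b. b \<in> \<B> \<Longrightarrow> card b = 4"
    using sqs by (auto simp: steiner_quadruple_system_def)
  have fb: "finite b" if "b \<in> \<B>" for b using blk(1)[OF that] X(1) finite_subset by blast
  have e: "e b \<subseteq> b" "card (e b) = 2" if "b \<in> \<B>" for b using val that by (auto simp: valid_choice_def)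
  obtain b0 where b0: "b0 \<in> \<B>" "p \<in> b0" "x \<in> b0" "y \<in> b0" using sqs_blockE[OF sqs pxy] by metis
  have "card (b0 - {p, x, y}) = 1" using blk(2)[OF b0(1)] fb[OF b0(1)] b0 pxy by (simp add: card_Diff_subset)
  then obtain q where "b0 - {p, x, y} = {q}" by (rule card_1_singletonE)
  then have q: "q \<in> b0" "q \<noteq> p" "q \<noteq> x" "q \<noteq> y" "b0 = {p, x, y, q}" using b0 by auto
  \<comment> \<open>A point outside \<open>b0\<close> yields a block \<open>b1\<close> that meets
    \<open>b0\<close> in \<open>x\<close> and \<open>q\<close> only, so that \<open>b1\<close>
    avoids both \<open>p\<close> and \<open>y\<close>.\<close>
  have "\<not> X \<subseteq> b0"
  proof
    assume "X \<subseteq> b0"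
    then have "card X \<le> card b0" using fb b0 by (intro card_mono) auto
    then show False using X(2) v8 blk(2)[OF b0(1)] by simp
  qed
  then obtain u where u: "u \<in> X" "u \<notin> b0" by blast
  have "q \<in> X" using q blk b0 by blast
  moreover have "u \<noteq> x" "u \<noteq> q" using u b0 q by auto
  ultimately obtain b1 where b1: "b1 \<in> \<B>" "x \<in> b1" "q \<in> b1" "u \<in> b1"
    using sqs_blockE[OF sqs pxy(2), of q u] u q by metis
  have "b1 \<noteq> b0" using b1 u by auto
  have y1: "y \<notin> b1"
  proof
    assume "y \<in> b1"
    then have "b1 = b0" using sqs_block_unique[OF sqs, of x y q b1 b0] b1 b0 q pxy by auto
    then show False using \<open>b1 \<noteq> b0\<close> by simp
  qed
  have p1: "p \<notin> b1"
  proof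
    assume "p \<in> b1"
    then have "b1 = b0" using sqs_block_unique[OF sqs, of x p q b1 b0] b1 b0 q pxy by auto
    then show False using \<open>b1 \<noteq> b0\<close> by simp
  qed
  define S where "S = {z \<in> b1. x \<in> e b1 \<longleftrightarrow> z \<notin> e b1}"
  have "card S = 2"
  proof (cases "x \<in> e b1")
    case True
    then have "S = b1 - e b1" by (auto simp: S_def)
    then show ?thesis using e[OF b1(1)] fb[OF b1(1)] blk(2)[OF b1(1)] by (simp add: card_Diff_subset finite_subset)
  next
    case False
    then have "S = e b1" using e[OF b1(1)] by (auto simp: S_def)
    then show ?thesis using e[OF b1(1)] by simp
  qed
  \<comment> \<open>The pair of \<open>b1\<close> separates \<open>x\<close> from exactly two
    points, so one of them is not \<open>q\<close>. This matters because the block through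
    \<open>x\<close>, \<open>y\<close>, \<open>q\<close> is \<open>b0\<close> and contains
    \<open>p\<close>.\<close>
  then have "\<not> S \<subseteq> {q}" using card_mono[of "{q}" S] by auto
  then obtain z where "z \<in> S" "z \<noteq> q" by blast
  then have z: "z \<in> b1" "x \<in> e b1 \<longleftrightarrow> z \<notin> e b1" "z \<noteq> q" "z \<noteq> x" by (auto simp: S_def)
  have z0: "z \<notin> b0" using z q y1 p1 by auto
  have zX: "z \<in> X" "z \<noteq> y" using z blk b1 z0 b0 by auto
  obtain b2 where b2: "b2 \<in> \<B>" "x \<in> b2" "y \<in> b2" "z \<in> b2"
    using sqs_blockE[OF sqs pxy(2,3) zX(1)] pxy(6) z(4) zX(2) by metis
  have p2: "p \<notin> b2"
  proof
    assume "p \<in> b2"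
    then have "b2 = b0" using sqs_block_unique[OF sqs, of x y p b2 b0] b2 b0 pxy by auto
    then show False using b2 z0 by simp
  qed
  have b12: "b2 \<noteq> b1" using b2 y1 by auto
  show thesis
  proof (cases "x \<in> e b2 \<longleftrightarrow> y \<notin> e b2")
    case True
    obtain d where "valid_choice \<B> (e(b2 := d))"
      "\<And>u. even (deg \<B> (e(b2 := d)) u) \<longleftrightarrow> (even (deg \<B> e u) \<longleftrightarrow> u \<notin> {x, y})"
      using toggle[OF fin val b2(1,2,3) True] by metis
    moreover have "(e(b2 := d)) b = e b" if "p \<in> b" for b using that p2 by auto
    ultimately show thesis using that by metis
  next
    case same: False
    obtain d1 where d1: "valid_choice \<B> (e(b1 := d1))"
      "\<And>u. even (deg \<B> (e(b1 := d1)) u) \<longleftrightarrow> (even (deg \<B> e u) \<longleftrightarrow> u \<notin> {x, z})"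
      using toggle[OF fin val b1(1,2) z(1,2)] by metis
    \<comment> \<open>If the pair of \<open>b2\<close> contains both or neither of \<open>x\<close>,
      \<open>y\<close>, then it is \<open>{x, y}\<close> or the complement, and either way it
      separates \<open>z\<close> from \<open>y\<close>.\<close>
    have "z \<in> e b2 \<longleftrightarrow> y \<notin> e b2"
    proof (cases "y \<in> e b2")
      case True
      then have "{x, y} \<subseteq> e b2" using same by auto
      moreover have "finite (e b2)" using e[OF b2(1)] by (auto intro: card_ge_0_finite)
      ultimately have "{x, y} = e b2" using e(2)[OF b2(1)] pxy(6) by (intro card_subset_eq) auto
      then have "z \<notin> e b2" using z zX by auto
      then show ?thesis using True by simp
    next
      case False
      then have "e b2 \<subseteq> b2 - {x, y}" using same e[OF b2(1)] by auto
      moreover have "card (b2 - {x, y}) = 2" "finite (b2 - {x, y})"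
        using blk(2)[OF b2(1)] fb[OF b2(1)] b2 pxy by (simp_all add: card_Diff_subset)
      ultimately have "e b2 = b2 - {x, y}" using e(2)[OF b2(1)] by (intro card_subset_eq) auto
      then show ?thesis using False b2 z zX by auto
    qed
    then have sep: "z \<in> (e(b1 := d1)) b2 \<longleftrightarrow> y \<notin> (e(b1 := d1)) b2" using b12 by simp
    obtain d2 where d2: "valid_choice \<B> (e(b1 := d1, b2 := d2))"
      "\<And>u. even (deg \<B> (e(b1 := d1, b2 := d2)) u) \<longleftrightarrow> (even (deg \<B> (e(b1 := d1)) u) \<longleftrightarrow> u \<notin> {z, y})"
      using toggle[OF fin d1(1) b2(1,4,3) sep] by metis
    have "even (deg \<B> (e(b1 := d1, b2 := d2)) u) \<longleftrightarrow> (even (deg \<B> e u) \<longleftrightarrow> u \<notin> {x, y})" for u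
      unfolding d2(2) d1(2) using z zX pxy by auto
    moreover have "(e(b1 := d1, b2 := d2)) b = e b" if "p \<in> b" for b using that p1 p2 by auto
    ultimately show thesis using that d2(1) by metis
  qed
qed

text \<open>Each point lies with \<open>p\<close> in \<open>(v - 2) / 2\<close> blocks, which is at
  least three as \<open>v\<close> is at least 8, whereas a block through \<open>p\<close> has only
  three other points. Double counting of incidences gives Hall's condition.\<close>

lemma ex_representatives:
  assumes sqs: "steiner_quadruple_system v X \<B>" and v8: "v \<ge> 8" and p: "p \<in> X"
  obtains f where "inj_on f (X - {p})" "\<And>a. a \<in> X - {p} \<Longrightarrow> f a \<in> \<B> \<and> p \<in> f a \<and> a \<in> f a"
proof -
  have fin: "finite \<B>" by (rule finite_blocks[OF sqs])
  have X: "finite X" and blk: "\<And>b. b \<in> \<B> \<Longrightarrow> b \<subseteq> X" "\<And>b. b \<in> \<B> \<Longrightarrow> card b = 4"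
    using sqs by (auto simp: steiner_quadruple_system_def)
  define N where "N a = {b \<in> \<B>. p \<in> b \<and> a \<in> b}" for a
  have "\<exists>f. inj_on f (X - {p}) \<and> (\<forall>a\<in>X - {p}. f a \<in> N a)"
  proof (rule hall_marriage)
    show "finite (X - {p})" using X by simp
    show "finite (N a)" for a using fin by (simp add: N_def)
    show "card J \<le> card (\<Union>(N ` J))" if J: "J \<subseteq> X - {p}" for J
    proof -
      define U where "U = \<Union>(N ` J)"
      have finJ: "finite J" using J X finite_subset by blast
      have UB: "U \<subseteq> \<B>" "\<And>b. b \<in> U \<Longrightarrow> p \<in> b" by (auto simp: U_def N_def)
      have finU: "finite U" using UB fin finite_subset by blast
      have lower: "3 \<le> card {b \<in> U. a \<in> b}" if "a \<in> J" for a
      proof -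
        have "2 * card (N a) = v - 2"
          unfolding N_def using that J by (intro card_blocks_pair[OF sqs p]) auto
        moreover have "N a \<subseteq> {b \<in> U. a \<in> b}" using that by (auto simp: U_def N_def)
        then have "card (N a) \<le> card {b \<in> U. a \<in> b}" using finU by (intro card_mono) auto
        ultimately show ?thesis using v8 by linarith
      qed
      have upper: "card {a \<in> J. a \<in> b} \<le> 3" if "b \<in> U" for b
      proof -
        have "b \<in> \<B>" "p \<in> b" using that UB by auto
        moreover have "finite b" using blk(1)[OF \<open>b \<in> \<B>\<close>] X finite_subset by blast
        ultimately have "card (b - {p}) = 3" using blk(2) by simp
        moreover have "card {a \<in> J. a \<in> b} \<le> card (b - {p})" using J \<open>finite b\<close> by (intro card_mono) auto
        ultimately show ?thesis by simp
      qed
      have "3 * card J = (\<Sum>a\<in>J. 3)" by simp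
      also have "\<dots> \<le> (\<Sum>a\<in>J. card {b \<in> U. a \<in> b})" by (intro sum_mono lower)
      also have "\<dots> = (\<Sum>b\<in>U. card {a \<in> J. a \<in> b})"
        by (rule sum_multicount_gen[OF finJ finU]) simp
      also have "\<dots> \<le> (\<Sum>b\<in>U. 3)" by (intro sum_mono upper)
      finally show ?thesis by (simp add: U_def)
    qed
  qed
  then obtain f where "inj_on f (X - {p})" "\<forall>a\<in>X - {p}. f a \<in> N a" by metis
  then show thesis by (intro that[of f]) (auto simp: N_def)
qed

text \<open>The blocks through a point \<open>p\<close> are used to make the graph of the chosen pairs connected: every
  other point but one is joined to \<open>p\<close> by a block of its own. The exception is needed to make the
  degree of \<open>p\<close> even. The blocks avoiding \<open>p\<close> then suffice to correct the remaining parities.\<close>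

lemma ex_spanning_choice:
  assumes sqs: "steiner_quadruple_system v X \<B>" and v8: "v \<ge> 8" and p: "p \<in> X"
  obtains e f a0 where "valid_choice \<B> e" "even (deg \<B> e p)"
    "\<And>a. a \<in> X - {p, a0} \<Longrightarrow> f a \<in> \<B> \<and> e (f a) = {p, a}"
proof -
  have fin: "finite \<B>" by (rule finite_blocks[OF sqs])
  have X: "finite X" "card X = v" and blk: "\<And>b. b \<in> \<B> \<Longrightarrow> b \<subseteq> X" "\<And>b. b \<in> \<B> \<Longrightarrow> card b = 4"
    using sqs by (auto simp: steiner_quadruple_system_def)
  obtain f where inj: "inj_on f (X - {p})" and f: "\<And>a. a \<in> X - {p} \<Longrightarrow> f a \<in> \<B> \<and> p \<in> f a \<and> a \<in> f a"
    using ex_representatives[OF sqs v8 p] by metis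
  have "\<exists>d. d \<subseteq> b \<and> card d = 2 \<and> (\<forall>a\<in>X - {p}. f a = b \<longrightarrow> d = {p, a})" if b: "b \<in> \<B>" for b
  proof (cases "b \<in> f ` (X - {p})")
    case True
    then obtain a where a: "a \<in> X - {p}" "b = f a" by blast
    then have "a' = a" if "a' \<in> X - {p}" "f a' = b" for a' using inj_onD[OF inj] that by blast
    then show ?thesis using a f[OF a(1)] by (intro exI[of _ "{p, a}"]) auto
  next
    case False
    obtain d where "d \<subseteq> b" "card d = 2" using obtain_subset_with_card_n[of 2 b] blk(2)[OF b] by auto
    then show ?thesis using False by blast
  qed
  then obtain e where e: "\<And>b. b \<in> \<B> \<Longrightarrow> e b \<subseteq> b \<and> card (e b) = 2 \<and> (\<forall>a\<in>X - {p}. f a = b \<longrightarrow> e b = {p, a})"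
    by metis
  have val: "valid_choice \<B> e" using e by (simp add: valid_choice_def)
  have ef: "e (f a) = {p, a}" if "a \<in> X - {p}" for a using e[of "f a"] f[OF that] that by blast
  have "card (X - {p}) > 0" using X v8 p by simp
  then obtain a0 where a0: "a0 \<in> X - {p}" by (metis card_gt_0_iff ex_in_conv)
  show thesis
  proof (cases "even (deg \<B> e p)")
    case True
    show thesis by (rule that[of e a0 f]) (use val True ef f in auto)
  next
    case False
    have b: "f a0 \<in> \<B>" "p \<in> f a0" "a0 \<in> f a0" using f[OF a0] by auto
    have "finite (f a0)" using blk(1)[OF b(1)] X(1) finite_subset by blast
    moreover have "p \<noteq> a0" using a0 by auto
    ultimately have "card (f a0 - {p, a0}) = 2" using blk(2)[OF b(1)] b by (simp add: card_Diff_subset)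
    then obtain c where "c \<in> f a0 - {p, a0}" by (metis card.empty ex_in_conv zero_neq_numeral)
    then have c: "c \<in> f a0" "c \<noteq> p" "c \<noteq> a0" by auto
    \<comment> \<open>Replacing \<open>p\<close> by \<open>c\<close> in the pair of
      \<open>f a0\<close> changes the parity of the degree of \<open>p\<close>. By injectivity of
      \<open>f\<close> the other representatives keep their pairs.\<close>
    define e' where "e' = e(f a0 := {a0, c})"
    have "valid_choice \<B> e'" using val b c by (simp add: valid_choice_def e'_def)
    moreover have "even (deg \<B> e' p)"
      unfolding e'_def deg_fun_upd[OF fin b(1)] using False ef[OF a0] c a0 by auto
    moreover have "e' (f a) = {p, a}" if "a \<in> X - {p, a0}" for a
    proof -
      have "f a \<noteq> f a0" using inj_onD[OF inj, of a a0] that a0 by auto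
      then show ?thesis using ef[of a] that by (simp add: e'_def)
    qed
    ultimately show thesis using f by (intro that[of e' a0 f]) auto
  qed
qed

text \<open>Among the choices that agree with \<open>e0\<close> on the blocks through
  \<open>p\<close>, one with the fewest points of odd degree is taken. The number of such points is
  even, because the degrees add up to twice the number of blocks; if there were any, two of them
  could be corrected at once.\<close>

theorem sqs_admits_one_ocycle:
  assumes sqs: "steiner_quadruple_system v X \<B>" and v8: "v \<ge> 8"
  shows "admits_one_ocycle \<B>"
proof -
  have fin: "finite \<B>" by (rule finite_blocks[OF sqs])
  have X: "finite X" "card X = v" and blk: "\<And>b. b \<in> \<B> \<Longrightarrow> b \<subseteq> X" "\<And>b. b \<in> \<B> \<Longrightarrow> card b = 4"
    using sqs by (auto simp: steiner_quadruple_system_def)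
  obtain p where p: "p \<in> X" using X v8 by fastforce
  obtain e0 f a0 where e0: "valid_choice \<B> e0" "even (deg \<B> e0 p)"
    and f: "\<And>a. a \<in> X - {p, a0} \<Longrightarrow> f a \<in> \<B> \<and> e0 (f a) = {p, a}"
    using ex_spanning_choice[OF sqs v8 p] by metis
  define good where "good e \<longleftrightarrow> valid_choice \<B> e \<and> (\<forall>b. p \<in> b \<longrightarrow> e b = e0 b)" for e
  define odds where "odds e = {u \<in> X. odd (deg \<B> e u)}" for e
  have "good e0" using e0 by (simp add: good_def)
  then obtain e where good: "good e" and mini: "\<And>e'. good e' \<Longrightarrow> card (odds e) \<le> card (odds e')"
    using ex_has_least_nat[of good e0 "\<lambda>e. card (odds e)"] by metis
  have e: "e b \<subseteq> b" "card (e b) = 2" if "b \<in> \<B>" for b using good that by (auto simp: good_def valid_choice_def)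
  have ep: "e b = e0 b" if "p \<in> b" for b using good that by (simp add: good_def)
  have fino: "finite (odds e)" using X by (simp add: odds_def)
  \<comment> \<open>A pair containing \<open>p\<close> belongs to a block through \<open>p\<close>,
    and the pairs of these blocks are fixed. So the degree of \<open>p\<close> remains even, and
    \<open>p\<close> is never one of the two points to be corrected.\<close>
  have "{b \<in> \<B>. p \<in> e b} = {b \<in> \<B>. p \<in> e0 b}"
    using e(1) ep e0(1) unfolding valid_choice_def by blast
  then have pdeg: "even (deg \<B> e p)" using e0(2) by (simp add: deg_def)
  have "(\<Sum>u\<in>X. deg \<B> e u) = (\<Sum>b\<in>\<B>. card {u \<in> X. u \<in> e b})"
    unfolding deg_def by (rule sum_multicount_gen[OF X(1) fin]) simp
  also have "\<dots> = (\<Sum>b\<in>\<B>. 2)"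
  proof (rule sum.cong[OF refl])
    fix b assume "b \<in> \<B>"
    then have "{u \<in> X. u \<in> e b} = e b" using e(1) blk(1) by blast
    then show "card {u \<in> X. u \<in> e b} = 2" using e(2) \<open>b \<in> \<B>\<close> by simp
  qed
  finally have "even (\<Sum>u\<in>X. deg \<B> e u)" by simp
  then have evenodds: "even (card (odds e))" by (simp add: even_sum_iff[OF X(1)] odds_def)
  have "odds e = {}"
  proof (rule ccontr)
    assume "odds e \<noteq> {}"
    then obtain x where x: "x \<in> odds e" by blast
    have "odds e \<noteq> {x}" using evenodds by auto
    then obtain y where y: "y \<in> odds e" "y \<noteq> x" using x by blast
    have xy: "x \<in> X" "y \<in> X" "p \<noteq> x" "p \<noteq> y" using x y pdeg by (auto simp: odds_def)
    have val: "valid_choice \<B> e" using good by (simp add: good_def)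
    obtain e' where e': "valid_choice \<B> e'" "\<And>b. p \<in> b \<Longrightarrow> e' b = e b"
      "\<And>u. even (deg \<B> e' u) \<longleftrightarrow> (even (deg \<B> e u) \<longleftrightarrow> u \<notin> {x, y})"
      using toggle_pair[OF sqs v8 val p xy(1-4) y(2)[symmetric]] by metis
    have "good e'" using e' ep by (simp add: good_def)
    moreover have "odds e' = odds e - {x, y}" using e'(3) x y by (auto simp: odds_def)
    then have "card (odds e') < card (odds e)" using x fino by (intro psubset_card_mono) auto
    ultimately show False using mini[of e'] by simp
  qed
  then have evenX: "even (deg \<B> e u)" if "u \<in> X" for u using that by (auto simp: odds_def)
  have ef: "f a \<in> \<B>" "e (f a) = {p, a}" if "a \<in> X - {p, a0}" for a
  proof -
    have "p \<in> f a" using f[OF that] e0(1) unfolding valid_choice_def by blast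
    then show "f a \<in> \<B>" "e (f a) = {p, a}" using f[OF that] ep by auto
  qed
  \<comment> \<open>No component of the chosen pairs misses \<open>p\<close>: a pair has two points,
    hence one other than the exceptional \<open>a0\<close>, and unless this point is
    \<open>p\<close> its own block \<open>f a\<close> joins it to \<open>p\<close>.\<close>
  have isolated: "S = {}"
    if S: "S \<subseteq> \<B>" "\<And>b. b \<in> S \<Longrightarrow> p \<notin> e b" and sep: "\<And>b c. b \<in> S \<Longrightarrow> c \<in> \<B> - S \<Longrightarrow> e b \<inter> e c = {}" for S
  proof (rule ccontr)
    assume "S \<noteq> {}"
    then obtain b where b: "b \<in> S" by blast
    have bB: "b \<in> \<B>" using b S by blast
    have "\<not> e b \<subseteq> {a0}" using e(2)[OF bB] card_mono[of "{a0}" "e b"] by auto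
    then obtain a where a: "a \<in> e b" "a \<noteq> a0" by blast
    then have "a \<in> X - {p, a0}" using S(2)[OF b] e(1)[OF bB] blk(1)[OF bB] by auto
    note fa = ef[OF this]
    then have "f a \<notin> S" using S(2)[of "f a"] by auto
    then have "e b \<inter> e (f a) = {}" using sep[OF b] fa by blast
    then show False using a fa by auto
  qed
  show ?thesis
  proof (rule admits_one_ocycle_if_even_connected[of \<B> e])
    show "\<B> \<noteq> {}"
    proof
      assume "\<B> = {}"
      then have "v * (v - 1) * (v - 2) = 0" using card_blocks[OF sqs] by simp
      then show False using v8 by simp
    qed
    show "even (card {b \<in> \<B>. x \<in> e b})" for x
    proof (cases "x \<in> X")
      case True
      then show ?thesis using evenX by (simp add: deg_def)
    next
      case False
      then have none: "{b \<in> \<B>. x \<in> e b} = {}" using e(1) blk(1) by blast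
      show ?thesis unfolding none by simp
    qed
    show "\<exists>b\<in>S. \<exists>c\<in>\<B> - S. e b \<inter> e c \<noteq> {}" if S: "S \<subset> \<B>" "S \<noteq> {}" for S
    proof (rule ccontr)
      assume "\<not> ?thesis"
      then have sep: "\<And>b c. b \<in> S \<Longrightarrow> c \<in> \<B> - S \<Longrightarrow> e b \<inter> e c = {}" by blast
      show False
      proof (cases "\<exists>b\<in>S. p \<in> e b")
        case True
        then obtain b where b: "b \<in> S" "p \<in> e b" by blast
        have "\<B> - S = {}"
        proof (rule isolated)
          show "p \<notin> e c" if "c \<in> \<B> - S" for c using sep[OF b(1) that] b(2) by blast
          show "e c \<inter> e d = {}" if c: "c \<in> \<B> - S" and d: "d \<in> \<B> - (\<B> - S)" for c d
            using sep[OF _ c, of d] d by blast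
        qed auto
        then show False using S by blast
      next
        case False
        have "S = {}" by (rule isolated) (use False S sep in auto)
        then show False using S by blast
      qed
    qed
  qed (use fin blk e in auto)
qed

theorem theorem1p2:
  fixes v :: nat
  assumes "[v = 2] (mod 6) \<or> [v = 4] (mod 6)"
    and "v > 4"
  shows "\<exists>(X :: nat set) \<B>. steiner_quadruple_system v X \<B> \<and> admits_one_ocycle \<B>"
proof -
  have v: "v mod 6 = 2 \<or> v mod 6 = 4" using assms(1) by (simp add: cong_def)
  then have "v \<ge> 8" using assms(2) by presburger
  moreover obtain X :: "nat set" and \<B> where "steiner_quadruple_system v X \<B>"
    using hanani[OF v] by (auto simp: sqs_exists_def)
  ultimately show ?thesis using sqs_admits_one_ocycle by metis
qed

end
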